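(* Let $(\Sigma,\omega)$ be a simplicial tropical $d$-fan in $N_\mathbb{R}$ and $*$ an inner product on $N_\mathbb{R}$. Then for any $D=\sum_{\rho\in\Sigma(1)}z_\rho X_\rho\in A^1(\Sigma)$ with $z\in\mathbb{R}^{\Sigma(1)}$, \[ \mathrm{Vol}_{\Sigma,\omega}(D)=\sum_{\sigma\in\Sigma(d)}\omega(\sigma)\det(G_\sigma)\sum_{f\in L(\sigma)}\prod_{j=1}^d\frac{\det(G_{\sigma(f,j),f(j)}(z))}{\det(G_{\sigma(f,j)})}. \] In particular, if $z\in\overline{\mathrm{Cub}}(\Sigma,* )$ is pseudo-cubical, then $\mathrm{Vol}_{\Sigma,\omega}(D)=\mathrm{Vol}(C_{\Sigma,*}(z);\omega)$.
   Context: $N_\mathbb{R}$ is a finite-dimensional real vector space with dual $M_\mathbb{R}$ and pairing $\langle\cdot,\cdot\rangle$. A fan $\Sigma\subseteq N_\mathbb{R}$ is a polyhedral fan with a chosen generator $u_\rho$ in the relative interior of each ray $\rho\in\Sigma(1)$; $\Sigma(k)$ is the set of $k$-dimensional cones, $\sigma(1)$ the rays of $\sigma$, $\sigma^\circ$ its relative interior. $\Sigma$ is simplicial if the ray generators of each cone are linearly independent; a $d$-fan has all maximal cones of dimension $d$. For $\sigma\in\Sigma$, $N_\sigma=\mathrm{span}_\mathbb{Z}(u_\rho:\rho\in\sigma(1))$ and $N_{\sigma,\mathbb{R}}=N_\sigma\otimes\mathbb{R}$. A simplicial tropical $d$-fan $(\Sigma,\omega)$ is a simplicial $d$-fan with $\omega:\Sigma(d)\to\mathbb{R}_{>0}$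 such that for every $\tau\in\Sigma(d-1)$, $\sum_{\sigma\in\Sigma(d),\tau\prec\sigma}\omega(\sigma)u_{\sigma\setminus\tau}\in N_{\tau,\mathbb{R}}$, where $u_{\sigma\setminus\tau}$ is the generator of the ray of $\sigma$ not in $\tau$. Chow ring: $A^\bullet(\Sigma)=\mathbb{R}[x_\rho:\rho\in\Sigma(1)]/(\mathcal{I}+\mathcal{J})$, $\mathcal{I}$ generated by $x_{\rho_1}\cdots x_{\rho_m}$ with $\mathrm{cone}(\rho_1,\dots,\rho_m)\notin\Sigma$, $\mathcal{J}$ by $\sum_\rho\langle v,u_\rho\rangle x_\rho$ for $v\in M_\mathbb{R}$; $X_\rho=[x_\rho]$, $X_\sigma=\prod_{\rho\in\sigma(1)}X_\rho$. For tropical $(\Sigma,\omega)$ there is a linear map $\deg_{\Sigma,\omega}:A^d(\Sigma)\to\mathbb{R}$ with $\deg_{\Sigma,\omega}(X_\sigma)=\omega(\sigma)$ for all $\sigma\in\Sigma(d)$, and $\mathrm{Vol}_{\Sigma,\omega}(D)=\deg_{\Sigma,\omega}(D^d)$. $L(\sigma)$ is the set of bijections $f:\{1,\dots,d\}\to\sigma(1)$ for $\sigma\in\Sigma(d)$; $\sigma(f,j)$ is the face with rays $\{f(i):i\le j\}$; $G_\sigma=(u_\rho*u_\eta)_{\rho,\eta\in\sigma(1)}$, and $G_{\sigma,\rho}(z)$ replaces the column indexed by $\rho$ with $(z_\eta)_{\eta\in\sigma(1)}$. $z$ is pseudo-cubical, $z\in\overline{\mathrm{Cub}}(\Sigma,*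 )$, if for every $\sigma\in\Sigma$ the set $\sigma\cap\{v: v*u_\rho=z_\rho\ \forall\rho\in\sigma(1)\}$ is nonempty. $P_{\sigma,*}(z)=\sigma\cap\{v: v*u_\rho\le z_\rho\ \forall\rho\in\sigma(1)\}$. $M_\sigma$ is the dual lattice of $N_\sigma$ viewed in $N_{\sigma,\mathbb{R}}$ via $*$, $\mathrm{Vol}_\sigma$ is the volume on $N_{\sigma,\mathbb{R}}$ normalized so a fundamental simplex of $M_\sigma$ has volume $1$, and $\mathrm{Vol}(C_{\Sigma,*}(z);\omega)=\sum_{\sigma\in\Sigma(d)}\omega(\sigma)\mathrm{Vol}_\sigma(P_{\sigma,*}(z))$. *)

theory Defs
  imports
    "HOL-Analysis.Analysis"
    "HOL-Combinatorics.Permutations"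
    "HOL-Algebra.QuotRing"
    "HOL-Library.Poly_Mapping"
begin

section \<open>Fans with marked rays\<close>

text \<open>The ambient vector space is the type \<open>'a\<close>. Its type-class inner product plays no role below;
  the inner product of the theorem is an arbitrary function \<open>ip\<close>.\<close>

definition inner_product :: "('a::real_vector \<Rightarrow> 'a \<Rightarrow> real) \<Rightarrow> bool" where
  "inner_product ip \<longleftrightarrow>
     bilinear ip \<and> (\<forall>x y. ip x y = ip y x) \<and> (\<forall>x. x \<noteq> 0 \<longrightarrow> ip x x > 0)"

definition polyhedral_cone :: "'a::real_vector set \<Rightarrow> bool" where
  "polyhedral_cone \<sigma> \<longleftrightarrow> (\<exists>S. finite S \<and> \<sigma> = convex_cone hull S)"

text \<open>Cones of a fan contain no line. Note that \<open>face_of\<close> regards the empty set as a face.\<close>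

definition polyhedral_fan :: "'a::real_vector set set \<Rightarrow> bool" where
  "polyhedral_fan \<Sigma> \<longleftrightarrow>
     finite \<Sigma> \<and>
     (\<forall>\<sigma>\<in>\<Sigma>. polyhedral_cone \<sigma> \<and> \<sigma> \<inter> uminus ` \<sigma> = {0}) \<and>
     (\<forall>\<sigma>\<in>\<Sigma>. \<forall>\<tau>. \<tau> face_of \<sigma> \<and> \<tau> \<noteq> {} \<longrightarrow> \<tau> \<in> \<Sigma>) \<and>
     (\<forall>\<sigma>\<in>\<Sigma>. \<forall>\<tau>\<in>\<Sigma>. (\<sigma> \<inter> \<tau>) face_of \<sigma> \<and> (\<sigma> \<inter> \<tau>) face_of \<tau>)"

definition cones :: "'a::real_vector set set \<Rightarrow> nat \<Rightarrow> 'a set set" where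
  "cones \<Sigma> k = {\<sigma> \<in> \<Sigma>. dim \<sigma> = k}"

definition rays :: "'a::real_vector set \<Rightarrow> 'a set set" where
  "rays \<sigma> = {\<rho>. \<rho> face_of \<sigma> \<and> dim \<rho> = 1}"

definition marked_fan :: "'a::euclidean_space set set \<Rightarrow> ('a set \<Rightarrow> 'a) \<Rightarrow> bool" where
  "marked_fan \<Sigma> u \<longleftrightarrow> polyhedral_fan \<Sigma> \<and> (\<forall>\<rho>\<in>cones \<Sigma> 1. u \<rho> \<in> rel_interior \<rho>)"

text \<open>Linear independence of the family \<open>(u \<rho>)\<close> indexed by the rays of \<open>\<sigma>\<close>.\<close>

definition independent_rays :: "('a set \<Rightarrow> 'a::real_vector) \<Rightarrow> 'a set \<Rightarrow> bool" where
  "independent_rays u \<sigma> \<longleftrightarrow> inj_on u (rays \<sigma>) \<and> independent (u ` rays \<sigma>)"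

definition simplicial_fan :: "'a::euclidean_space set set \<Rightarrow> ('a set \<Rightarrow> 'a) \<Rightarrow> bool" where
  "simplicial_fan \<Sigma> u \<longleftrightarrow> marked_fan \<Sigma> u \<and> (\<forall>\<sigma>\<in>\<Sigma>. independent_rays u \<sigma>)"

definition pure_fan :: "nat \<Rightarrow> 'a::real_vector set set \<Rightarrow> bool" where
  "pure_fan d \<Sigma> \<longleftrightarrow> (\<forall>\<sigma>\<in>\<Sigma>. (\<forall>\<tau>\<in>\<Sigma>. \<sigma> \<subseteq> \<tau> \<longrightarrow> \<tau> = \<sigma>) \<longrightarrow> dim \<sigma> = d)"

definition opposite_ray :: "'a::real_vector set \<Rightarrow> 'a set \<Rightarrow> 'a set" where
  "opposite_ray \<sigma> \<tau> = (THE \<rho>. \<rho> \<in> rays \<sigma> - rays \<tau>)"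

text \<open>The codimension-one cones are described by \<open>Suc k = d\<close>, so that there are none if \<open>d = 0\<close>.\<close>

definition simplicial_tropical_fan ::
    "nat \<Rightarrow> 'a::euclidean_space set set \<Rightarrow> ('a set \<Rightarrow> 'a) \<Rightarrow> ('a set \<Rightarrow> real) \<Rightarrow> bool" where
  "simplicial_tropical_fan d \<Sigma> u \<omega> \<longleftrightarrow>
     simplicial_fan \<Sigma> u \<and> pure_fan d \<Sigma> \<and>
     (\<forall>\<sigma>\<in>cones \<Sigma> d. \<omega> \<sigma> > 0) \<and>
     (\<forall>k. Suc k = d \<longrightarrow> (\<forall>\<tau>\<in>cones \<Sigma> k.
        (\<Sum>\<sigma> | \<sigma> \<in> cones \<Sigma> d \<and> \<tau> face_of \<sigma>. \<omega> \<sigma> *\<^sub>R u (opposite_ray \<sigma> \<tau>)) \<in> span (u ` rays \<tau>)))"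


section \<open>The Chow ring\<close>

text \<open>A monomial in variables indexed by rays is a finitely supported exponent function, and a
  polynomial is a finitely supported real function on monomials.\<close>

type_synonym 'r mpoly = "('r \<Rightarrow>\<^sub>0 nat) \<Rightarrow>\<^sub>0 real"

definition var :: "'r \<Rightarrow> 'r mpoly" where
  "var \<rho> = Poly_Mapping.single (Poly_Mapping.single \<rho> 1) 1"

definition const :: "real \<Rightarrow> 'r mpoly" where
  "const c = Poly_Mapping.single 0 c"

definition mpoly_ring :: "'r set \<Rightarrow> 'r mpoly ring" where
  "mpoly_ring V =
     \<lparr>carrier = {p. \<forall>m\<in>Poly_Mapping.keys p. Poly_Mapping.keys m \<subseteq> V},
      mult = (*), one = 1, zero = 0, add = (+)\<rparr>"

definition homogeneous :: "nat \<Rightarrow> 'r mpoly \<Rightarrow> bool" where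
  "homogeneous k p \<longleftrightarrow>
     (\<forall>m\<in>Poly_Mapping.keys p. (\<Sum>\<rho>\<in>Poly_Mapping.keys m. Poly_Mapping.lookup m \<rho>) = k)"

definition chow_poly_ring :: "'a::real_vector set set \<Rightarrow> 'a set mpoly ring" where
  "chow_poly_ring \<Sigma> = mpoly_ring (cones \<Sigma> 1)"

definition ideal_I :: "'a::real_vector set set \<Rightarrow> 'a set mpoly set" where
  "ideal_I \<Sigma> = genideal (chow_poly_ring \<Sigma>)
     {\<Prod>\<rho>\<in>S. var \<rho> | S. S \<subseteq> cones \<Sigma> 1 \<and> convex_cone hull (\<Union>S) \<notin> \<Sigma>}"

definition ideal_J :: "'a::real_vector set set \<Rightarrow> ('a set \<Rightarrow> 'a) \<Rightarrow> 'a set mpoly set" where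
  "ideal_J \<Sigma> u = genideal (chow_poly_ring \<Sigma>)
     {\<Sum>\<rho>\<in>cones \<Sigma> 1. const (v (u \<rho>)) * var \<rho> | v. linear v}"

definition chow_ideal :: "'a::real_vector set set \<Rightarrow> ('a set \<Rightarrow> 'a) \<Rightarrow> 'a set mpoly set" where
  "chow_ideal \<Sigma> u = set_add (chow_poly_ring \<Sigma>) (ideal_I \<Sigma>) (ideal_J \<Sigma> u)"

definition chow_ring :: "'a::real_vector set set \<Rightarrow> ('a set \<Rightarrow> 'a) \<Rightarrow> 'a set mpoly set ring" where
  "chow_ring \<Sigma> u = chow_poly_ring \<Sigma> Quot chow_ideal \<Sigma> u"

definition chow_class ::
    "'a::real_vector set set \<Rightarrow> ('a set \<Rightarrow> 'a) \<Rightarrow> 'a set mpoly \<Rightarrow> 'a set mpoly set" where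
  "chow_class \<Sigma> u p = a_r_coset (chow_poly_ring \<Sigma>) (chow_ideal \<Sigma> u) p"

definition chow_scale ::
    "'a::real_vector set set \<Rightarrow> ('a set \<Rightarrow> 'a) \<Rightarrow> real \<Rightarrow> 'a set mpoly set \<Rightarrow> 'a set mpoly set" where
  "chow_scale \<Sigma> u c a = chow_class \<Sigma> u (const c) \<otimes>\<^bsub>chow_ring \<Sigma> u\<^esub> a"

definition chow_graded ::
    "'a::real_vector set set \<Rightarrow> ('a set \<Rightarrow> 'a) \<Rightarrow> nat \<Rightarrow> 'a set mpoly set set" where
  "chow_graded \<Sigma> u k = chow_class \<Sigma> u ` {p \<in> carrier (chow_poly_ring \<Sigma>). homogeneous k p}"

definition X_ray ::
    "'a::real_vector set set \<Rightarrow> ('a set \<Rightarrow> 'a) \<Rightarrow> 'a set \<Rightarrow> 'a set mpoly set" where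
  "X_ray \<Sigma> u \<rho> = chow_class \<Sigma> u (var \<rho>)"

definition X_cone ::
    "'a::real_vector set set \<Rightarrow> ('a set \<Rightarrow> 'a) \<Rightarrow> 'a set \<Rightarrow> 'a set mpoly set" where
  "X_cone \<Sigma> u \<sigma> = (\<Otimes>\<^bsub>chow_ring \<Sigma> u\<^esub>\<rho>\<in>rays \<sigma>. X_ray \<Sigma> u \<rho>)"

definition divisor ::
    "'a::real_vector set set \<Rightarrow> ('a set \<Rightarrow> 'a) \<Rightarrow> ('a set \<Rightarrow> real) \<Rightarrow> 'a set mpoly set" where
  "divisor \<Sigma> u z = (\<Oplus>\<^bsub>chow_ring \<Sigma> u\<^esub>\<rho>\<in>cones \<Sigma> 1. chow_scale \<Sigma> u (z \<rho>) (X_ray \<Sigma> u \<rho>))"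

text \<open>The defining properties of the degree map of a tropical fan; only its values on the
  degree-\<open>d\<close> part of the Chow ring matter.\<close>

definition degree_map ::
    "nat \<Rightarrow> 'a::real_vector set set \<Rightarrow> ('a set \<Rightarrow> 'a) \<Rightarrow> ('a set \<Rightarrow> real) \<Rightarrow>
     ('a set mpoly set \<Rightarrow> real) \<Rightarrow> bool" where
  "degree_map d \<Sigma> u \<omega> deg \<longleftrightarrow>
     (\<forall>a\<in>chow_graded \<Sigma> u d. \<forall>b\<in>chow_graded \<Sigma> u d.
        deg (a \<oplus>\<^bsub>chow_ring \<Sigma> u\<^esub> b) = deg a + deg b) \<and>
     (\<forall>c. \<forall>a\<in>chow_graded \<Sigma> u d. deg (chow_scale \<Sigma> u c a) = c * deg a) \<and>
     (\<forall>\<sigma>\<in>cones \<Sigma> d. deg (X_cone \<Sigma> u \<sigma>) = \<omega> \<sigma>)"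

definition Vol_divisor ::
    "nat \<Rightarrow> 'a::real_vector set set \<Rightarrow> ('a set \<Rightarrow> 'a) \<Rightarrow>
     ('a set mpoly set \<Rightarrow> real) \<Rightarrow> 'a set mpoly set \<Rightarrow> real" where
  "Vol_divisor d \<Sigma> u deg D = deg (D [^]\<^bsub>chow_ring \<Sigma> u\<^esub> d)"


section \<open>Gram determinants and flags\<close>

text \<open>Leibniz formula for a square matrix whose rows and columns are indexed by a finite set, as
  in the library definition for matrices indexed by a finite type.\<close>

definition det_on :: "'i set \<Rightarrow> ('i \<Rightarrow> 'i \<Rightarrow> real) \<Rightarrow> real" where
  "det_on S A = (\<Sum>p | p permutes S. of_int (sign p) * (\<Prod>i\<in>S. A i (p i)))"

definition gram :: "('a \<Rightarrow> 'a \<Rightarrow> real) \<Rightarrow> ('a set \<Rightarrow> 'a) \<Rightarrow> 'a set \<Rightarrow> 'a set \<Rightarrow> real" where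
  "gram ip u = (\<lambda>\<rho> \<eta>. ip (u \<rho>) (u \<eta>))"

definition gram_replace ::
    "('a \<Rightarrow> 'a \<Rightarrow> real) \<Rightarrow> ('a set \<Rightarrow> 'a) \<Rightarrow> 'a set \<Rightarrow> ('a set \<Rightarrow> real) \<Rightarrow> 'a set \<Rightarrow> 'a set \<Rightarrow> real" where
  "gram_replace ip u \<rho> z = (\<lambda>\<eta> \<kappa>. if \<kappa> = \<rho> then z \<eta> else gram ip u \<eta> \<kappa>)"

definition det_gram ::
    "('a \<Rightarrow> 'a \<Rightarrow> real) \<Rightarrow> ('a set \<Rightarrow> 'a::real_vector) \<Rightarrow> 'a set \<Rightarrow> real" where
  "det_gram ip u \<sigma> = det_on (rays \<sigma>) (gram ip u)"

definition det_gram_replace ::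
    "('a \<Rightarrow> 'a \<Rightarrow> real) \<Rightarrow> ('a set \<Rightarrow> 'a::real_vector) \<Rightarrow> 'a set \<Rightarrow> 'a set \<Rightarrow> ('a set \<Rightarrow> real) \<Rightarrow> real"
  where "det_gram_replace ip u \<sigma> \<rho> z = det_on (rays \<sigma>) (gram_replace ip u \<rho> z)"

definition labelings :: "nat \<Rightarrow> 'a::real_vector set \<Rightarrow> (nat \<Rightarrow> 'a set) set" where
  "labelings d \<sigma> = {f \<in> {1..d} \<rightarrow>\<^sub>E rays \<sigma>. bij_betw f {1..d} (rays \<sigma>)}"

definition flag_face :: "'a::real_vector set \<Rightarrow> (nat \<Rightarrow> 'a set) \<Rightarrow> nat \<Rightarrow> 'a set" where
  "flag_face \<sigma> f j = (THE \<tau>. \<tau> face_of \<sigma> \<and> \<tau> \<noteq> {} \<and> rays \<tau> = f ` {1..j})"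


section \<open>Normal complexes and their volume\<close>

definition pseudo_cubical ::
    "'a::real_vector set set \<Rightarrow> ('a set \<Rightarrow> 'a) \<Rightarrow> ('a \<Rightarrow> 'a \<Rightarrow> real) \<Rightarrow> ('a set \<Rightarrow> real) set" where
  "pseudo_cubical \<Sigma> u ip = {z. \<forall>\<sigma>\<in>\<Sigma>. \<sigma> \<inter> {v. \<forall>\<rho>\<in>rays \<sigma>. ip v (u \<rho>) = z \<rho>} \<noteq> {}}"

definition normal_polytope ::
    "('a set \<Rightarrow> 'a::real_vector) \<Rightarrow> ('a \<Rightarrow> 'a \<Rightarrow> real) \<Rightarrow> ('a set \<Rightarrow> real) \<Rightarrow> 'a set \<Rightarrow> 'a set" where
  "normal_polytope u ip z \<sigma> = \<sigma> \<inter> {v. \<forall>\<rho>\<in>rays \<sigma>. ip v (u \<rho>) \<le> z \<rho>}"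

definition cone_lattice :: "('a set \<Rightarrow> 'a::real_vector) \<Rightarrow> 'a set \<Rightarrow> 'a set" where
  "cone_lattice u \<sigma> = {\<Sum>\<rho>\<in>rays \<sigma>. of_int (c \<rho>) *\<^sub>R u \<rho> | c. True}"

definition dual_lattice ::
    "('a set \<Rightarrow> 'a::real_vector) \<Rightarrow> ('a \<Rightarrow> 'a \<Rightarrow> real) \<Rightarrow> 'a set \<Rightarrow> 'a set" where
  "dual_lattice u ip \<sigma> = {m \<in> span (u ` rays \<sigma>). \<forall>n\<in>cone_lattice u \<sigma>. ip m n \<in> \<int>}"

text \<open>The basis of the dual lattice that is dual to \<open>(u \<rho>)\<close>.\<close>

definition dual_vector ::
    "('a set \<Rightarrow> 'a::real_vector) \<Rightarrow> ('a \<Rightarrow> 'a \<Rightarrow> real) \<Rightarrow> 'a set \<Rightarrow> 'a set \<Rightarrow> 'a" where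
  "dual_vector u ip \<sigma> \<rho> =
     (THE m. m \<in> span (u ` rays \<sigma>) \<and> (\<forall>\<eta>\<in>rays \<sigma>. ip m (u \<eta>) = of_bool (\<eta> = \<rho>)))"

definition fundamental_simplex ::
    "('a set \<Rightarrow> 'a::real_vector) \<Rightarrow> ('a \<Rightarrow> 'a \<Rightarrow> real) \<Rightarrow> 'a set \<Rightarrow> 'a set" where
  "fundamental_simplex u ip \<sigma> = convex hull (insert 0 (dual_vector u ip \<sigma> ` rays \<sigma>))"

text \<open>Lebesgue volume on the span of \<open>\<sigma>\<close> in the linear coordinates \<open>v \<mapsto> (v * u \<rho>)\<close>, which are the
  coordinates with respect to the dual basis; any other Lebesgue measure on this space
  is a constant multiple of it.\<close>

definition coord_volume ::
    "('a set \<Rightarrow> 'a::real_vector) \<Rightarrow> ('a \<Rightarrow> 'a \<Rightarrow> real) \<Rightarrow> 'a set \<Rightarrow> 'a set \<Rightarrow> real" where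
  "coord_volume u ip \<sigma> P =
     measure (Pi\<^sub>M (rays \<sigma>) (\<lambda>_. lborel)) ((\<lambda>v. \<lambda>\<rho>\<in>rays \<sigma>. ip v (u \<rho>)) ` P)"

definition Vol_cone ::
    "('a set \<Rightarrow> 'a::real_vector) \<Rightarrow> ('a \<Rightarrow> 'a \<Rightarrow> real) \<Rightarrow> 'a set \<Rightarrow> 'a set \<Rightarrow> real" where
  "Vol_cone u ip \<sigma> P = coord_volume u ip \<sigma> P / coord_volume u ip \<sigma> (fundamental_simplex u ip \<sigma>)"

definition Vol_normal_complex ::
    "nat \<Rightarrow> 'a::real_vector set set \<Rightarrow> ('a set \<Rightarrow> 'a) \<Rightarrow> ('a \<Rightarrow> 'a \<Rightarrow> real) \<Rightarrow>
     ('a set \<Rightarrow> real) \<Rightarrow> ('a set \<Rightarrow> real) \<Rightarrow> real" where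
  "Vol_normal_complex d \<Sigma> u ip z \<omega> =
     (\<Sum>\<sigma>\<in>cones \<Sigma> d. \<omega> \<sigma> * Vol_cone u ip \<sigma> (normal_polytope u ip z \<sigma>))"


section \<open>Sanity checks for the volume normalization\<close>

lemma inner_product_simps:
  assumes "inner_product ip"
  shows "ip (x + y) w = ip x w + ip y w" "ip w (x + y) = ip w x + ip w y"
    "ip (x - y) w = ip x w - ip y w" "ip (c *\<^sub>R x) w = c * ip x w" "ip w (c *\<^sub>R x) = c * ip w x"
    "ip (sum g A) w = (\<Sum>i\<in>A. ip (g i) w)" "ip w (sum g A) = (\<Sum>i\<in>A. ip w (g i))"
    "ip 0 w = 0" "ip w 0 = 0"
proof -
  have l1: "linear (\<lambda>x. ip x w)" and l2: "linear (ip w)" for w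
    using assms by (auto simp: inner_product_def bilinear_def)
  show "ip (x + y) w = ip x w + ip y w" "ip (x - y) w = ip x w - ip y w"
    "ip (c *\<^sub>R x) w = c * ip x w" "ip (sum g A) w = (\<Sum>i\<in>A. ip (g i) w)" "ip 0 w = 0"
    using linear_add[OF l1] linear_diff[OF l1] linear_scale[OF l1] linear_sum[OF l1] linear_0[OF l1]
    by auto
  show "ip w (x + y) = ip w x + ip w y" "ip w (c *\<^sub>R x) = c * ip w x"
    "ip w (sum g A) = (\<Sum>i\<in>A. ip w (g i))" "ip w 0 = 0"
    using linear_add[OF l2] linear_scale[OF l2] linear_sum[OF l2] linear_0[OF l2]
    by auto
qed

lemma ip_span_zero:
  assumes ip: "inner_product ip" and x: "x \<in> span B" and z: "\<And>b. b \<in> B \<Longrightarrow> ip w b = 0"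
  shows "ip w x = 0"
  using x
proof (induction rule: span_induct_alt)
  case base
  then show ?case by (simp add: inner_product_simps[OF ip])
next
  case (step c b y)
  then show ?case by (simp add: inner_product_simps[OF ip] z)
qed

lemma span_prescribed_products:
  fixes B :: "'a::real_vector set"
  assumes ip: "inner_product ip" and "finite B" "independent B"
  shows "\<exists>v\<in>span B. \<forall>b\<in>B. ip v b = f b"
  using assms(2,3)
proof (induction B arbitrary: f rule: finite_induct)
  case empty
  then show ?case by (auto intro: span_zero)
next
  case (insert b B)
  have ind: "independent B" and nb: "b \<notin> span B"
    using insert by (auto simp: independent_insert)
  obtain p where p: "p \<in> span B" "\<forall>c\<in>B. ip p c = ip b c"
    using insert.IH[OF ind, of "ip b"] by blast
  obtain v where v: "v \<in> span B" "\<forall>c\<in>B. ip v c = f c"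
    using insert.IH[OF ind, of f] by blast
  define q where "q = b - p"
  have qB: "ip q c = 0" if "c \<in> B" for c
    using p that by (simp add: q_def inner_product_simps[OF ip])
  have "q \<noteq> 0" using nb p by (auto simp: q_def)
  then have "ip q q > 0" using ip by (simp add: inner_product_def)
  moreover have "ip q p = 0" using ip_span_zero[OF ip p(1)] qB by blast
  moreover have "ip q b = ip q q + ip q p"
    by (simp add: q_def inner_product_simps(2)[OF ip, symmetric])
  ultimately have qb: "ip q b > 0" by simp
  define w where "w = v + ((f b - ip v b) / ip q b) *\<^sub>R q"
  have "span B \<subseteq> span (insert b B)" by (rule span_mono) auto
  then have "v \<in> span (insert b B)" "q \<in> span (insert b B)"
    using v p by (auto simp: q_def intro!: span_diff intro: span_base)
  then have "w \<in> span (insert b B)"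
    unfolding w_def by (intro span_add span_mul)
  moreover have "\<forall>c\<in>insert b B. ip w c = f c"
    using v qB qb by (auto simp: w_def inner_product_simps[OF ip])
  ultimately show ?case by blast
qed

lemma span_products_unique:
  assumes ip: "inner_product ip" and "v \<in> span B" "w \<in> span B" "\<And>b. b \<in> B \<Longrightarrow> ip v b = ip w b"
  shows "v = w"
proof -
  have "ip (v - w) (v - w) = 0"
    by (rule ip_span_zero[OF ip]) (use assms in \<open>auto simp: inner_product_simps[OF ip] intro: span_diff\<close>)
  moreover have "ip (v - w) (v - w) > 0" if "v - w \<noteq> 0"
    using ip that unfolding inner_product_def by blast
  ultimately show ?thesis by fastforce
qed

lemma finite_rays:
  fixes u :: "'a::euclidean_space set \<Rightarrow> 'a"
  assumes "independent_rays u \<sigma>"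
  shows "finite (rays \<sigma>)"
  using assms finite_imageD[of u "rays \<sigma>"] independent_imp_finite by (auto simp: independent_rays_def)

lemma dual_vector:
  fixes u :: "'a::euclidean_space set \<Rightarrow> 'a"
  assumes ip: "inner_product ip" and ind: "independent_rays u \<sigma>" and "\<rho> \<in> rays \<sigma>"
  shows "dual_vector u ip \<sigma> \<rho> \<in> span (u ` rays \<sigma>)"
    "\<And>\<eta>. \<eta> \<in> rays \<sigma> \<Longrightarrow> ip (dual_vector u ip \<sigma> \<rho>) (u \<eta>) = of_bool (\<eta> = \<rho>)"
proof -
  let ?P = "\<lambda>m. m \<in> span (u ` rays \<sigma>) \<and> (\<forall>\<eta>\<in>rays \<sigma>. ip m (u \<eta>) = of_bool (\<eta> = \<rho>))"
  have inj: "inj_on u (rays \<sigma>)" using ind by (simp add: independent_rays_def)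
  obtain m where "m \<in> span (u ` rays \<sigma>)"
      "\<forall>b\<in>u ` rays \<sigma>. ip m b = of_bool (the_inv_into (rays \<sigma>) u b = \<rho>)"
    using span_prescribed_products[OF ip, of "u ` rays \<sigma>" "\<lambda>b. of_bool (the_inv_into (rays \<sigma>) u b = \<rho>)"]
      finite_rays[OF ind] ind by (auto simp: independent_rays_def)
  then have "?P m" by (auto simp: the_inv_into_f_f[OF inj])
  moreover have "m' = m''" if "?P m'" "?P m''" for m' m''
    by (rule span_products_unique[OF ip]) (use that in auto)
  ultimately have "\<exists>!m. ?P m" by blast
  from theI'[OF this] have "?P (dual_vector u ip \<sigma> \<rho>)"
    unfolding dual_vector_def .
  then show "dual_vector u ip \<sigma> \<rho> \<in> span (u ` rays \<sigma>)"
    "\<And>\<eta>. \<eta> \<in> rays \<sigma> \<Longrightarrow> ip (dual_vector u ip \<sigma> \<rho>) (u \<eta>) = of_bool (\<eta> = \<rho>)" by auto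
qed

lemma ip_sum_dual_vector:
  fixes u :: "'a::euclidean_space set \<Rightarrow> 'a"
  assumes ip: "inner_product ip" and ind: "independent_rays u \<sigma>" and \<eta>: "\<eta> \<in> rays \<sigma>"
  shows "ip (\<Sum>\<rho>\<in>rays \<sigma>. c \<rho> *\<^sub>R dual_vector u ip \<sigma> \<rho>) (u \<eta>) = c \<eta>"
proof -
  have "ip (\<Sum>\<rho>\<in>rays \<sigma>. c \<rho> *\<^sub>R dual_vector u ip \<sigma> \<rho>) (u \<eta>)
      = (\<Sum>\<rho>\<in>rays \<sigma>. if \<eta> = \<rho> then c \<rho> else 0)"
    unfolding inner_product_simps[OF ip] by (rule sum.cong) (auto simp: dual_vector[OF ip ind] \<eta>)
  then show ?thesis using finite_rays[OF ind] \<eta> by simp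
qed

lemma dual_lattice_basis:
  fixes u :: "'a::euclidean_space set \<Rightarrow> 'a"
  assumes ip: "inner_product ip" and ind: "independent_rays u \<sigma>"
  shows "dual_lattice u ip \<sigma> = {\<Sum>\<rho>\<in>rays \<sigma>. of_int (c \<rho>) *\<^sub>R dual_vector u ip \<sigma> \<rho> | c. True}"
    (is "?L = ?R")
proof
  show "?R \<subseteq> ?L"
  proof
    fix m assume "m \<in> ?R"
    then obtain c :: "'a set \<Rightarrow> int"
      where m: "m = (\<Sum>\<rho>\<in>rays \<sigma>. of_int (c \<rho>) *\<^sub>R dual_vector u ip \<sigma> \<rho>)" by blast
    have "ip m n \<in> \<int>" if n_mem: "n \<in> cone_lattice u \<sigma>" for n
    proof -
      obtain e :: "'a set \<Rightarrow> int" where n: "n = (\<Sum>\<rho>\<in>rays \<sigma>. of_int (e \<rho>) *\<^sub>R u \<rho>)"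
        using n_mem unfolding cone_lattice_def by blast
      show ?thesis
        unfolding n inner_product_simps(5,7)[OF ip] m
        by (intro Ints_sum Ints_mult) (auto simp: ip_sum_dual_vector[OF ip ind])
    qed
    moreover have "m \<in> span (u ` rays \<sigma>)"
      unfolding m by (intro span_sum span_mul dual_vector(1)[OF ip ind])
    ultimately show "m \<in> ?L" by (simp add: dual_lattice_def)
  qed
  show "?L \<subseteq> ?R"
  proof
    fix m assume m: "m \<in> ?L"
    have "u \<rho> \<in> cone_lattice u \<sigma>" if "\<rho> \<in> rays \<sigma>" for \<rho>
    proof -
      have "(\<Sum>\<eta>\<in>rays \<sigma>. of_int (of_bool (\<eta> = \<rho>)) *\<^sub>R u \<eta>) = (\<Sum>\<eta>\<in>rays \<sigma>. if \<eta> = \<rho> then u \<eta> else 0)"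
        by (rule sum.cong) auto
      also have "\<dots> = u \<rho>" using that finite_rays[OF ind] by simp
      finally show ?thesis
        unfolding cone_lattice_def by (intro CollectI exI[of _ "\<lambda>\<eta>. of_bool (\<eta> = \<rho>)"]) simp
    qed
    then have "\<exists>k::int. ip m (u \<rho>) = of_int k" if "\<rho> \<in> rays \<sigma>" for \<rho>
      using m that by (auto simp: dual_lattice_def elim!: Ints_cases)
    then obtain c :: "'a set \<Rightarrow> int" where c: "\<And>\<rho>. \<rho> \<in> rays \<sigma> \<Longrightarrow> ip m (u \<rho>) = of_int (c \<rho>)"
      by metis
    have "m = (\<Sum>\<rho>\<in>rays \<sigma>. of_int (c \<rho>) *\<^sub>R dual_vector u ip \<sigma> \<rho>)"
    proof (rule span_products_unique[OF ip, of _ "u ` rays \<sigma>"])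
      show "m \<in> span (u ` rays \<sigma>)" using m by (simp add: dual_lattice_def)
      show "(\<Sum>\<rho>\<in>rays \<sigma>. of_int (c \<rho>) *\<^sub>R dual_vector u ip \<sigma> \<rho>) \<in> span (u ` rays \<sigma>)"
        by (intro span_sum span_mul dual_vector(1)[OF ip ind])
    qed (auto simp: c ip_sum_dual_vector[OF ip ind])
    then show "m \<in> ?R" by blast
  qed
qed

text \<open>The fundamental simplex has volume \<open>1/k!\<close> in the chosen coordinates, where \<open>k\<close> is the number
  of rays; in particular \<open>Vol_cone\<close> does not divide by zero.\<close>

lemma coord_volume_fundamental_simplex:
  fixes u :: "'a::euclidean_space set \<Rightarrow> 'a"
  assumes ip: "inner_product ip" and ind: "independent_rays u \<sigma>"
  shows "coord_volume u ip \<sigma> (fundamental_simplex u ip \<sigma>) = 1 / fact (card (rays \<sigma>))"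
proof -
  let ?R = "rays \<sigma>" and ?m = "dual_vector u ip \<sigma>"
  let ?\<phi> = "\<lambda>v. \<lambda>\<rho>\<in>?R. ip v (u \<rho>)"
  let ?T = "{x::'a set \<Rightarrow> real. (\<forall>\<rho>\<in>?R. 0 \<le> x \<rho>) \<and> sum x ?R \<le> 1} \<inter> space (Pi\<^sub>M ?R (\<lambda>_. lborel))"
  have fin: "finite ?R" using finite_rays[OF ind] .
  have inj: "inj_on ?m ?R"
  proof (rule inj_onI)
    fix \<rho> \<eta> assume "\<rho> \<in> ?R" "\<eta> \<in> ?R" "?m \<rho> = ?m \<eta>"
    then show "\<rho> = \<eta>" using dual_vector(2)[OF ip ind, of \<rho> \<rho>] dual_vector(2)[OF ip ind, of \<eta> \<rho>]
      by (simp split: if_splits)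
  qed
  have nz: "0 \<notin> ?m ` ?R"
  proof
    assume "0 \<in> ?m ` ?R"
    then obtain \<rho> where \<rho>: "\<rho> \<in> ?R" "?m \<rho> = 0" by force
    have "ip (?m \<rho>) (u \<rho>) = 1" using dual_vector(2)[OF ip ind \<rho>(1) \<rho>(1)] by simp
    then show False using \<rho>(2) inner_product_simps(8)[OF ip] by simp
  qed
  have hull: "fundamental_simplex u ip \<sigma> =
      {\<Sum>\<rho>\<in>?R. c \<rho> *\<^sub>R ?m \<rho> | c. (\<forall>\<rho>\<in>?R. 0 \<le> c \<rho>) \<and> sum c ?R \<le> 1}" (is "_ = ?H")
  proof
    show "fundamental_simplex u ip \<sigma> \<subseteq> ?H"
    proof
      fix x assume "x \<in> fundamental_simplex u ip \<sigma>"
      then obtain e where e: "\<forall>y\<in>insert 0 (?m ` ?R). 0 \<le> e y" "sum e (insert 0 (?m ` ?R)) = 1"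
          "(\<Sum>y\<in>insert 0 (?m ` ?R). e y *\<^sub>R y) = x"
        using fin unfolding fundamental_simplex_def by (subst (asm) convex_hull_finite) blast+
      have "e 0 \<ge> 0" "e 0 + sum e (?m ` ?R) = 1" "(\<Sum>y\<in>?m ` ?R. e y *\<^sub>R y) = x"
        using e fin nz by simp_all
      then have "sum (e \<circ> ?m) ?R \<le> 1" "x = (\<Sum>\<rho>\<in>?R. (e \<circ> ?m) \<rho> *\<^sub>R ?m \<rho>)"
        by (simp_all add: sum.reindex[OF inj])
      moreover have "\<forall>\<rho>\<in>?R. 0 \<le> (e \<circ> ?m) \<rho>" using e(1) by simp
      ultimately show "x \<in> ?H" by blast
    qed
    show "?H \<subseteq> fundamental_simplex u ip \<sigma>"
    proof
      fix x assume "x \<in> ?H"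
      then obtain c where c: "\<forall>\<rho>\<in>?R. 0 \<le> c \<rho>" "sum c ?R \<le> 1" "x = (\<Sum>\<rho>\<in>?R. c \<rho> *\<^sub>R ?m \<rho>)" by blast
      define e where "e y = (if y = 0 then 1 - sum c ?R else c (the_inv_into ?R ?m y))" for y
      have em: "e (?m \<rho>) = c \<rho>" if "\<rho> \<in> ?R" for \<rho>
        using that nz by (auto simp: e_def the_inv_into_f_f[OF inj])
      have "\<forall>y\<in>insert 0 (?m ` ?R). 0 \<le> e y"
        using c(1,2) em by (simp add: e_def)
      moreover have "sum e (?m ` ?R) = sum c ?R"
        using em by (simp add: sum.reindex[OF inj])
      then have "sum e (insert 0 (?m ` ?R)) = 1"
        using fin nz by (simp add: e_def)
      moreover have "(\<Sum>y\<in>?m ` ?R. e y *\<^sub>R y) = x"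
        using em unfolding c(3) by (simp add: sum.reindex[OF inj])
      then have "(\<Sum>y\<in>insert 0 (?m ` ?R). e y *\<^sub>R y) = x"
        using fin nz by simp
      ultimately have "\<exists>e. (\<forall>y\<in>insert 0 (?m ` ?R). 0 \<le> e y) \<and> sum e (insert 0 (?m ` ?R)) = 1 \<and>
          (\<Sum>y\<in>insert 0 (?m ` ?R). e y *\<^sub>R y) = x" by blast
      then show "x \<in> fundamental_simplex u ip \<sigma>"
        unfolding fundamental_simplex_def using fin by (subst convex_hull_finite) blast+
    qed
  qed
  have "?\<phi> ` fundamental_simplex u ip \<sigma> = ?T"
  proof
    show "?\<phi> ` fundamental_simplex u ip \<sigma> \<subseteq> ?T"
    proof
      fix y assume "y \<in> ?\<phi> ` fundamental_simplex u ip \<sigma>"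
      then obtain c where c: "\<forall>\<rho>\<in>?R. 0 \<le> c \<rho>" "sum c ?R \<le> 1"
          "y = ?\<phi> (\<Sum>\<rho>\<in>?R. c \<rho> *\<^sub>R ?m \<rho>)" unfolding hull by blast
      have "y = restrict c ?R"
        unfolding c(3) by (rule restrict_ext) (rule ip_sum_dual_vector[OF ip ind])
      then show "y \<in> ?T" using c(1,2) by (simp add: space_PiM)
    qed
    show "?T \<subseteq> ?\<phi> ` fundamental_simplex u ip \<sigma>"
    proof
      fix x assume x: "x \<in> ?T"
      then have "x = ?\<phi> (\<Sum>\<rho>\<in>?R. x \<rho> *\<^sub>R ?m \<rho>)"
        by (intro ext) (simp add: ip_sum_dual_vector[OF ip ind] space_PiM PiE_def extensional_def)
      moreover have "(\<Sum>\<rho>\<in>?R. x \<rho> *\<^sub>R ?m \<rho>) \<in> fundamental_simplex u ip \<sigma>"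
        unfolding hull using x by blast
      ultimately show "x \<in> ?\<phi> ` fundamental_simplex u ip \<sigma>" by blast
    qed
  qed
  then show ?thesis
    using emeasure_std_simplex_aux[OF fin, of 1] by (simp add: coord_volume_def measure_def)
qed

end

theory Submission
  imports Defs
begin

text \<open>For a cone \<open>\<tau>\<close> let \<open>w\<^sub>\<tau>\<close> be the point of its span with \<open>w\<^sub>\<tau> * u\<^sub>\<rho> = z\<^sub>\<rho>\<close> on the rays of \<open>\<tau>\<close>. The linear
  relation of \<open>v = w\<^sub>\<tau> * _\<close> gives \<open>D X\<^sub>\<tau> = \<Sum> (z\<^sub>\<rho> - w\<^sub>\<tau> * u\<^sub>\<rho>) X\<^sub>\<sigma>\<close>, summed over the cones \<open>\<sigma>\<close> that arise from \<open>\<tau>\<close> by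
  adding one ray \<open>\<rho>\<close>, and a column operation shows that \<open>z\<^sub>\<rho> - w\<^sub>\<tau> * u\<^sub>\<rho>\<close> is the quotient of the determinants of
  \<open>G\<^sub>\<sigma>\<^sub>,\<^sub>\<rho>(z)\<close> and \<open>G\<^sub>\<tau>\<close>. Iterating from \<open>\<tau> = {0}\<close> expands \<open>D\<^sup>d\<close> over flags, and the Gram determinants telescope.

  In the pseudo-cubical case the polytope of a maximal cone is cut into pyramids with apex \<open>w\<^sub>\<tau>\<close> over its
  facets on \<open>v * u\<^sub>\<rho> = z\<^sub>\<rho>\<close>, starting with \<open>\<tau> = {0}\<close>; in the coordinates \<open>v * u\<^sub>\<rho>\<close> the height of such a pyramid is again
  \<open>z\<^sub>\<rho> - w\<^sub>\<tau> * u\<^sub>\<rho>\<close>, so that the volume satisfies the same recursion.\<close>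

section \<open>Injective sequences with image in a simplicial complex\<close>

text \<open>Algebra and geometry are brought to one normal form, a sum of products of
  \<open>excess\<close> over sequences of rays whose initial segments span faces. Hence
  \<open>seqs\<close> and its recursion are stated for an arbitrary complex: the ray sets of the
  whole fan for powers of the divisor, \<open>Pow (rays \<sigma>)\<close> for the polytope of one
  cone. In the power of the divisor the obstacle is self-intersection: the degree map prescribes no
  value for a monomial with a repeated ray. The relation attached to the foot removes exactly the
  rays already chosen, and nonfaces lie in the ideal, so only faces survive. In the geometry the
  pyramids tile the polytope only if their heights are nonnegative. Pseudo-cubicality places each
  foot in its own face, and positive definiteness of the inverse Gram matrix turns this into
  nonnegative heights. Overlaps, and points in no pyramid, form null sets. A pyramid in dimension n
  contributes 1/n; the resulting 1/d! cancels against the coordinate volume of the fundamental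
  simplex.\<close>

definition seqs :: "nat \<Rightarrow> 'r set set \<Rightarrow> (nat \<Rightarrow> 'r) set" where
  "seqs k C = {f \<in> {1..k} \<rightarrow>\<^sub>E \<Union>C. inj_on f {1..k} \<and> f ` {1..k} \<in> C}"

lemma finite_seqs: "finite C \<Longrightarrow> (\<And>T. T \<in> C \<Longrightarrow> finite T) \<Longrightarrow> finite (seqs k C)"
  unfolding seqs_def by (intro finite_Collect_conjI disjI1) (auto intro!: finite_PiE)

lemma seqs_0: "{} \<in> C \<Longrightarrow> seqs 0 C = {\<lambda>_. undefined}"
  by (auto simp: seqs_def)

lemma image_fun_upd_Suc: "(f(Suc k := \<rho>)) ` {1..k} = f ` {1..k}"
  by (rule image_cong) auto

lemma image_fun_upd_Suc': "(f(Suc k := \<rho>)) ` {1..Suc k} = insert \<rho> (f ` {1..k})"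
proof -
  have "{1..Suc k} = insert (Suc k) {1..k}" by auto
  then show ?thesis by (simp only: image_insert fun_upd_same image_fun_upd_Suc)
qed

text \<open>The bijection cuts off the last entry. Downward closure of \<open>C\<close> puts the
  image of the shortened sequence back into \<open>C\<close>.\<close>

lemma sum_seqs_Suc:
  fixes F :: "(nat \<Rightarrow> 'r) \<Rightarrow> 'b::comm_monoid_add"
  assumes fin: "finite C" "\<And>T. T \<in> C \<Longrightarrow> finite T" and down: "\<And>T U. T \<in> C \<Longrightarrow> U \<subseteq> T \<Longrightarrow> U \<in> C"
  shows "sum F (seqs (Suc k) C) =
    (\<Sum>f\<in>seqs k C. \<Sum>\<rho> | \<rho> \<notin> f ` {1..k} \<and> insert \<rho> (f ` {1..k}) \<in> C. F (f(Suc k := \<rho>)))"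
proof -
  let ?R = "\<lambda>f. {\<rho>. \<rho> \<notin> f ` {1..k} \<and> insert \<rho> (f ` {1..k}) \<in> C}"
  have "?R f \<subseteq> \<Union>C" for f by auto
  then have finR: "\<forall>f\<in>seqs k C. finite (?R f)"
    using fin by (meson finite_Union finite_subset)
  have "sum F (seqs (Suc k) C) = (\<Sum>(f, \<rho>)\<in>Sigma (seqs k C) ?R. F (f(Suc k := \<rho>)))"
  proof (rule sum.reindex_bij_witness[of _ "\<lambda>(f, \<rho>). f(Suc k := \<rho>)" "\<lambda>g. (restrict g {1..k}, g (Suc k))"])
    fix g assume g: "g \<in> seqs (Suc k) C"
    then have gE: "g \<in> extensional {1..Suc k}" and inj: "inj_on g {1..Suc k}" and im: "g ` {1..Suc k} \<in> C"
      by (auto simp: seqs_def PiE_def)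
    have S: "{1..Suc k} = insert (Suc k) {1..k}" by auto
    have "(restrict g {1..k})(Suc k := g (Suc k)) = g"
      using gE by (auto simp: fun_eq_iff extensional_def)
    then show "(\<lambda>(f, \<rho>). f(Suc k := \<rho>)) (restrict g {1..k}, g (Suc k)) = g"
      "(case (restrict g {1..k}, g (Suc k)) of (f, \<rho>) \<Rightarrow> F (f(Suc k := \<rho>))) = F g" by simp_all
    have "g ` {1..k} \<subseteq> g ` {1..Suc k}" by auto
    then have "g ` {1..k} \<in> C" using down im by blast
    moreover have "inj_on g {1..k}" using inj by (rule inj_on_subset) auto
    ultimately have "restrict g {1..k} \<in> seqs k C"
      by (auto simp: seqs_def inj_on_restrict_eq image_restrict_eq)
    moreover have "g (Suc k) \<in> ?R (restrict g {1..k})"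
      using inj im unfolding S by (auto simp: image_restrict_eq)
    ultimately show "(restrict g {1..k}, g (Suc k)) \<in> Sigma (seqs k C) ?R" by blast
  next
    fix p assume p: "p \<in> Sigma (seqs k C) ?R"
    obtain f \<rho> where p_def: "p = (f, \<rho>)" by fastforce
    have f: "f \<in> {1..k} \<rightarrow>\<^sub>E \<Union>C" "inj_on f {1..k}" "\<rho> \<notin> f ` {1..k}" "insert \<rho> (f ` {1..k}) \<in> C"
      using p by (auto simp: p_def seqs_def)
    have "restrict (f(Suc k := \<rho>)) {1..k} = f"
      using f(1) by (auto simp: fun_eq_iff PiE_def extensional_def)
    then show "(\<lambda>g. (restrict g {1..k}, g (Suc k))) ((\<lambda>(f, \<rho>). f(Suc k := \<rho>)) p) = p"
      by (simp add: p_def)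
    have "inj_on (f(Suc k := \<rho>)) {1..k} = inj_on f {1..k}"
      by (rule inj_on_cong) simp
    then have "inj_on (f(Suc k := \<rho>)) (insert (Suc k) {1..k})"
      using f(2,3) image_fun_upd_Suc[of f k \<rho>] by (simp add: inj_on_insert)
    moreover have S: "{1..Suc k} = insert (Suc k) {1..k}" by auto
    ultimately have "inj_on (f(Suc k := \<rho>)) {1..Suc k}" by (simp only: S)
    moreover have "(f(Suc k := \<rho>)) ` {1..Suc k} \<in> C"
      using f(4) by (simp only: image_fun_upd_Suc')
    moreover have "f(Suc k := \<rho>) \<in> {1..Suc k} \<rightarrow>\<^sub>E \<Union>C"
    proof (rule PiE_I)
      fix x assume "x \<in> {1..Suc k}"
      then consider "x = Suc k" | "x \<in> {1..k}" by fastforce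
      then show "(f(Suc k := \<rho>)) x \<in> \<Union>C"
      proof cases
        case 1
        then show ?thesis using f(4) by auto
      next
        case 2
        then show ?thesis using PiE_mem[OF f(1) 2] by auto
      qed
    next
      fix x assume "x \<notin> {1..Suc k}"
      then have "x \<noteq> Suc k" "x \<notin> {1..k}" by auto
      then show "(f(Suc k := \<rho>)) x = undefined" using PiE_arb[OF f(1)] by simp
    qed
    ultimately show "(\<lambda>(f, \<rho>). f(Suc k := \<rho>)) p \<in> seqs (Suc k) C"
      by (simp only: p_def seqs_def mem_Collect_eq prod.case)
  qed
  also have "\<dots> = (\<Sum>f\<in>seqs k C. \<Sum>\<rho>\<in>?R f. F (f(Suc k := \<rho>)))"
    using finite_seqs[OF fin] finR by (simp add: sum.Sigma)
  finally show ?thesis .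
qed

text \<open>A step is weighted by the face reached before it: the interval \<open>{1..<j}\<close>
  excludes \<open>j\<close>, so the first factor belongs to the empty set of rays.\<close>

definition seq_weight :: "('r set \<Rightarrow> 'r \<Rightarrow> 'b::comm_monoid_mult) \<Rightarrow> nat \<Rightarrow> (nat \<Rightarrow> 'r) \<Rightarrow> 'b" where
  "seq_weight a k f = (\<Prod>j=1..k. a (f ` {1..<j}) (f j))"

lemma seq_weight_0: "seq_weight a 0 f = 1"
  by (simp add: seq_weight_def)

lemma seq_weight_Suc:
  "seq_weight a (Suc k) (f(Suc k := \<rho>)) = seq_weight a k f * a (f ` {1..k}) \<rho>"
proof -
  have "(\<Prod>j=1..k. a ((f(Suc k := \<rho>)) ` {1..<j}) ((f(Suc k := \<rho>)) j)) = seq_weight a k f"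
    unfolding seq_weight_def
  proof (rule prod.cong)
    fix j assume "j \<in> {1..k}"
    moreover from this have "(f(Suc k := \<rho>)) ` {1..<j} = f ` {1..<j}" by (intro image_cong) auto
    ultimately show "a ((f(Suc k := \<rho>)) ` {1..<j}) ((f(Suc k := \<rho>)) j) = a (f ` {1..<j}) (f j)" by simp
  qed simp
  moreover have "(f(Suc k := \<rho>)) ` {1..<Suc k} = f ` {1..k}" by (intro image_cong) auto
  ultimately show ?thesis unfolding seq_weight_def by (simp add: prod.nat_ivl_Suc')
qed

section \<open>Gram determinants\<close>

text \<open>A permutation uses column \<open>r\<close> exactly once, in row
  \<open>Hilbert_Choice.inv p r\<close>; isolating that factor makes linearity in the column
  visible.\<close>

lemma prod_column:
  fixes A :: "'i \<Rightarrow> 'i \<Rightarrow> real"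
  assumes "finite S" and p: "p permutes S" and "r \<in> S"
  shows "(\<Prod>i\<in>S. if p i = r then b i else A i (p i)) =
    b (Hilbert_Choice.inv p r) * (\<Prod>i\<in>S - {Hilbert_Choice.inv p r}. A i (p i))"
proof -
  have r: "Hilbert_Choice.inv p r \<in> S" using permutes_in_image[OF permutes_inv[OF p]] assms(3) by simp
  have "(\<Prod>i\<in>S - {Hilbert_Choice.inv p r}. if p i = r then b i else A i (p i)) = (\<Prod>i\<in>S - {Hilbert_Choice.inv p r}. A i (p i))"
    by (rule prod.cong) (use permutes_inverses(2)[OF p] in auto)
  then show ?thesis
    using prod.remove[OF assms(1) r, of "\<lambda>i. if p i = r then b i else A i (p i)"]
    by (simp add: permutes_inverses(1)[OF p])
qed

lemma det_on_column_sum: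
  assumes "finite S" "r \<in> S"
  shows "det_on S (\<lambda>i j. if j = r then \<Sum>k\<in>K. c k * B k i else A i j) =
    (\<Sum>k\<in>K. c k * det_on S (\<lambda>i j. if j = r then B k i else A i j))"
proof -
  have "det_on S (\<lambda>i j. if j = r then \<Sum>k\<in>K. c k * B k i else A i j) =
      (\<Sum>p | p permutes S. \<Sum>k\<in>K. c k * (of_int (sign p) *
        (\<Prod>i\<in>S. if p i = r then B k i else A i (p i))))"
    unfolding det_on_def
  proof (rule sum.cong)
    fix p assume "p \<in> {p. p permutes S}"
    then have p: "p permutes S" by simp
    show "of_int (sign p) * (\<Prod>i\<in>S. if p i = r then \<Sum>k\<in>K. c k * B k i else A i (p i)) =
        (\<Sum>k\<in>K. c k * (of_int (sign p) * (\<Prod>i\<in>S. if p i = r then B k i else A i (p i))))"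
      using prod_column[OF assms(1) p assms(2), of "\<lambda>i. \<Sum>k\<in>K. c k * B k i" A]
      by (simp add: prod_column[OF assms(1) p assms(2)] sum_distrib_left sum_distrib_right ac_simps)
  qed simp
  also have "\<dots> = (\<Sum>k\<in>K. c k * det_on S (\<lambda>i j. if j = r then B k i else A i j))"
    unfolding det_on_def by (subst sum.swap) (simp add: sum_distrib_left)
  finally show ?thesis .
qed

text \<open>Composing with the transposition of \<open>r\<close> and \<open>s\<close> flips every
  sign and keeps every product, so the determinant equals its negative.\<close>

lemma det_on_equal_columns:
  assumes "finite S" "r \<in> S" "s \<in> S" "r \<noteq> s" "\<And>i. i \<in> S \<Longrightarrow> A i r = A i s"
  shows "det_on S A = 0"
proof -
  let ?t = "Transposition.transpose r s"
  have t: "?t permutes S" using assms(2,3) by (rule permutes_swap_id)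
  have "det_on S A = (\<Sum>p | p permutes S. of_int (sign (?t \<circ> p)) * (\<Prod>i\<in>S. A i ((?t \<circ> p) i)))"
    unfolding det_on_def by (rule setum_permutations_compose_left[OF t])
  also have "\<dots> = (\<Sum>p | p permutes S. - (of_int (sign p) * (\<Prod>i\<in>S. A i (p i))))"
  proof (rule sum.cong)
    fix p assume "p \<in> {p. p permutes S}"
    then have p: "p permutes S" by simp
    have "sign (?t \<circ> p) = - sign p"
      using sign_compose[OF permutation_swap_id permutation_permutes[THEN iffD2]] assms(1,4) p
      by (metis sign_swap_id mult_minus1)
    moreover have "(\<Prod>i\<in>S. A i ((?t \<circ> p) i)) = (\<Prod>i\<in>S. A i (p i))"
      by (rule prod.cong) (auto simp: Transposition.transpose_def assms(5))
    ultimately show "of_int (sign (?t \<circ> p)) * (\<Prod>i\<in>S. A i ((?t \<circ> p) i)) =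
        - (of_int (sign p) * (\<Prod>i\<in>S. A i (p i)))" by simp
  qed simp
  also have "\<dots> = - det_on S A" by (simp add: det_on_def sum_negf)
  finally show ?thesis by simp
qed

text \<open>A permutation moving \<open>r\<close> meets column \<open>r\<close> in some row of
  \<open>T\<close>, where the entry is zero; those fixing \<open>r\<close> are the permutations of
  \<open>T\<close>.\<close>

lemma det_on_unit_column:
  assumes "finite T" "r \<notin> T" "\<And>i. i \<in> T \<Longrightarrow> A i r = 0"
  shows "det_on (insert r T) A = A r r * det_on T A"
proof -
  have "det_on (insert r T) A =
      (\<Sum>p | p permutes T. of_int (sign p) * (\<Prod>i\<in>insert r T. A i (p i)))"
    unfolding det_on_def
  proof (rule sum.mono_neutral_right)
    show "finite {p. p permutes insert r T}" using assms(1) by (simp add: finite_permutations)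
    show "{p. p permutes T} \<subseteq> {p. p permutes insert r T}" by (auto intro: permutes_subset)
    show "\<forall>p\<in>{p. p permutes insert r T} - {p. p permutes T}.
        of_int (sign p) * (\<Prod>i\<in>insert r T. A i (p i)) = 0"
    proof
      fix p assume p: "p \<in> {p. p permutes insert r T} - {p. p permutes T}"
      then have "p r \<noteq> r" using permutes_superset[of p "insert r T" T] by auto
      moreover have "Hilbert_Choice.inv p r \<in> insert r T"
        using p permutes_in_image[OF permutes_inv, of p "insert r T" r] by simp
      moreover have "p (Hilbert_Choice.inv p r) = r" using p permutes_inverses(1) by fast
      ultimately have "Hilbert_Choice.inv p r \<in> T" "A (Hilbert_Choice.inv p r) (p (Hilbert_Choice.inv p r)) = 0" using assms(3) by auto
      then show "of_int (sign p) * (\<Prod>i\<in>insert r T. A i (p i)) = 0"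
        using assms(1) by (auto intro!: prod_zero)
    qed
  qed
  also have "\<dots> = A r r * det_on T A"
    unfolding det_on_def sum_distrib_left
    by (rule sum.cong) (use assms(1,2) in \<open>auto simp: permutes_not_in\<close>)
  finally show ?thesis .
qed

lemma det_on_cong:
  assumes "\<And>i j. i \<in> S \<Longrightarrow> j \<in> S \<Longrightarrow> A i j = B i j"
  shows "det_on S A = det_on S B"
  unfolding det_on_def
  by (intro sum.cong prod.cong arg_cong2[of _ _ _ _ "(*)"]) (auto simp: assms permutes_in_image)

text \<open>Column \<open>r\<close> is a combination of the columns in \<open>T\<close> on the rows
  of \<open>T\<close> only. Subtracting that combination leaves the defect \<open>?d\<close> in row
  \<open>r\<close> and zeros elsewhere.\<close>

lemma det_on_reduce_column:
  assumes "finite T" "r \<notin> T" "\<And>i. i \<in> T \<Longrightarrow> A i r = (\<Sum>j\<in>T. c j * A i j)"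
  shows "det_on (insert r T) A = (A r r - (\<Sum>j\<in>T. c j * A r j)) * det_on T A"
proof -
  let ?S = "insert r T"
  let ?d = "A r r - (\<Sum>j\<in>T. c j * A r j)"
  \<comment> \<open>Column \<open>r\<close> is split into the columns of \<open>T\<close> with
    coefficients \<open>c\<close> and \<open>?d\<close> times a unit vector. Each summand coming
    from \<open>T\<close> gives a determinant with two equal columns.\<close>
  let ?B = "\<lambda>k i. if k = r then (if i = r then ?d else 0) else A i k"
  let ?c = "\<lambda>k. if k = r then 1 else c k"
  have "det_on ?S A = det_on ?S (\<lambda>i j. if j = r then \<Sum>k\<in>?S. ?c k * ?B k i else A i j)"
  proof (rule det_on_cong)
    fix i j assume "i \<in> ?S" "j \<in> ?S"
    have "(\<Sum>k\<in>T. ?c k * ?B k i) = (\<Sum>k\<in>T. c k * A i k)"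
      by (rule sum.cong) (use assms(2) in auto)
    then have "(\<Sum>k\<in>?S. ?c k * ?B k i) = A i r"
      using assms \<open>i \<in> ?S\<close> by auto
    then show "A i j = (if j = r then \<Sum>k\<in>?S. ?c k * ?B k i else A i j)" by simp
  qed
  also have "\<dots> = (\<Sum>k\<in>?S. ?c k * det_on ?S (\<lambda>i j. if j = r then ?B k i else A i j))"
    using assms(1) by (intro det_on_column_sum) auto
  also have "\<dots> = det_on ?S (\<lambda>i j. if j = r then ?B r i else A i j)"
  proof -
    have "det_on ?S (\<lambda>i j. if j = r then ?B k i else A i j) = 0" if "k \<in> T" for k
      by (rule det_on_equal_columns[of _ r k]) (use that assms(1,2) in auto)
    then show ?thesis using assms(1,2) by simp
  qed
  also have "\<dots> = ?d * det_on T (\<lambda>i j. if j = r then ?B r i else A i j)"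
    using assms(1,2) by (subst det_on_unit_column) auto
  also have "det_on T (\<lambda>i j. if j = r then ?B r i else A i j) = det_on T A"
    using assms(2) by (intro det_on_cong) auto
  finally show ?thesis .
qed

section \<open>Feet on faces and Gram determinants with a replaced column\<close>

definition foot ::
    "('r \<Rightarrow> 'a::real_vector) \<Rightarrow> ('a \<Rightarrow> 'a \<Rightarrow> real) \<Rightarrow> ('r \<Rightarrow> real) \<Rightarrow> 'r set \<Rightarrow> 'a" where
  "foot u ip z T = (SOME v. v \<in> span (u ` T) \<and> (\<forall>\<eta>\<in>T. ip v (u \<eta>) = z \<eta>))"

definition excess ::
    "('r \<Rightarrow> 'a::real_vector) \<Rightarrow> ('a \<Rightarrow> 'a \<Rightarrow> real) \<Rightarrow> ('r \<Rightarrow> real) \<Rightarrow> 'r set \<Rightarrow> 'r \<Rightarrow> real" where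
  "excess u ip z T \<rho> = z \<rho> - ip (foot u ip z T) (u \<rho>)"

lemma foot:
  assumes ip: "inner_product ip" and "finite T" and inj: "inj_on u T" and "independent (u ` T)"
  shows "foot u ip z T \<in> span (u ` T)" "\<And>\<eta>. \<eta> \<in> T \<Longrightarrow> ip (foot u ip z T) (u \<eta>) = z \<eta>"
proof -
  obtain v where "v \<in> span (u ` T)" "\<forall>b\<in>u ` T. ip v b = z (the_inv_into T u b)"
    using span_prescribed_products[OF ip, of "u ` T" "\<lambda>b. z (the_inv_into T u b)"] assms by auto
  then have "v \<in> span (u ` T) \<and> (\<forall>\<eta>\<in>T. ip v (u \<eta>) = z \<eta>)"
    by (auto simp: the_inv_into_f_f[OF inj])
  then have "foot u ip z T \<in> span (u ` T) \<and> (\<forall>\<eta>\<in>T. ip (foot u ip z T) (u \<eta>) = z \<eta>)"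
    unfolding foot_def by (rule someI)
  then show "foot u ip z T \<in> span (u ` T)" "\<And>\<eta>. \<eta> \<in> T \<Longrightarrow> ip (foot u ip z T) (u \<eta>) = z \<eta>"
    by auto
qed

lemma span_image_coeffs:
  assumes "finite T" "inj_on u T" "v \<in> span (u ` T)"
  obtains c where "v = (\<Sum>\<rho>\<in>T. c \<rho> *\<^sub>R u \<rho>)"
proof -
  obtain e where "v = (\<Sum>b\<in>u ` T. e b *\<^sub>R b)"
    using assms(1,3) by (auto simp: span_finite)
  then have "v = (\<Sum>\<rho>\<in>T. e (u \<rho>) *\<^sub>R u \<rho>)" by (simp add: sum.reindex[OF assms(2)])
  then show ?thesis by (rule that)
qed

text \<open>Let \<open>c\<close> be the coefficients of the foot. By its defining equations, the
  column \<open>z\<close> is on the rows of \<open>T\<close> the combination of the Gram columns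
  with coefficients \<open>c\<close>; in row \<open>\<rho>\<close> the defect of this relation is
  the excess.\<close>

lemma det_on_gram_replace:
  assumes ip: "inner_product ip" and fin: "finite T" and ind: "inj_on u T" "independent (u ` T)"
    and "\<rho> \<notin> T"
  shows "det_on (insert \<rho> T) (gram_replace ip u \<rho> z) = excess u ip z T \<rho> * det_on T (gram ip u)"
proof -
  obtain c where c: "foot u ip z T = (\<Sum>\<eta>\<in>T. c \<eta> *\<^sub>R u \<eta>)"
    using span_image_coeffs[OF fin ind(1) foot(1)[OF ip fin ind]] by blast
  have sym: "ip x y = ip y x" for x y using ip by (simp add: inner_product_def)
  have sum: "(\<Sum>\<eta>\<in>T. c \<eta> * gram_replace ip u \<rho> z \<kappa> \<eta>) = ip (foot u ip z T) (u \<kappa>)" for \<kappa>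
    unfolding c inner_product_simps[OF ip]
    by (rule sum.cong) (use assms(5) in \<open>auto simp: gram_replace_def gram_def sym\<close>)
  have "det_on (insert \<rho> T) (gram_replace ip u \<rho> z) =
      (gram_replace ip u \<rho> z \<rho> \<rho> - (\<Sum>\<eta>\<in>T. c \<eta> * gram_replace ip u \<rho> z \<rho> \<eta>)) *
      det_on T (gram_replace ip u \<rho> z)"
    by (rule det_on_reduce_column[OF fin assms(5)])
      (subst sum, simp add: foot(2)[OF ip fin ind] gram_replace_def)
  also have "det_on T (gram_replace ip u \<rho> z) = det_on T (gram ip u)"
    by (rule det_on_cong) (use assms(5) in \<open>auto simp: gram_replace_def\<close>)
  finally show ?thesis by (simp only: sum) (simp add: excess_def gram_replace_def)
qed

text \<open>With \<open>?z\<close> as right-hand side, replacing the last column changes nothing. So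
  adding a ray multiplies the determinant by \<open>excess\<close>, which is here the squared
  distance of \<open>u \<rho>\<close> from the span of the other generators.\<close>

lemma det_on_gram_pos:
  fixes T :: "'a::real_vector set set"
  assumes ip: "inner_product ip" and "finite T" "inj_on u T" "independent (u ` T)"
  shows "det_on T (gram ip u) > 0"
  using assms(2-)
proof (induction T rule: finite_induct)
  case empty
  then show ?case by (simp add: det_on_def)
next
  case (insert \<rho> T)
  have ind: "inj_on u T" "independent (u ` T)" and \<rho>: "u \<rho> \<notin> span (u ` T)"
    using insert.prems insert.hyps by (auto simp: independent_insert split: if_splits)
  let ?z = "\<lambda>\<eta>. ip (u \<eta>) (u \<rho>)"
  let ?q = "u \<rho> - foot u ip ?z T"
  note f = foot[OF ip insert.hyps(1) ind, where z = ?z]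
  have sym: "ip x y = ip y x" for x y using ip by (simp add: inner_product_def)
  have "?q \<noteq> 0" using f(1) \<rho> by auto
  then have "ip ?q ?q > 0" using ip by (simp add: inner_product_def)
  moreover have "ip ?q (foot u ip ?z T) = 0"
  proof (rule ip_span_zero[OF ip f(1)])
    fix b assume "b \<in> u ` T"
    then obtain \<eta> where "\<eta> \<in> T" "b = u \<eta>" by blast
    then show "ip ?q b = 0" using f(2)[of \<eta>] sym[of "u \<eta>" "u \<rho>"] by (simp add: inner_product_simps(3)[OF ip])
  qed
  moreover have "ip (u \<rho>) ?q = ip (u \<rho>) (u \<rho>) - ip (u \<rho>) (foot u ip ?z T)"
    using sym inner_product_simps(3)[OF ip] by metis
  then have "ip ?q (u \<rho>) = ip (u \<rho>) (u \<rho>) - ip (foot u ip ?z T) (u \<rho>)"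
    by (simp only: inner_product_simps(3)[OF ip])
  moreover have "ip ?q ?q = ip ?q (u \<rho>) - ip ?q (foot u ip ?z T)"
    using sym inner_product_simps(3)[OF ip] by metis
  ultimately have "excess u ip ?z T \<rho> > 0"
    by (simp add: excess_def)
  moreover have "gram_replace ip u \<rho> ?z = gram ip u"
    by (auto simp: gram_replace_def gram_def fun_eq_iff)
  ultimately show ?case
    using det_on_gram_replace[OF ip insert.hyps(1) ind insert.hyps(2), where z = ?z] insert.IH[OF ind] by simp
qed

section \<open>Simplicial fans\<close>

lemma sum_in_convex_cone:
  assumes "convex_cone K" "\<And>i. i \<in> T \<Longrightarrow> x i \<in> K"
  shows "sum x T \<in> K"
  using assms(2)
  by (induction T rule: infinite_finite_induct)
    (auto simp: convex_cone_add[OF assms(1)] convex_cone_contains_0[OF assms(1)])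

lemma convex_cone_hull_image:
  assumes "finite T"
  shows "convex_cone hull (u ` T) = {\<Sum>i\<in>T. c i *\<^sub>R u i | c. \<forall>i\<in>T. 0 \<le> c i}" (is "_ = ?H")
proof
  show "convex_cone hull (u ` T) \<subseteq> ?H"
  proof (rule hull_minimal)
    show "u ` T \<subseteq> ?H"
    proof
      fix v assume "v \<in> u ` T"
      then obtain i where i: "i \<in> T" "v = u i" by blast
      have "(\<Sum>j\<in>T. (if j = i then 1 else 0) *\<^sub>R u j) = (\<Sum>j\<in>T. if j = i then u j else 0)"
        by (rule sum.cong) auto
      then have "v = (\<Sum>j\<in>T. (if j = i then 1 else 0) *\<^sub>R u j)"
        using i assms by simp
      then show "v \<in> ?H" by (intro CollectI exI[of _ "\<lambda>j. if j = i then 1 else 0"]) auto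
    qed
    show "convex_cone ?H"
      unfolding convex_cone_iff
    proof (intro conjI ballI allI impI)
      show "0 \<in> ?H" by (intro CollectI exI[of _ "\<lambda>_. 0"]) auto
    next
      fix x y assume "x \<in> ?H" "y \<in> ?H"
      then obtain c e where "x = (\<Sum>i\<in>T. c i *\<^sub>R u i)" "\<forall>i\<in>T. 0 \<le> c i"
        "y = (\<Sum>i\<in>T. e i *\<^sub>R u i)" "\<forall>i\<in>T. 0 \<le> e i" by blast
      then show "x + y \<in> ?H"
        by (intro CollectI exI[of _ "\<lambda>i. c i + e i"]) (auto simp: scaleR_add_left sum.distrib)
    next
      fix x and r :: real assume "x \<in> ?H" "r \<ge> 0"
      then obtain c where "x = (\<Sum>i\<in>T. c i *\<^sub>R u i)" "\<forall>i\<in>T. 0 \<le> c i" by blast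
      then show "r *\<^sub>R x \<in> ?H"
        using \<open>r \<ge> 0\<close> by (intro CollectI exI[of _ "\<lambda>i. r * c i"]) (auto simp: scaleR_sum_right)
    qed
  qed
  show "?H \<subseteq> convex_cone hull (u ` T)"
  proof
    fix x assume "x \<in> ?H"
    then obtain c where c: "x = (\<Sum>i\<in>T. c i *\<^sub>R u i)" "\<forall>i\<in>T. 0 \<le> c i" by blast
    show "x \<in> convex_cone hull (u ` T)"
      unfolding c(1)
      by (rule sum_in_convex_cone[OF convex_cone_convex_cone_hull])
        (use c(2) in \<open>auto intro: convex_cone_hull_mul hull_inc\<close>)
  qed
qed

lemma convex_cone_hull_singleton: "convex_cone hull {s} = {c *\<^sub>R s | c. 0 \<le> c}"
  using convex_cone_hull_image[of "{s}" "\<lambda>x. x"] by (auto; metis)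

lemma convex_cone_hull_subset_span: "convex_cone hull S \<subseteq> span S"
  by (rule hull_minimal) (auto simp: span_superset convex_cone_iff span_zero span_add span_mul)

lemma dim_convex_cone_hull:
  fixes S :: "'a::euclidean_space set"
  shows "dim (convex_cone hull S) = dim S"
  by (metis antisym convex_cone_hull_subset_span dim_span dim_subset hull_subset)

lemma pointed_sum_zero:
  fixes K :: "'a::ab_group_add set"
  assumes "K \<inter> uminus ` K = {0}" "x \<in> K" "y \<in> K" "x + y = 0"
  shows "x = 0"
proof -
  have "x = - y" using assms(4) by (rule eq_neg_iff_add_eq_0[THEN iffD2])
  then show ?thesis using assms by blast
qed

text \<open>Split both endpoints of a segment through the ray into a multiple of \<open>s\<close>
  and a rest in the hull of the other generators. The combined rest \<open>k\<close> is a multiple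
  of \<open>s\<close>: irredundancy forbids a positive multiple, pointedness a negative one.
  Pointedness then also kills the two separate rests.\<close>

lemma extreme_generator_face:
  assumes pt: "convex_cone hull S \<inter> uminus ` (convex_cone hull S) = {0}"
    and s: "s \<in> S" "s \<notin> convex_cone hull (S - {s})"
  shows "convex_cone hull {s} face_of convex_cone hull S"
  unfolding face_of_def
proof (intro conjI ballI impI)
  let ?K = "convex_cone hull S" and ?K' = "convex_cone hull (S - {s})"
  show "convex_cone hull {s} \<subseteq> ?K" using s by (intro hull_mono) auto
  show "convex (convex_cone hull {s})" by (rule convex_convex_cone_hull)
  fix a b x assume ab: "a \<in> ?K" "b \<in> ?K" and x: "x \<in> convex_cone hull {s}" "x \<in> open_segment a b"
  have split: "\<exists>c y. 0 \<le> c \<and> y \<in> ?K' \<and> v = c *\<^sub>R s + y" if "v \<in> ?K" for v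
  proof -
    have "S = {s} \<union> (S - {s})" using s by auto
    then have "v \<in> convex_cone hull ({s} \<union> (S - {s}))" using that by simp
    then show ?thesis unfolding convex_cone_hull_Un convex_cone_hull_singleton by auto
  qed
  obtain \<alpha> a' \<beta> b' where a: "0 \<le> \<alpha>" "a' \<in> ?K'" "a = \<alpha> *\<^sub>R s + a'"
      and b: "0 \<le> \<beta>" "b' \<in> ?K'" "b = \<beta> *\<^sub>R s + b'"
    using split ab by meson
  obtain t where t: "0 \<le> t" "x = t *\<^sub>R s" using x(1) convex_cone_hull_singleton[of s] by blast
  obtain l where l: "0 < l" "l < 1" "x = (1 - l) *\<^sub>R a + l *\<^sub>R b"
    using x(2) by (auto simp: in_segment)
  define k where "k = (1 - l) *\<^sub>R a' + l *\<^sub>R b'"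
  define g where "g = (1 - l) * \<alpha> + l * \<beta>"
  have K': "(1 - l) *\<^sub>R a' \<in> ?K'" "l *\<^sub>R b' \<in> ?K'"
    using a b l by (auto intro: convex_cone_hull_mul)
  then have k: "k \<in> ?K'" unfolding k_def by (rule convex_cone_hull_add)
  have sub: "?K' \<subseteq> ?K" by (intro hull_mono) auto
  have eq: "t *\<^sub>R s = g *\<^sub>R s + k"
    using l(3) unfolding t(2) a(3) b(3) k_def g_def by (simp add: algebra_simps)
  have "t \<le> g"
  proof (rule ccontr)
    assume "\<not> t \<le> g"
    moreover have "k = (t - g) *\<^sub>R s" using eq by (simp add: algebra_simps)
    ultimately have "s = (1 / (t - g)) *\<^sub>R k" by simp
    moreover have "\<dots> \<in> ?K'" using k \<open>\<not> t \<le> g\<close> by (intro convex_cone_hull_mul) auto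
    ultimately show False using s(2) by simp
  qed
  have "k + (g - t) *\<^sub>R s = 0" using eq by (simp add: algebra_simps)
  moreover have "(g - t) *\<^sub>R s \<in> ?K" using \<open>t \<le> g\<close> s(1) by (intro convex_cone_hull_mul hull_inc) auto
  ultimately have k0: "k = 0" using pointed_sum_zero[OF pt] k sub by blast
  have "(1 - l) *\<^sub>R a' = 0"
    using pointed_sum_zero[OF pt, of "(1 - l) *\<^sub>R a'" "l *\<^sub>R b'"] K' sub k0 unfolding k_def by blast
  moreover have "l *\<^sub>R b' = 0"
    using k0 calculation unfolding k_def by simp
  ultimately have "a' = 0" "b' = 0" using l by auto
  then show "a \<in> convex_cone hull {s}" "b \<in> convex_cone hull {s}"
    using a b by (auto simp: convex_cone_hull_singleton)
qed

text \<open>In a generating set of least cardinality no generator is redundant, so each one spans a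
  ray by \<open>extreme_generator_face\<close>.\<close>

lemma pointed_cone_generated_by_rays:
  fixes \<sigma> :: "'a::euclidean_space set"
  assumes "polyhedral_cone \<sigma>" and pt: "\<sigma> \<inter> uminus ` \<sigma> = {0}"
  shows "\<sigma> = convex_cone hull (\<Union>(rays \<sigma>))"
proof
  obtain S0 where "finite S0 \<and> \<sigma> = convex_cone hull S0"
    using assms(1) unfolding polyhedral_cone_def by blast
  then obtain S where S: "finite S" "\<sigma> = convex_cone hull S"
      and min: "\<And>S'. finite S' \<Longrightarrow> \<sigma> = convex_cone hull S' \<Longrightarrow> card S \<le> card S'"
    using ex_has_least_nat[of "\<lambda>S. finite S \<and> \<sigma> = convex_cone hull S" S0 card] by blast
  have "S \<subseteq> \<Union>(rays \<sigma>)"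
  proof
    fix s assume s: "s \<in> S"
    have ns: "s \<notin> convex_cone hull (S - {s})"
    proof
      assume "s \<in> convex_cone hull (S - {s})"
      then have "\<sigma> = convex_cone hull (S - {s})"
        using S(2) s by (metis hull_redundant insert_Diff)
      then show False using min[of "S - {s}"] S(1) s by (metis card_Diff1_less finite_Diff leD)
    qed
    then have "s \<noteq> 0" using convex_cone_hull_contains_0 by metis
    have "convex_cone hull {s} face_of \<sigma>"
      using extreme_generator_face[OF _ s ns] pt S(2) by simp
    moreover have "dim (convex_cone hull {s}) = 1"
      using \<open>s \<noteq> 0\<close> by (simp add: dim_convex_cone_hull)
    ultimately have "convex_cone hull {s} \<in> rays \<sigma>" by (simp add: rays_def)
    then show "s \<in> \<Union>(rays \<sigma>)" using hull_inc[of s "{s}"] by blast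
  qed
  then show "\<sigma> \<subseteq> convex_cone hull (\<Union>(rays \<sigma>))" using S(2) hull_mono by metis
  show "convex_cone hull (\<Union>(rays \<sigma>)) \<subseteq> \<sigma>"
  proof (rule hull_minimal)
    show "\<Union>(rays \<sigma>) \<subseteq> \<sigma>" by (auto simp: rays_def dest: face_of_imp_subset)
    show "convex_cone \<sigma>" using S(2) convex_cone_convex_cone_hull by metis
  qed
qed

lemma ray_generated:
  fixes \<rho> :: "'a::euclidean_space set"
  assumes "polyhedral_cone \<rho>" and pt: "\<rho> \<inter> uminus ` \<rho> = {0}" and dim: "dim \<rho> = 1"
    and v: "v \<in> rel_interior \<rho>"
  shows "\<rho> = convex_cone hull {v}" "v \<noteq> 0"
proof -
  have K: "convex_cone \<rho>"
    using assms(1) convex_cone_convex_cone_hull unfolding polyhedral_cone_def by metis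
  have v_mem: "v \<in> \<rho>" using v rel_interior_subset by blast
  show "v \<noteq> 0"
  proof
    assume "v = 0"
    obtain e where e: "e \<in> \<rho>" "e \<noteq> 0"
      using dim by (metis dim_eq_0 One_nat_def Suc_neq_Zero singletonI subsetI singleton_iff)
    \<comment> \<open>If \<open>v\<close> were the apex, the segment from \<open>e\<close> to
      \<open>v\<close> could be prolonged inside \<open>\<rho>\<close> beyond \<open>v\<close>, to a
      negative multiple of \<open>e\<close>, against pointedness.\<close>
    obtain m where m: "m > 1" "\<And>t. t > 1 \<Longrightarrow> t \<le> m \<Longrightarrow> (1 - t) *\<^sub>R e + t *\<^sub>R v \<in> \<rho>"
      using convex_rel_interior_if[of \<rho> v] K v hull_inc[of e \<rho> affine] e
      unfolding convex_cone_def by meson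
    have "(1 - m) *\<^sub>R e \<in> \<rho>" using m(2)[of m] m(1) \<open>v = 0\<close> by simp
    moreover have "(m - 1) *\<^sub>R e \<in> \<rho>" using m(1) e by (intro convex_cone_scaleR[OF K]) auto
    moreover have "(m - 1) *\<^sub>R e + (1 - m) *\<^sub>R e = 0" by (simp add: algebra_simps)
    ultimately have "(m - 1) *\<^sub>R e = 0" using pointed_sum_zero[OF pt] by blast
    then show False using m e by simp
  qed
  then have "independent {v}" by simp
  then have "\<rho> \<subseteq> span {v}"
    using card_ge_dim_independent[of "{v}" \<rho>] v_mem dim by simp
  show "\<rho> = convex_cone hull {v}"
  proof
    show "convex_cone hull {v} \<subseteq> \<rho>" using v_mem K by (intro hull_minimal) auto
    show "\<rho> \<subseteq> convex_cone hull {v}"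
    proof
      fix x assume x: "x \<in> \<rho>"
      then obtain t where t: "x = t *\<^sub>R v" using \<open>\<rho> \<subseteq> span {v}\<close> by (auto simp: span_singleton)
      have "x = 0" if "t < 0"
      proof (rule pointed_sum_zero[OF pt x])
        show "(- t) *\<^sub>R v \<in> \<rho>" using that v_mem by (intro convex_cone_scaleR[OF K]) auto
      qed (simp add: t)
      then show "x \<in> convex_cone hull {v}"
        using t convex_cone_hull_contains_0[of "{v}"] by (cases "t < 0") (auto simp: convex_cone_hull_singleton)
    qed
  qed
qed

lemma independent_family_unique:
  assumes "finite R" "inj_on u R" "independent (u ` R)"
    and "(\<Sum>i\<in>R. c i *\<^sub>R u i) = (\<Sum>i\<in>R. e i *\<^sub>R u i)" "i \<in> R"
  shows "c i = e i"
proof -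
  let ?g = "\<lambda>b. c (the_inv_into R u b) - e (the_inv_into R u b)"
  have "(\<Sum>b\<in>u ` R. ?g b *\<^sub>R b) = (\<Sum>i\<in>R. (c i - e i) *\<^sub>R u i)"
    by (simp add: sum.reindex[OF assms(2)] the_inv_into_f_f[OF assms(2)])
  also have "\<dots> = 0" using assms(4) by (simp add: scaleR_diff_left sum_subtractf)
  finally have "?g (u i) = 0"
    using independentD[OF assms(3) _ order_refl, of ?g "u i"] assms(1,5) by simp
  then show ?thesis using assms(5) by (simp add: the_inv_into_f_f[OF assms(2)])
qed

text \<open>Coordinates with respect to independent generators are unique. Off \<open>T\<close>
  those of a point of the subcone are zero, and a convex combination of nonnegative numbers with
  positive weights vanishes only if all of them do.\<close>

lemma sub_cone_face:
  assumes "finite R" "inj_on u R" "independent (u ` R)" "T \<subseteq> R"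
  shows "convex_cone hull (u ` T) face_of convex_cone hull (u ` R)"
  unfolding face_of_def
proof (intro conjI ballI impI)
  have finT: "finite T" using assms finite_subset by blast
  show "convex_cone hull (u ` T) \<subseteq> convex_cone hull (u ` R)" using assms by (intro hull_mono) auto
  show "convex (convex_cone hull (u ` T))" by (rule convex_convex_cone_hull)
  have main: "(\<Sum>i\<in>R. a i *\<^sub>R u i) \<in> convex_cone hull (u ` T)"
    if "\<forall>i\<in>R. 0 \<le> a i" "\<And>i. i \<in> R - T \<Longrightarrow> a i = 0" for a
  proof -
    have "(\<Sum>i\<in>R. a i *\<^sub>R u i) = (\<Sum>i\<in>T. a i *\<^sub>R u i)"
      by (rule sum.mono_neutral_right) (use assms that in auto)
    then show ?thesis unfolding convex_cone_hull_image[OF finT] using that(1) assms(4) by blast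
  qed
  fix a b x
  assume ab: "a \<in> convex_cone hull (u ` R)" "b \<in> convex_cone hull (u ` R)"
    and x: "x \<in> convex_cone hull (u ` T)" "x \<in> open_segment a b"
  obtain \<alpha> where a: "a = (\<Sum>i\<in>R. \<alpha> i *\<^sub>R u i)" "\<forall>i\<in>R. 0 \<le> \<alpha> i"
    using ab convex_cone_hull_image[OF assms(1), of u] by blast
  obtain \<beta> where b: "b = (\<Sum>i\<in>R. \<beta> i *\<^sub>R u i)" "\<forall>i\<in>R. 0 \<le> \<beta> i"
    using ab convex_cone_hull_image[OF assms(1), of u] by blast
  obtain c where c: "x = (\<Sum>i\<in>T. c i *\<^sub>R u i)"
    using x convex_cone_hull_image[OF finT, of u] by blast
  obtain l where l: "0 < l" "l < 1" "x = (1 - l) *\<^sub>R a + l *\<^sub>R b"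
    using x(2) by (auto simp: in_segment)
  have "(\<Sum>i\<in>R. (if i \<in> T then c i else 0) *\<^sub>R u i) = x"
    unfolding c by (rule sum.mono_neutral_cong_right) (use assms in auto)
  also have "x = (\<Sum>i\<in>R. ((1 - l) * \<alpha> i + l * \<beta> i) *\<^sub>R u i)"
    unfolding l(3) a(1) b(1) by (simp add: scaleR_sum_right sum.distrib scaleR_add_left)
  finally have eq: "(if i \<in> T then c i else 0) = (1 - l) * \<alpha> i + l * \<beta> i" if "i \<in> R" for i
    by (rule independent_family_unique[OF assms(1-3) _ that])
  have "\<alpha> i = 0 \<and> \<beta> i = 0" if "i \<in> R - T" for i
  proof -
    have "(1 - l) * \<alpha> i + l * \<beta> i = 0" using eq[of i] that by simp
    moreover have "(1 - l) * \<alpha> i \<ge> 0" "l * \<beta> i \<ge> 0" using a b l that by auto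
    ultimately have "(1 - l) * \<alpha> i = 0" "l * \<beta> i = 0" by linarith+
    then show ?thesis using l by auto
  qed
  then show "a \<in> convex_cone hull (u ` T)" "b \<in> convex_cone hull (u ` T)"
    using main[of \<alpha>] main[of \<beta>] a b by auto
qed

section \<open>The simplicial complex formed by the ray sets of a fan\<close>

context
  fixes \<Sigma> :: "'a::euclidean_space set set" and u :: "'a set \<Rightarrow> 'a"
  assumes simp_fan: "simplicial_fan \<Sigma> u"
begin

lemma finite_fan: "finite \<Sigma>"
  using simp_fan by (simp add: simplicial_fan_def marked_fan_def polyhedral_fan_def)

lemma fan_cone:
  assumes "\<sigma> \<in> \<Sigma>"
  shows "polyhedral_cone \<sigma>" "\<sigma> \<inter> uminus ` \<sigma> = {0}"
  using simp_fan assms by (auto simp: simplicial_fan_def marked_fan_def polyhedral_fan_def)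

lemma fan_face: "\<sigma> \<in> \<Sigma> \<Longrightarrow> \<tau> face_of \<sigma> \<Longrightarrow> \<tau> \<noteq> {} \<Longrightarrow> \<tau> \<in> \<Sigma>"
  using simp_fan by (auto simp: simplicial_fan_def marked_fan_def polyhedral_fan_def)

lemma fan_Int_face: "\<sigma> \<in> \<Sigma> \<Longrightarrow> \<tau> \<in> \<Sigma> \<Longrightarrow> (\<sigma> \<inter> \<tau>) face_of \<sigma>"
  using simp_fan by (auto simp: simplicial_fan_def marked_fan_def polyhedral_fan_def)

lemma fan_independent: "\<sigma> \<in> \<Sigma> \<Longrightarrow> independent_rays u \<sigma>"
  using simp_fan by (simp add: simplicial_fan_def)

lemma fan_rays:
  assumes "\<sigma> \<in> \<Sigma>"
  shows "finite (rays \<sigma>)" "inj_on u (rays \<sigma>)" "independent (u ` rays \<sigma>)"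
  using fan_independent[OF assms] finite_rays by (auto simp: independent_rays_def)

lemma fan_ray:
  assumes "\<rho> \<in> cones \<Sigma> 1"
  shows "\<rho> = convex_cone hull {u \<rho>}" "u \<rho> \<noteq> 0" "u \<rho> \<in> \<rho>"
proof -
  have "u \<rho> \<in> rel_interior \<rho>"
    using simp_fan assms by (simp add: simplicial_fan_def marked_fan_def)
  moreover have "\<rho> \<in> \<Sigma>" "dim \<rho> = 1" using assms by (auto simp: cones_def)
  ultimately show "\<rho> = convex_cone hull {u \<rho>}" "u \<rho> \<noteq> 0" "u \<rho> \<in> \<rho>"
    using ray_generated[OF fan_cone, of \<rho> "u \<rho>"] rel_interior_subset by blast+
qed

lemma rays_subset_cones: "\<sigma> \<in> \<Sigma> \<Longrightarrow> rays \<sigma> \<subseteq> cones \<Sigma> 1"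
  using fan_face by (fastforce simp: rays_def cones_def)

lemma convex_cone_hull_Union_rays:
  assumes "T \<subseteq> cones \<Sigma> 1"
  shows "convex_cone hull (\<Union>T) = convex_cone hull (u ` T)"
proof
  show "convex_cone hull (\<Union>T) \<subseteq> convex_cone hull (u ` T)"
  proof (rule hull_minimal)
    show "\<Union>T \<subseteq> convex_cone hull (u ` T)"
    proof
      fix x assume "x \<in> \<Union>T"
      then obtain \<rho> where \<rho>: "\<rho> \<in> T" "x \<in> \<rho>" by blast
      then have "x \<in> convex_cone hull {u \<rho>}" using fan_ray(1) assms by blast
      moreover have "convex_cone hull {u \<rho>} \<subseteq> convex_cone hull (u ` T)"
        using \<rho> by (intro hull_mono) auto
      ultimately show "x \<in> convex_cone hull (u ` T)" by blast
    qed
  qed (rule convex_cone_convex_cone_hull)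
  show "convex_cone hull (u ` T) \<subseteq> convex_cone hull (\<Union>T)"
    using fan_ray(3) assms by (intro hull_mono) blast
qed

lemma fan_cone_hull:
  assumes "\<sigma> \<in> \<Sigma>"
  shows "\<sigma> = convex_cone hull (u ` rays \<sigma>)"
  using pointed_cone_generated_by_rays[OF fan_cone[OF assms]]
    convex_cone_hull_Union_rays[OF rays_subset_cones[OF assms]] by simp

lemma dim_fan_cone:
  assumes "\<sigma> \<in> \<Sigma>"
  shows "dim \<sigma> = card (rays \<sigma>)"
proof -
  have "dim \<sigma> = dim (u ` rays \<sigma>)"
    using fan_cone_hull[OF assms] dim_convex_cone_hull by metis
  then show ?thesis
    using fan_rays[OF assms] by (simp add: dim_eq_card_independent card_image)
qed

text \<open>A further ray of the subcone would be a ray of \<open>\<sigma>\<close> outside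
  \<open>T\<close> with its generator in the span of \<open>u\<close> applied to \<open>T\<close>,
  against independence. Together with \<open>fan_eqI\<close> this identifies the fan with the
  complex of its ray sets.\<close>

lemma sub_cone:
  assumes "\<sigma> \<in> \<Sigma>" "T \<subseteq> rays \<sigma>"
  shows "convex_cone hull (u ` T) face_of \<sigma>" "convex_cone hull (u ` T) \<in> \<Sigma>"
    "rays (convex_cone hull (u ` T)) = T"
proof -
  let ?\<tau> = "convex_cone hull (u ` T)"
  show face: "?\<tau> face_of \<sigma>"
    using sub_cone_face[OF fan_rays[OF assms(1)] assms(2)] fan_cone_hull[OF assms(1)] by simp
  then show mem: "?\<tau> \<in> \<Sigma>" using fan_face[OF assms(1)] convex_cone_hull_nonempty by blast
  show "rays ?\<tau> = T"
  proof
    show "T \<subseteq> rays ?\<tau>"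
    proof
      fix \<rho> assume "\<rho> \<in> T"
      then have \<rho>: "\<rho> face_of \<sigma>" "dim \<rho> = 1" "\<rho> \<in> cones \<Sigma> 1"
        using assms rays_subset_cones by (auto simp: rays_def)
      have "\<rho> \<subseteq> ?\<tau>"
        using fan_ray(1)[OF \<rho>(3)] hull_mono[of "{u \<rho>}" "u ` T" convex_cone] \<open>\<rho> \<in> T\<close> by auto
      then show "\<rho> \<in> rays ?\<tau>"
        using face_of_subset[OF \<rho>(1) _ face_of_imp_subset[OF face]] \<rho>(2) by (simp add: rays_def)
    qed
    show "rays ?\<tau> \<subseteq> T"
    proof
      fix \<rho> assume \<rho>: "\<rho> \<in> rays ?\<tau>"
      then have "\<rho> face_of ?\<tau>" "dim \<rho> = 1" by (auto simp: rays_def)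
      then have "\<rho> face_of \<sigma>" "dim \<rho> = 1" and "\<rho> \<subseteq> ?\<tau>"
        using face_of_trans[OF _ face] face_of_imp_subset by blast+
      then have \<rho>\<sigma>: "\<rho> \<in> rays \<sigma>" by (simp add: rays_def)
      then have "u \<rho> \<in> \<rho>" using fan_ray(3) rays_subset_cones assms(1) by blast
      then have span: "u \<rho> \<in> span (u ` T)"
        using \<open>\<rho> \<subseteq> ?\<tau>\<close> convex_cone_hull_subset_span by blast
      show "\<rho> \<in> T"
      proof (rule ccontr)
        assume "\<rho> \<notin> T"
        then have "u ` T \<subseteq> u ` rays \<sigma> - {u \<rho>}"
          using fan_rays(2)[OF assms(1)] assms(2) \<rho>\<sigma> by (auto dest: inj_onD)
        then have "u \<rho> \<in> span (u ` rays \<sigma> - {u \<rho>})" using span span_mono by blast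
        then show False
          using fan_rays(3)[OF assms(1)] \<rho>\<sigma> unfolding dependent_def by blast
      qed
    qed
  qed
qed

lemma fan_eqI: "\<sigma> \<in> \<Sigma> \<Longrightarrow> \<tau> \<in> \<Sigma> \<Longrightarrow> rays \<sigma> = rays \<tau> \<Longrightarrow> \<sigma> = \<tau>"
  using fan_cone_hull by metis

lemma fan_complex_down: "T \<in> rays ` \<Sigma> \<Longrightarrow> U \<subseteq> T \<Longrightarrow> U \<in> rays ` \<Sigma>"
  using sub_cone(2,3) by (metis imageE imageI)

lemma fan_complex_finite: "finite (rays ` \<Sigma>)" "T \<in> rays ` \<Sigma> \<Longrightarrow> finite T"
  using finite_fan fan_rays(1) by auto

lemma fan_complex_independent:
  assumes "T \<in> rays ` \<Sigma>"
  shows "finite T" "inj_on u T" "independent (u ` T)" "T \<subseteq> cones \<Sigma> 1"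
  using assms fan_rays rays_subset_cones by blast+

text \<open>If the hull were a cone of the fan, each ray in \<open>S\<close>, being a cone of the
  fan contained in it, would be a face of it, and \<open>S\<close> would consist of rays of one
  cone. This matches the generators of \<open>ideal_I\<close> with the nonfaces of the
  complex.\<close>

lemma nonface_cone:
  assumes "S \<subseteq> cones \<Sigma> 1" "S \<notin> rays ` \<Sigma>"
  shows "convex_cone hull (\<Union>S) \<notin> \<Sigma>"
proof
  let ?\<sigma> = "convex_cone hull (\<Union>S)"
  assume \<sigma>: "?\<sigma> \<in> \<Sigma>"
  have "S \<subseteq> rays ?\<sigma>"
  proof
    fix \<rho> assume "\<rho> \<in> S"
    then have "\<rho> \<in> \<Sigma>" "dim \<rho> = 1" "\<rho> \<subseteq> ?\<sigma>"
      using assms(1) hull_subset[of "\<Union>S" convex_cone] by (auto simp: cones_def)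
    then show "\<rho> \<in> rays ?\<sigma>" using fan_Int_face[OF \<sigma>, of \<rho>] by (simp add: rays_def Int_absorb1)
  qed
  then have "S \<in> rays ` \<Sigma>" using fan_complex_down[of "rays ?\<sigma>" S] \<sigma> by blast
  then show False using assms(2) by blast
qed

text \<open>The definite description is legitimate because a cone of the fan is the hull of the
  generators of its rays, hence determined by them.\<close>

lemma flag_face:
  assumes "\<sigma> \<in> \<Sigma>" "f \<in> labelings d \<sigma>" "j \<le> d"
  shows "rays (flag_face \<sigma> f j) = f ` {1..j}"
proof -
  have sub: "f ` {1..j} \<subseteq> rays \<sigma>"
    using assms(2,3) by (auto simp: labelings_def bij_betw_def)
  note s = sub_cone[OF assms(1) sub]
  have "flag_face \<sigma> f j = convex_cone hull (u ` f ` {1..j})"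
    unfolding flag_face_def
  proof (rule the_equality)
    show "convex_cone hull (u ` f ` {1..j}) face_of \<sigma> \<and> convex_cone hull (u ` f ` {1..j}) \<noteq> {} \<and>
        rays (convex_cone hull (u ` f ` {1..j})) = f ` {1..j}"
      using s convex_cone_hull_nonempty by blast
  next
    fix \<tau> assume "\<tau> face_of \<sigma> \<and> \<tau> \<noteq> {} \<and> rays \<tau> = f ` {1..j}"
    then show "\<tau> = convex_cone hull (u ` f ` {1..j})"
      using fan_face[OF assms(1)] fan_cone_hull by metis
  qed
  then show ?thesis using s(3) by simp
qed

end

section \<open>Powers of a divisor in the Chow ring\<close>

lemma const_add: "const (a + b) = const a + const b"
  by (simp add: const_def single_add)

lemma const_mult: "const (a * b) = const a * const b"
  by (simp add: const_def mult_single)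

lemma const_0: "const 0 = 0" and const_1: "const 1 = 1"
  by (simp_all add: const_def)

lemma mpoly_ring_simps:
  "x \<otimes>\<^bsub>mpoly_ring V\<^esub> y = x * y" "x \<oplus>\<^bsub>mpoly_ring V\<^esub> y = x + y"
  "\<one>\<^bsub>mpoly_ring V\<^esub> = 1" "\<zero>\<^bsub>mpoly_ring V\<^esub> = 0"
  by (simp_all add: mpoly_ring_def)

lemma mpoly_carrier:
  "0 \<in> carrier (mpoly_ring V)" "1 \<in> carrier (mpoly_ring V)" "const c \<in> carrier (mpoly_ring V)"
  "\<rho> \<in> V \<Longrightarrow> var \<rho> \<in> carrier (mpoly_ring V)"
  "p \<in> carrier (mpoly_ring V) \<Longrightarrow> q \<in> carrier (mpoly_ring V) \<Longrightarrow> p + q \<in> carrier (mpoly_ring V)"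
  "p \<in> carrier (mpoly_ring V) \<Longrightarrow> q \<in> carrier (mpoly_ring V) \<Longrightarrow> p * q \<in> carrier (mpoly_ring V)"
  "p \<in> carrier (mpoly_ring V) \<Longrightarrow> - p \<in> carrier (mpoly_ring V)"
proof -
  show "0 \<in> carrier (mpoly_ring V)" "1 \<in> carrier (mpoly_ring V)" "const c \<in> carrier (mpoly_ring V)"
    "\<rho> \<in> V \<Longrightarrow> var \<rho> \<in> carrier (mpoly_ring V)"
    by (auto simp: mpoly_ring_def const_def var_def)
  assume p: "p \<in> carrier (mpoly_ring V)"
  show "- p \<in> carrier (mpoly_ring V)"
    using p by (auto simp: mpoly_ring_def in_keys_iff)
  assume q: "q \<in> carrier (mpoly_ring V)"
  show "p + q \<in> carrier (mpoly_ring V)"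
    using p q Poly_Mapping.keys_add[of p q] by (fastforce simp: mpoly_ring_def)
  show "p * q \<in> carrier (mpoly_ring V)"
    unfolding mpoly_ring_def
  proof (clarsimp)
    fix m x assume "m \<in> Poly_Mapping.keys (p * q)" and x: "x \<in> Poly_Mapping.keys m"
    then obtain a b where ab: "m = a + b" "a \<in> Poly_Mapping.keys p" "b \<in> Poly_Mapping.keys q"
      using keys_mult[of p q] by blast
    then have "x \<in> Poly_Mapping.keys a \<union> Poly_Mapping.keys b"
      using x Poly_Mapping.keys_add[of a b] by blast
    then show "x \<in> V" using ab p q by (auto simp: mpoly_ring_def)
  qed
qed

lemma mpoly_carrier_sum:
  "(\<And>i. i \<in> A \<Longrightarrow> g i \<in> carrier (mpoly_ring V)) \<Longrightarrow> sum g A \<in> carrier (mpoly_ring V)"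
  by (induction A rule: infinite_finite_induct) (auto intro: mpoly_carrier)

lemma mpoly_carrier_prod:
  "(\<And>i. i \<in> A \<Longrightarrow> g i \<in> carrier (mpoly_ring V)) \<Longrightarrow> prod g A \<in> carrier (mpoly_ring V)"
  by (induction A rule: infinite_finite_induct) (auto intro: mpoly_carrier)

lemma mpoly_carrier_power: "p \<in> carrier (mpoly_ring V) \<Longrightarrow> p ^ k \<in> carrier (mpoly_ring V)"
  by (induction k) (auto intro: mpoly_carrier)

lemma cring_mpoly_ring: "cring (mpoly_ring V)"
proof (rule cringI)
  show "abelian_group (mpoly_ring V)"
  proof (rule abelian_groupI)
    fix x assume "x \<in> carrier (mpoly_ring V)"
    then show "\<exists>y\<in>carrier (mpoly_ring V). y \<oplus>\<^bsub>mpoly_ring V\<^esub> x = \<zero>\<^bsub>mpoly_ring V\<^esub>"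
      by (intro bexI[of _ "- x"]) (simp_all add: mpoly_ring_simps mpoly_carrier)
  qed (auto simp: mpoly_ring_simps mpoly_carrier)
  show "Group.comm_monoid (mpoly_ring V)"
    by (rule comm_monoidI) (auto simp: mpoly_ring_simps mpoly_carrier algebra_simps)
qed (auto simp: mpoly_ring_simps algebra_simps)

definition squarefree_monomial :: "'r set \<Rightarrow> 'r mpoly" where
  "squarefree_monomial T = (\<Prod>\<rho>\<in>T. var \<rho>)"

lemma squarefree_monomial_insert:
  "finite T \<Longrightarrow> \<rho> \<notin> T \<Longrightarrow> squarefree_monomial (insert \<rho> T) = var \<rho> * squarefree_monomial T"
  by (simp add: squarefree_monomial_def)

lemma squarefree_monomial_carrier:
  "T \<subseteq> V \<Longrightarrow> squarefree_monomial T \<in> carrier (mpoly_ring V)"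
  unfolding squarefree_monomial_def by (intro mpoly_carrier_prod mpoly_carrier) auto

lemma homogeneous_squarefree_monomial:
  assumes "finite T"
  shows "homogeneous (card T) (squarefree_monomial T)"
proof -
  let ?m = "\<lambda>T. \<Sum>\<rho>\<in>T. Poly_Mapping.single \<rho> (1::nat)"
  \<comment> \<open>The product collapses to one monomial whose exponent vector is the indicator
    function of \<open>T\<close>.\<close>
  have mono: "squarefree_monomial T = Poly_Mapping.single (?m T) 1"
    using assms
    by (induction T rule: finite_induct) (auto simp: squarefree_monomial_def var_def mult_single)
  have l: "Poly_Mapping.lookup (?m T) \<rho> = of_bool (\<rho> \<in> T)" for \<rho>
    using assms
    by (induction T rule: finite_induct) (auto simp: lookup_add lookup_single when_def)
  have "Poly_Mapping.keys (?m T) = T" by (auto simp: in_keys_iff l[unfolded One_nat_def])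
  then show ?thesis by (simp add: homogeneous_def mono l[unfolded One_nat_def])
qed

lemma homogeneous_const_mult: "homogeneous k p \<Longrightarrow> homogeneous k (const c * p)"
proof -
  have "Poly_Mapping.keys (const c * p) \<subseteq> Poly_Mapping.keys p"
    using keys_mult[of "const c" p] by (auto simp: const_def split: if_splits)
  then show "homogeneous k p \<Longrightarrow> homogeneous k (const c * p)" by (auto simp: homogeneous_def)
qed

lemma homogeneous_sum:
  assumes "\<And>i. i \<in> A \<Longrightarrow> homogeneous k (g i)"
  shows "homogeneous k (sum g A)"
  using assms
proof (induction A rule: infinite_finite_induct)
  case (insert x F)
  then show ?case using Poly_Mapping.keys_add[of "g x" "sum g F"] by (fastforce simp: homogeneous_def)
qed (auto simp: homogeneous_def)

section \<open>Classes modulo the Chow ideal and the degree map\<close>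

context
  fixes \<Sigma> :: "'a::real_vector set set" and u :: "'a set \<Rightarrow> 'a"
begin

abbreviation (input) "chow_polys \<equiv> carrier (mpoly_ring (cones \<Sigma> 1))"

lemma ideal_I: "ideal (ideal_I \<Sigma>) (mpoly_ring (cones \<Sigma> 1))"
  and ideal_I_monomial:
    "S \<subseteq> cones \<Sigma> 1 \<Longrightarrow> convex_cone hull (\<Union>S) \<notin> \<Sigma> \<Longrightarrow> squarefree_monomial S \<in> ideal_I \<Sigma>"
proof -
  let ?G = "{\<Prod>\<rho>\<in>S. var \<rho> | S. S \<subseteq> cones \<Sigma> 1 \<and> convex_cone hull (\<Union>S) \<notin> \<Sigma>}"
  have G: "?G \<subseteq> chow_polys" by (auto intro!: mpoly_carrier_prod mpoly_carrier)
  interpret cring "mpoly_ring (cones \<Sigma> 1)" by (rule cring_mpoly_ring)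
  show "ideal (ideal_I \<Sigma>) (mpoly_ring (cones \<Sigma> 1))"
    unfolding ideal_I_def chow_poly_ring_def by (rule genideal_ideal[OF G])
  have "?G \<subseteq> ideal_I \<Sigma>"
    unfolding ideal_I_def chow_poly_ring_def by (rule genideal_self[OF G])
  then show "S \<subseteq> cones \<Sigma> 1 \<Longrightarrow> convex_cone hull (\<Union>S) \<notin> \<Sigma> \<Longrightarrow> squarefree_monomial S \<in> ideal_I \<Sigma>"
    unfolding squarefree_monomial_def by blast
qed

lemma ideal_J: "ideal (ideal_J \<Sigma> u) (mpoly_ring (cones \<Sigma> 1))"
  and ideal_J_linear: "linear v \<Longrightarrow> (\<Sum>\<rho>\<in>cones \<Sigma> 1. const (v (u \<rho>)) * var \<rho>) \<in> ideal_J \<Sigma> u"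
proof -
  let ?G = "{\<Sum>\<rho>\<in>cones \<Sigma> 1. const (v (u \<rho>)) * var \<rho> | v. linear v}"
  have G: "?G \<subseteq> chow_polys" by (auto intro!: mpoly_carrier_sum mpoly_carrier)
  interpret cring "mpoly_ring (cones \<Sigma> 1)" by (rule cring_mpoly_ring)
  show "ideal (ideal_J \<Sigma> u) (mpoly_ring (cones \<Sigma> 1))"
    unfolding ideal_J_def chow_poly_ring_def by (rule genideal_ideal[OF G])
  have "?G \<subseteq> ideal_J \<Sigma> u"
    unfolding ideal_J_def chow_poly_ring_def by (rule genideal_self[OF G])
  then show "linear v \<Longrightarrow> (\<Sum>\<rho>\<in>cones \<Sigma> 1. const (v (u \<rho>)) * var \<rho>) \<in> ideal_J \<Sigma> u" by blast
qed

lemma ideal_chow: "ideal (chow_ideal \<Sigma> u) (mpoly_ring (cones \<Sigma> 1))"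
proof -
  interpret cring "mpoly_ring (cones \<Sigma> 1)" by (rule cring_mpoly_ring)
  show ?thesis
    unfolding chow_ideal_def chow_poly_ring_def by (rule add_ideals[OF ideal_I ideal_J])
qed

lemma chow_ideal_supset: "ideal_I \<Sigma> \<subseteq> chow_ideal \<Sigma> u" "ideal_J \<Sigma> u \<subseteq> chow_ideal \<Sigma> u"
proof -
  have 0: "0 \<in> ideal_I \<Sigma>" "0 \<in> ideal_J \<Sigma> u"
    using additive_subgroup.zero_closed[OF ideal.axioms(1)[OF ideal_I]]
      additive_subgroup.zero_closed[OF ideal.axioms(1)[OF ideal_J]]
    by (simp_all add: mpoly_ring_simps)
  have "a + b \<in> chow_ideal \<Sigma> u" if "a \<in> ideal_I \<Sigma>" "b \<in> ideal_J \<Sigma> u" for a b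
    using that by (auto simp: chow_ideal_def set_add_defs chow_poly_ring_def mpoly_ring_def)
  from this[OF _ 0(2)] this[OF 0(1)]
  show "ideal_I \<Sigma> \<subseteq> chow_ideal \<Sigma> u" "ideal_J \<Sigma> u \<subseteq> chow_ideal \<Sigma> u" by auto
qed

lemma chow_ideal_closed:
  "0 \<in> chow_ideal \<Sigma> u"
  "p \<in> chow_ideal \<Sigma> u \<Longrightarrow> p \<in> chow_polys"
  "p \<in> chow_ideal \<Sigma> u \<Longrightarrow> q \<in> chow_ideal \<Sigma> u \<Longrightarrow> p + q \<in> chow_ideal \<Sigma> u"
  "p \<in> chow_ideal \<Sigma> u \<Longrightarrow> q \<in> chow_polys \<Longrightarrow> q * p \<in> chow_ideal \<Sigma> u"
proof -
  note a = ideal.axioms(1)[OF ideal_chow]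
  show "0 \<in> chow_ideal \<Sigma> u" using additive_subgroup.zero_closed[OF a] by (simp add: mpoly_ring_simps)
  show "p \<in> chow_ideal \<Sigma> u \<Longrightarrow> p \<in> chow_polys" by (rule ideal.Icarr[OF ideal_chow])
  show "p \<in> chow_ideal \<Sigma> u \<Longrightarrow> q \<in> chow_ideal \<Sigma> u \<Longrightarrow> p + q \<in> chow_ideal \<Sigma> u"
    using additive_subgroup.a_closed[OF a, of p q] by (simp add: mpoly_ring_simps)
  show "p \<in> chow_ideal \<Sigma> u \<Longrightarrow> q \<in> chow_polys \<Longrightarrow> q * p \<in> chow_ideal \<Sigma> u"
    using ideal.I_l_closed[OF ideal_chow, of p q] by (simp add: mpoly_ring_simps)
qed

lemma chow_ideal_sum: "(\<And>i. i \<in> A \<Longrightarrow> g i \<in> chow_ideal \<Sigma> u) \<Longrightarrow> sum g A \<in> chow_ideal \<Sigma> u"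
  by (induction A rule: infinite_finite_induct) (auto intro: chow_ideal_closed)

lemma cring_chow_ring: "cring (chow_ring \<Sigma> u)"
  unfolding chow_ring_def chow_poly_ring_def
  by (rule ideal.quotient_is_cring[OF ideal_chow cring_mpoly_ring])

lemma chow_class_hom:
  assumes "p \<in> chow_polys" "q \<in> chow_polys"
  shows "chow_class \<Sigma> u p \<in> carrier (chow_ring \<Sigma> u)"
    "chow_class \<Sigma> u (p + q) = chow_class \<Sigma> u p \<oplus>\<^bsub>chow_ring \<Sigma> u\<^esub> chow_class \<Sigma> u q"
    "chow_class \<Sigma> u (p * q) = chow_class \<Sigma> u p \<otimes>\<^bsub>chow_ring \<Sigma> u\<^esub> chow_class \<Sigma> u q"
proof -
  have "chow_class \<Sigma> u \<in> ring_hom (mpoly_ring (cones \<Sigma> 1)) (chow_ring \<Sigma> u)"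
    using ideal.rcos_ring_hom[OF ideal_chow]
    by (simp add: chow_class_def[abs_def] chow_ring_def chow_poly_ring_def)
  note h = ring_hom_memE(1)[OF this, of p] ring_hom_memE(2,3)[OF this, of p q]
  show "chow_class \<Sigma> u p \<in> carrier (chow_ring \<Sigma> u)"
    "chow_class \<Sigma> u (p + q) = chow_class \<Sigma> u p \<oplus>\<^bsub>chow_ring \<Sigma> u\<^esub> chow_class \<Sigma> u q"
    "chow_class \<Sigma> u (p * q) = chow_class \<Sigma> u p \<otimes>\<^bsub>chow_ring \<Sigma> u\<^esub> chow_class \<Sigma> u q"
    using h assms by (simp_all add: mpoly_ring_simps)
qed

lemma chow_class_1: "chow_class \<Sigma> u 1 = \<one>\<^bsub>chow_ring \<Sigma> u\<^esub>"
proof -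
  have "chow_class \<Sigma> u \<in> ring_hom (mpoly_ring (cones \<Sigma> 1)) (chow_ring \<Sigma> u)"
    using ideal.rcos_ring_hom[OF ideal_chow]
    by (simp add: chow_class_def[abs_def] chow_ring_def chow_poly_ring_def)
  from ring_hom_memE(4)[OF this] show ?thesis by (simp add: mpoly_ring_simps)
qed

lemma chow_class_ideal:
  assumes "r \<in> chow_ideal \<Sigma> u"
  shows "chow_class \<Sigma> u r = \<zero>\<^bsub>chow_ring \<Sigma> u\<^esub>"
proof -
  interpret R: cring "mpoly_ring (cones \<Sigma> 1)" by (rule cring_mpoly_ring)
  have "abelian_subgroup (chow_ideal \<Sigma> u) (mpoly_ring (cones \<Sigma> 1))"
    using abelian_subgroupI3[OF ideal.axioms(1)[OF ideal_chow] R.is_abelian_group] .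
  from abelian_subgroup.a_rcos_const[OF this assms] show ?thesis
    by (simp add: chow_class_def chow_ring_def chow_poly_ring_def FactRing_def)
qed

lemma chow_class_cong:
  assumes "p \<in> chow_polys" "r \<in> chow_ideal \<Sigma> u"
  shows "chow_class \<Sigma> u (p + r) = chow_class \<Sigma> u p"
proof -
  interpret Q: cring "chow_ring \<Sigma> u" by (rule cring_chow_ring)
  show ?thesis
    using chow_class_hom[OF assms(1) chow_ideal_closed(2)[OF assms(2)]] chow_class_ideal[OF assms(2)]
    by simp
qed

lemma chow_class_sum:
  assumes "finite A" "\<And>i. i \<in> A \<Longrightarrow> g i \<in> chow_polys"
  shows "chow_class \<Sigma> u (sum g A) = (\<Oplus>\<^bsub>chow_ring \<Sigma> u\<^esub>i\<in>A. chow_class \<Sigma> u (g i))"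
  using assms
proof (induction A rule: finite_induct)
  case empty
  interpret Q: cring "chow_ring \<Sigma> u" by (rule cring_chow_ring)
  show ?case by (simp add: chow_class_ideal chow_ideal_closed)
next
  case (insert x F)
  interpret Q: cring "chow_ring \<Sigma> u" by (rule cring_chow_ring)
  have "sum g F \<in> chow_polys" using insert.prems by (intro mpoly_carrier_sum) auto
  then show ?case
    using insert by (subst Q.finsum_insert) (auto simp: chow_class_hom)
qed

lemma chow_class_prod:
  assumes "finite A" "\<And>i. i \<in> A \<Longrightarrow> g i \<in> chow_polys"
  shows "chow_class \<Sigma> u (prod g A) = (\<Otimes>\<^bsub>chow_ring \<Sigma> u\<^esub>i\<in>A. chow_class \<Sigma> u (g i))"
  using assms
proof (induction A rule: finite_induct)
  case empty
  interpret Q: cring "chow_ring \<Sigma> u" by (rule cring_chow_ring)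
  show ?case by (simp add: chow_class_1)
next
  case (insert x F)
  interpret Q: cring "chow_ring \<Sigma> u" by (rule cring_chow_ring)
  have "prod g F \<in> chow_polys" using insert.prems by (intro mpoly_carrier_prod) auto
  then show ?case
    using insert by (subst Q.finprod_insert) (auto simp: chow_class_hom)
qed

lemma chow_class_power:
  assumes "p \<in> chow_polys"
  shows "chow_class \<Sigma> u (p ^ k) = chow_class \<Sigma> u p [^]\<^bsub>chow_ring \<Sigma> u\<^esub> k"
proof (induction k)
  case 0
  interpret Q: cring "chow_ring \<Sigma> u" by (rule cring_chow_ring)
  show ?case by (simp add: chow_class_1)
next
  case (Suc k)
  interpret Q: cring "chow_ring \<Sigma> u" by (rule cring_chow_ring)
  have "chow_class \<Sigma> u (p ^ Suc k) = chow_class \<Sigma> u (p ^ k * p)" by (simp only: power_Suc2)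
  then show ?case using Suc assms by (simp add: chow_class_hom mpoly_carrier_power)
qed

lemma X_cone_eq:
  assumes "finite (rays \<sigma>)" "rays \<sigma> \<subseteq> cones \<Sigma> 1"
  shows "X_cone \<Sigma> u \<sigma> = chow_class \<Sigma> u (squarefree_monomial (rays \<sigma>))"
  unfolding X_cone_def X_ray_def squarefree_monomial_def
  by (rule chow_class_prod[symmetric]) (use assms in \<open>auto intro: mpoly_carrier\<close>)

lemma divisor_eq:
  assumes "finite (cones \<Sigma> 1)"
  shows "divisor \<Sigma> u z = chow_class \<Sigma> u (\<Sum>\<rho>\<in>cones \<Sigma> 1. const (z \<rho>) * var \<rho>)"
proof -
  interpret Q: cring "chow_ring \<Sigma> u" by (rule cring_chow_ring)
  have "divisor \<Sigma> u z = (\<Oplus>\<^bsub>chow_ring \<Sigma> u\<^esub>\<rho>\<in>cones \<Sigma> 1. chow_class \<Sigma> u (const (z \<rho>) * var \<rho>))"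
    unfolding divisor_def chow_scale_def X_ray_def
  proof (rule Q.finsum_cong'[OF refl])
    show "(\<lambda>\<rho>. chow_class \<Sigma> u (const (z \<rho>) * var \<rho>)) \<in> cones \<Sigma> 1 \<rightarrow> carrier (chow_ring \<Sigma> u)"
      by (intro Pi_I chow_class_hom(1)[of _ 0] mpoly_carrier)
  qed (rule chow_class_hom(3)[symmetric]; intro mpoly_carrier)
  also have "\<dots> = chow_class \<Sigma> u (\<Sum>\<rho>\<in>cones \<Sigma> 1. const (z \<rho>) * var \<rho>)"
    by (rule chow_class_sum[symmetric]) (use assms in \<open>auto intro: mpoly_carrier\<close>)
  finally show ?thesis .
qed

text \<open>Linearity of the degree map is available only on the part of degree \<open>d\<close>, so
  every partial sum has to be kept homogeneous.\<close>

lemma degree_map_sum: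
  assumes deg: "degree_map d \<Sigma> u \<omega> deg" and "finite A"
    and "\<And>i. i \<in> A \<Longrightarrow> p i \<in> chow_polys" "\<And>i. i \<in> A \<Longrightarrow> homogeneous d (p i)"
  shows "deg (chow_class \<Sigma> u (\<Sum>i\<in>A. const (c i) * p i)) = (\<Sum>i\<in>A. c i * deg (chow_class \<Sigma> u (p i)))"
proof -
  have graded: "chow_class \<Sigma> u q \<in> chow_graded \<Sigma> u d" if "q \<in> chow_polys" "homogeneous d q" for q
    using that by (auto simp: chow_graded_def chow_poly_ring_def)
  have scale: "deg (chow_class \<Sigma> u (const c * q)) = c * deg (chow_class \<Sigma> u q)"
    if "q \<in> chow_polys" "homogeneous d q" for c q
  proof -
    have "chow_class \<Sigma> u (const c * q) = chow_scale \<Sigma> u c (chow_class \<Sigma> u q)"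
      unfolding chow_scale_def using that by (simp add: chow_class_hom mpoly_carrier)
    then show ?thesis using deg graded[OF that] by (simp add: degree_map_def)
  qed
  show ?thesis
    using assms(2-)
  proof (induction A rule: finite_induct)
    case empty
    \<comment> \<open>The zero polynomial is homogeneous of every degree, and scaling it by 0 shows
      that its class has degree value 0.\<close>
    have "homogeneous d 0" by (simp add: homogeneous_def)
    then show ?case using scale[of 0 0] by (simp add: mpoly_carrier const_0)
  next
    case (insert x F)
    let ?s = "\<Sum>i\<in>F. const (c i) * p i"
    have s: "?s \<in> chow_polys" "homogeneous d ?s"
      using insert.prems by (auto intro!: mpoly_carrier_sum mpoly_carrier homogeneous_sum homogeneous_const_mult)
    have x: "const (c x) * p x \<in> chow_polys" "homogeneous d (const (c x) * p x)" "p x \<in> chow_polys" "homogeneous d (p x)"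
      using insert.prems by (auto intro!: mpoly_carrier homogeneous_const_mult)
    have "deg (chow_class \<Sigma> u (const (c x) * p x + ?s)) =
        deg (chow_class \<Sigma> u (const (c x) * p x)) + deg (chow_class \<Sigma> u ?s)"
      using deg graded[OF s] graded[OF x(1,2)] chow_class_hom(2)[OF x(1) s(1)] by (simp add: degree_map_def)
    then show ?case using insert scale[OF x(3,4)] by simp
  qed
qed

end

text \<open>Subtracting the linear relation of \<open>v\<close> from the divisor makes its coefficients vanish on \<open>T\<close>, so
  that only squarefree monomials remain.\<close>

lemma divisor_times_monomial:
  fixes \<Sigma> :: "'a::euclidean_space set set"
  assumes fan: "simplicial_fan \<Sigma> u" and T: "T \<in> rays ` \<Sigma>" and v: "linear v"
    and a: "\<And>\<rho>. a \<rho> = z \<rho> - v (u \<rho>)" and aT: "\<And>\<rho>. \<rho> \<in> T \<Longrightarrow> a \<rho> = 0"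
  shows "\<exists>r\<in>chow_ideal \<Sigma> u. (\<Sum>\<rho>\<in>cones \<Sigma> 1. const (z \<rho>) * var \<rho>) * squarefree_monomial T =
    (\<Sum>\<rho> | \<rho> \<notin> T \<and> insert \<rho> T \<in> rays ` \<Sigma>. const (a \<rho>) * squarefree_monomial (insert \<rho> T)) + r"
proof -
  let ?V = "cones \<Sigma> 1" and ?x = "squarefree_monomial :: 'a set set \<Rightarrow> _"
  let ?N = "{\<rho>. \<rho> \<notin> T \<and> insert \<rho> T \<in> rays ` \<Sigma>}"
  note T' = fan_complex_independent[OF fan T]
  have finV: "finite ?V" using finite_fan[OF fan] by (simp add: cones_def)
  have N: "?N \<subseteq> ?V" using fan_complex_independent(4)[OF fan] by blast
  \<comment> \<open>\<open>r1\<close> is a multiple of the linear relation and comes from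
    \<open>ideal_J\<close>. In \<open>r2\<close> the terms with \<open>\<rho>\<close> in
    \<open>T\<close> have coefficient 0, and the others are multiples of nonface monomials from
    \<open>ideal_I\<close>.\<close>
  define r1 where "r1 = ?x T * (\<Sum>\<rho>\<in>?V. const (v (u \<rho>)) * var \<rho>)"
  define r2 where "r2 = (\<Sum>\<rho>\<in>?V - ?N. const (a \<rho>) * var \<rho> * ?x T)"
  have "r1 \<in> chow_ideal \<Sigma> u"
    unfolding r1_def
    by (rule chow_ideal_closed(4)[OF subsetD[OF chow_ideal_supset(2) ideal_J_linear[OF v]]
          squarefree_monomial_carrier[OF T'(4)]])
  moreover have "r2 \<in> chow_ideal \<Sigma> u"
    unfolding r2_def
  proof (rule chow_ideal_sum)
    fix \<rho> assume \<rho>: "\<rho> \<in> ?V - ?N"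
    show "const (a \<rho>) * var \<rho> * ?x T \<in> chow_ideal \<Sigma> u"
    proof (cases "\<rho> \<in> T")
      case True
      then show ?thesis by (simp add: aT const_0 chow_ideal_closed)
    next
      case False
      then have "insert \<rho> T \<notin> rays ` \<Sigma>" "insert \<rho> T \<subseteq> ?V" using \<rho> T' by auto
      then have "?x (insert \<rho> T) \<in> chow_ideal \<Sigma> u"
        by (intro subsetD[OF chow_ideal_supset(1)] ideal_I_monomial nonface_cone[OF fan])
      then have "const (a \<rho>) * ?x (insert \<rho> T) \<in> chow_ideal \<Sigma> u"
        by (intro chow_ideal_closed(4) mpoly_carrier(3))
      then show ?thesis by (simp add: squarefree_monomial_insert[OF T'(1) False] mult.assoc)
    qed
  qed
  ultimately have "r1 + r2 \<in> chow_ideal \<Sigma> u" by (rule chow_ideal_closed)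
  moreover have "(\<Sum>\<rho>\<in>?V. const (z \<rho>) * var \<rho>) * ?x T =
      (\<Sum>\<rho>\<in>?N. const (a \<rho>) * ?x (insert \<rho> T)) + (r1 + r2)"
  proof -
    have z: "const (z \<rho>) = const (a \<rho>) + const (v (u \<rho>))" for \<rho>
      by (simp add: a const_add[symmetric])
    have "(\<Sum>\<rho>\<in>?N. const (a \<rho>) * ?x (insert \<rho> T)) = (\<Sum>\<rho>\<in>?N. const (a \<rho>) * var \<rho> * ?x T)"
      by (rule sum.cong) (auto simp: squarefree_monomial_insert[OF T'(1)] mult.assoc)
    moreover have "(\<Sum>\<rho>\<in>?V. const (a \<rho>) * var \<rho> * ?x T) =
        r2 + (\<Sum>\<rho>\<in>?N. const (a \<rho>) * var \<rho> * ?x T)"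
      unfolding r2_def by (rule sum.subset_diff[OF N finV])
    moreover have "(\<Sum>\<rho>\<in>?V. const (z \<rho>) * var \<rho>) * ?x T =
        (\<Sum>\<rho>\<in>?V. const (a \<rho>) * var \<rho> * ?x T) + r1"
      by (simp only: z r1_def distrib_right sum.distrib sum_distrib_right sum_distrib_left mult.commute[of "?x T"])
    ultimately show ?thesis by (simp only: ac_simps)
  qed
  ultimately show ?thesis by blast
qed

text \<open>The hypothesis on \<open>a\<close> is what one application of
  \<open>divisor_times_monomial\<close> consumes. The monomial of a sequence depends only on its
  image, whereas the weight remembers the order.\<close>

lemma divisor_power:
  fixes \<Sigma> :: "'a::euclidean_space set set"
  assumes fan: "simplicial_fan \<Sigma> u"
    and a: "\<And>T. T \<in> rays ` \<Sigma> \<Longrightarrow> \<exists>v. linear v \<and> (\<forall>\<rho>. a T \<rho> = z \<rho> - v (u \<rho>)) \<and> (\<forall>\<rho>\<in>T. a T \<rho> = 0)"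
  shows "\<exists>r\<in>chow_ideal \<Sigma> u. (\<Sum>\<rho>\<in>cones \<Sigma> 1. const (z \<rho>) * var \<rho>) ^ k =
    (\<Sum>f\<in>seqs k (rays ` \<Sigma>). const (seq_weight a k f) * squarefree_monomial (f ` {1..k})) + r"
proof (induction k)
  case 0
  show ?case
  \<comment> \<open>The empty set is a face unless the fan is empty; in that case its monomial,
    which is 1, lies in the ideal and the sum has no terms.\<close>
  proof (cases "{} \<in> rays ` \<Sigma>")
    case True
    then show ?thesis
      by (intro bexI[of _ 0]) (auto simp: seqs_0 seq_weight_0 squarefree_monomial_def const_1 chow_ideal_closed)
  next
    case False
    then have "convex_cone hull (\<Union>{}) \<notin> \<Sigma>" using nonface_cone[OF fan, of "{}"] by simp
    then have "squarefree_monomial {} \<in> chow_ideal \<Sigma> u"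
      using ideal_I_monomial[of "{}"] chow_ideal_supset(1) by blast
    moreover have "seqs 0 (rays ` \<Sigma>) = {}" using False by (auto simp: seqs_def)
    ultimately show ?thesis by (intro bexI[of _ 1]) (auto simp: squarefree_monomial_def)
  qed
next
  case (Suc k)
  let ?L = "\<Sum>\<rho>\<in>cones \<Sigma> 1. const (z \<rho>) * var \<rho> :: 'a set mpoly"
  let ?x = "squarefree_monomial :: 'a set set \<Rightarrow> _" and ?C = "rays ` \<Sigma>"
  let ?N = "\<lambda>f. {\<rho>. \<rho> \<notin> f ` {1..k} \<and> insert \<rho> (f ` {1..k}) \<in> ?C}"
  let ?s = "\<lambda>f. \<Sum>\<rho>\<in>?N f. const (a (f ` {1..k}) \<rho>) * ?x (insert \<rho> (f ` {1..k}))"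
  obtain r where r: "r \<in> chow_ideal \<Sigma> u"
    "?L ^ k = (\<Sum>f\<in>seqs k ?C. const (seq_weight a k f) * ?x (f ` {1..k})) + r"
    using Suc by blast
  have "\<exists>r\<in>chow_ideal \<Sigma> u. ?L * ?x (f ` {1..k}) = ?s f + r" if "f \<in> seqs k ?C" for f
  proof -
    have T: "f ` {1..k} \<in> ?C" using that by (simp add: seqs_def)
    from a[OF this] obtain v where "linear v" "\<And>\<rho>. a (f ` {1..k}) \<rho> = z \<rho> - v (u \<rho>)"
      "\<And>\<rho>. \<rho> \<in> f ` {1..k} \<Longrightarrow> a (f ` {1..k}) \<rho> = 0" by blast
    from divisor_times_monomial[where a = "a (f ` {1..k})", OF fan T this] show ?thesis .
  qed
  then have "\<forall>f\<in>seqs k ?C. \<exists>r. r \<in> chow_ideal \<Sigma> u \<and> ?L * ?x (f ` {1..k}) = ?s f + r" by blast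
  from bchoice[OF this] obtain q where q: "\<And>f. f \<in> seqs k ?C \<Longrightarrow> q f \<in> chow_ideal \<Sigma> u"
    "\<And>f. f \<in> seqs k ?C \<Longrightarrow> ?L * ?x (f ` {1..k}) = ?s f + q f" by blast
  define r' where "r' = (\<Sum>f\<in>seqs k ?C. const (seq_weight a k f) * q f) + ?L * r"
  have "?L \<in> carrier (mpoly_ring (cones \<Sigma> 1))" by (intro mpoly_carrier_sum mpoly_carrier)
  then have "r' \<in> chow_ideal \<Sigma> u"
    unfolding r'_def
    by (intro chow_ideal_closed(3) chow_ideal_sum chow_ideal_closed(4) q(1) r(1) mpoly_carrier(3))
  moreover have "?L ^ Suc k =
      (\<Sum>f\<in>seqs (Suc k) ?C. const (seq_weight a (Suc k) f) * ?x (f ` {1..Suc k})) + r'"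
  proof -
    have "L * (\<Sum>f\<in>seqs k ?C. const (seq_weight a k f) * ?x (f ` {1..k})) =
        (\<Sum>f\<in>seqs k ?C. const (seq_weight a k f) * (L * ?x (f ` {1..k})))" for L
      by (simp add: sum_distrib_left mult.left_commute)
    then have "?L ^ Suc k = (\<Sum>f\<in>seqs k ?C. const (seq_weight a k f) * (?L * ?x (f ` {1..k}))) + ?L * r"
      by (simp only: power_Suc r(2) distrib_left)
    also have "(\<Sum>f\<in>seqs k ?C. const (seq_weight a k f) * (?L * ?x (f ` {1..k}))) =
        (\<Sum>f\<in>seqs k ?C. const (seq_weight a k f) * ?s f + const (seq_weight a k f) * q f)"
      by (rule sum.cong) (simp_all only: q(2) distrib_left)
    also have "\<dots> = (\<Sum>f\<in>seqs k ?C. const (seq_weight a k f) * ?s f) +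
        (\<Sum>f\<in>seqs k ?C. const (seq_weight a k f) * q f)" by (rule sum.distrib)
    also have "(\<Sum>f\<in>seqs k ?C. const (seq_weight a k f) * ?s f) =
        (\<Sum>f\<in>seqs (Suc k) ?C. const (seq_weight a (Suc k) f) * ?x (f ` {1..Suc k}))"
      by (subst sum_seqs_Suc[OF fan_complex_finite[OF fan] fan_complex_down[OF fan]])
        (assumption | simp only: seq_weight_Suc image_fun_upd_Suc' const_mult sum_distrib_left mult.assoc)+
    finally show ?thesis by (simp only: r'_def add.assoc)
  qed
  ultimately show ?case by blast
qed

section \<open>Integration on finite products\<close>

text \<open>Fubini peels off one coordinate at a time, each contributing the one-dimensional factor
  \<open>1 / r\<close>. The restriction to \<open>J\<close> keeps the argument in the extensional
  product space.\<close>

lemma nn_integral_PiM_affine: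
  fixes \<beta> :: "'i \<Rightarrow> real"
  assumes "finite J" and r: "r > 0" and g: "g \<in> borel_measurable (Pi\<^sub>M J (\<lambda>_. lborel))"
  shows "(\<integral>\<^sup>+ x. g (\<lambda>i\<in>J. \<beta> i + r * x i) \<partial>Pi\<^sub>M J (\<lambda>_. lborel)) =
    ennreal ((1 / r) ^ card J) * (\<integral>\<^sup>+ x. g x \<partial>Pi\<^sub>M J (\<lambda>_. lborel))"
  using assms(1,3)
proof (induction J arbitrary: g rule: finite_induct)
  case empty
  then show ?case
    by (simp add: PiM_empty nn_integral_count_space_finite)
next
  case (insert j J)
  interpret product_sigma_finite "\<lambda>_::'i. lborel :: real measure" by standard
  let ?M = "\<lambda>J. Pi\<^sub>M J (\<lambda>_::'i. lborel :: real measure)"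
  let ?A = "\<lambda>J x. \<lambda>i\<in>J. \<beta> i + r * x i"
  have A: "?A K \<in> measurable (?M K) (?M K)" for K by (rule measurable_restrict) measurable
  define G where "G x = (\<integral>\<^sup>+ y. g (x(j := y)) \<partial>lborel)" for x
  have G: "G \<in> borel_measurable (?M J)"
    unfolding G_def
    using measurable_compose[OF measurable_add_dim[of j J "\<lambda>_. lborel :: real measure"] insert.prems]
    by (intro lborel.borel_measurable_nn_integral) (simp add: split_beta' fun_upd_def)
  have "(\<integral>\<^sup>+ x. g (?A (insert j J) x) \<partial>?M (insert j J)) =
      (\<integral>\<^sup>+ x. \<integral>\<^sup>+ y. g (?A (insert j J) (x(j := y))) \<partial>lborel \<partial>?M J)"
    by (rule product_nn_integral_insert[OF insert.hyps measurable_compose[OF A insert.prems]])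
  also have "\<dots> = (\<integral>\<^sup>+ x. ennreal (1 / r) * G (?A J x) \<partial>?M J)"
  proof (rule nn_integral_cong)
    fix x assume x: "x \<in> space (?M J)"
    have "?A (insert j J) (x(j := y)) = (?A J x)(j := \<beta> j + r * y)" for y
      using insert.hyps by (auto simp: fun_eq_iff)
    moreover have Ax: "?A J x \<in> space (?M J)" by (simp add: space_PiM)
    have "(\<lambda>y. g ((?A J x)(j := y))) \<in> borel_measurable borel"
      using measurable_comp[OF measurable_component_update[OF Ax insert.hyps(2)] insert.prems]
      by (simp add: comp_def)
    from nn_integral_real_affine[OF this, of r "\<beta> j"] r
    have "(\<integral>\<^sup>+ y. g ((?A J x)(j := y)) \<partial>lborel) =
        ennreal r * (\<integral>\<^sup>+ y. g ((?A J x)(j := \<beta> j + r * y)) \<partial>lborel)" by simp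
    then have "ennreal (1 / r) * (\<integral>\<^sup>+ y. g ((?A J x)(j := y)) \<partial>lborel) =
        (\<integral>\<^sup>+ y. g ((?A J x)(j := \<beta> j + r * y)) \<partial>lborel)"
      using r by (simp add: mult.assoc[symmetric] ennreal_mult[symmetric])
    ultimately show "(\<integral>\<^sup>+ y. g (?A (insert j J) (x(j := y))) \<partial>lborel) =
        ennreal (1 / r) * G (?A J x)" by (simp add: G_def)
  qed
  also have "\<dots> = ennreal (1 / r) * (\<integral>\<^sup>+ x. G (?A J x) \<partial>?M J)"
    by (rule nn_integral_cmult[OF measurable_compose[OF A G]])
  also have "(\<integral>\<^sup>+ x. G (?A J x) \<partial>?M J) = ennreal ((1 / r) ^ card J) * (\<integral>\<^sup>+ x. G x \<partial>?M J)"
    by (rule insert.IH[OF G])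
  also have "(\<integral>\<^sup>+ x. G x \<partial>?M J) = (\<integral>\<^sup>+ x. g x \<partial>?M (insert j J))"
    unfolding G_def by (rule product_nn_integral_insert[OF insert.hyps insert.prems, symmetric])
  finally show ?case
    using insert.hyps r by (simp add: mult.assoc[symmetric] ennreal_mult[symmetric])
qed

text \<open>On every line in direction \<open>i\<close> the function \<open>h\<close> is constant,
  so the line meets the exceptional set in at most one point.\<close>

lemma AE_PiM_neq:
  fixes h :: "('i \<Rightarrow> real) \<Rightarrow> real"
  assumes "finite I" "i \<in> I" and h[measurable]: "h \<in> borel_measurable (Pi\<^sub>M I (\<lambda>_. lborel))"
    and upd: "\<And>y t. h (y(i := t)) = h y"
  shows "AE y in Pi\<^sub>M I (\<lambda>_. lborel). y i \<noteq> h y"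
proof -
  interpret product_sigma_finite "\<lambda>_. lborel :: real measure" by standard
  let ?J = "I - {i}"
  let ?M = "\<lambda>J. Pi\<^sub>M J (\<lambda>_. lborel :: real measure)"
  let ?B = "{y \<in> space (?M I). y i = h y}"
  have I: "I = insert i ?J" using assms by auto
  have B[measurable]: "?B \<in> sets (?M I)"
    using assms(2) by measurable
  have "emeasure (?M I) ?B = (\<integral>\<^sup>+ y. indicator ?B y \<partial>?M (insert i ?J))"
    using I B by simp
  also have "\<dots> = (\<integral>\<^sup>+ x. \<integral>\<^sup>+ t. indicator ?B (x(i := t)) \<partial>lborel \<partial>?M ?J)"
    using assms(1) B I by (intro product_nn_integral_insert) auto
  also have "\<dots> = (\<integral>\<^sup>+ x. 0 \<partial>?M ?J)"
  proof (rule nn_integral_cong)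
    fix x assume "x \<in> space (?M ?J)"
    have "(\<integral>\<^sup>+ t. indicator ?B (x(i := t)) \<partial>lborel) \<le> (\<integral>\<^sup>+ t. indicator {h x} t \<partial>lborel)"
      by (intro nn_integral_mono) (auto simp: indicator_def upd)
    then show "(\<integral>\<^sup>+ t. indicator ?B (x(i := t)) \<partial>lborel) = 0" by simp
  qed
  finally have "emeasure (?M I) ?B = 0" by simp
  then show ?thesis using B by (intro AE_I[of _ _ ?B]) auto
qed

text \<open>The origin of the factor 1/dimension: cross-sections of a pyramid over an
  \<open>n\<close>-dimensional base scale with the \<open>n\<close>-th power of the relative
  distance from the apex. The interval is open at the level of the apex, where
  \<open>pyramid\<close> cannot rescale.\<close>

lemma nn_integral_pyramid_height:
  fixes a b :: real
  assumes "a > 0"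
  shows "(\<integral>\<^sup>+ s. ennreal (((s - b) / a) ^ n) * indicator {b<..b + a} s \<partial>lborel) = ennreal (a / Suc n)"
proof -
  have "(\<integral>\<^sup>+ s. ennreal (((s - b) / a) ^ n) * indicator {b<..b + a} s \<partial>lborel) =
      (\<integral>\<^sup>+ s. ennreal (((s - b) / a) ^ n) * indicator {b..b + a} s \<partial>lborel)"
    using AE_lborel_singleton[of b] by (intro nn_integral_cong_AE) (auto simp: indicator_def)
  also have "\<dots> = ennreal (a / Suc n * ((b + a - b) / a) ^ Suc n - a / Suc n * ((b - b) / a) ^ Suc n)"
  proof -
    have "((\<lambda>s. a / real (Suc n) * ((s - b) / a) ^ Suc n) has_real_derivative ((s - b) / a) ^ n) (at s)" for s
      using assms by (auto intro!: derivative_eq_intros simp del: of_nat_Suc power_Suc)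
    then show ?thesis using assms by (intro nn_integral_FTC_Icc) auto
  qed
  finally show ?thesis using assms by simp
qed

section \<open>Volumes of pseudo-cubical polytopes\<close>

text \<open>A point \<open>v\<close> is recorded by its products \<open>h i = v * u i\<close>. \<open>H\<close> is the inverse Gram matrix, so that
  \<open>coeff h\<close> below are the coefficients of \<open>v\<close> with respect to the \<open>u i\<close>, and \<open>vtx T\<close> is the foot on the
  face spanned by \<open>T\<close>. The last assumption is pseudo-cubicality.\<close>

locale cubical_polytope =
  fixes S :: "'r set" and H :: "'r \<Rightarrow> 'r \<Rightarrow> real" and z :: "'r \<Rightarrow> real" and vtx :: "'r set \<Rightarrow> 'r \<Rightarrow> real"
  assumes fin: "finite S"
    and posdef: "\<And>h. \<exists>i\<in>S. h i \<noteq> 0 \<Longrightarrow> 0 < (\<Sum>i\<in>S. h i * (\<Sum>j\<in>S. H i j * h j))"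
    and vtx_tight: "\<And>T i. T \<subseteq> S \<Longrightarrow> i \<in> T \<Longrightarrow> vtx T i = z i"
    and vtx_supp: "\<And>T i. T \<subseteq> S \<Longrightarrow> i \<in> S - T \<Longrightarrow> (\<Sum>j\<in>S. H i j * vtx T j) = 0"
    and vtx_nonneg: "\<And>T i. T \<subseteq> S \<Longrightarrow> i \<in> T \<Longrightarrow> 0 \<le> (\<Sum>j\<in>S. H i j * vtx T j)"
begin

section \<open>Heights, slices and rays from the apex\<close>

definition coeff :: "('r \<Rightarrow> real) \<Rightarrow> 'r \<Rightarrow> real" where
  "coeff h i = (\<Sum>j\<in>S. H i j * h j)"

definition gap :: "'r set \<Rightarrow> 'r \<Rightarrow> real" where
  "gap T i = z i - vtx T i"

text \<open>Signs of coefficients are required off \<open>T\<close> only. Dilation from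
  \<open>vtx T\<close> preserves them there, because the coefficients of \<open>vtx T\<close> vanish
  off \<open>T\<close>; on \<open>T\<close> it need not preserve them.\<close>

definition slice :: "'r set \<Rightarrow> ('r \<Rightarrow> real) \<Rightarrow> bool" where
  "slice T h \<longleftrightarrow> (\<forall>i\<in>T. h i = z i) \<and> (\<forall>i\<in>S - T. 0 \<le> coeff h i \<and> h i \<le> z i)"

lemma coeff_cong: "(\<And>i. i \<in> S \<Longrightarrow> h i = g i) \<Longrightarrow> coeff h = coeff g"
  by (simp add: coeff_def fun_eq_iff)

lemma coeff_lin: "coeff (\<lambda>i. a * h i + b * g i) i = a * coeff h i + b * coeff g i"
  by (simp add: coeff_def sum.distrib sum_distrib_left algebra_simps)

lemma slice_cong: "T \<subseteq> S \<Longrightarrow> (\<And>i. i \<in> S \<Longrightarrow> h i = g i) \<Longrightarrow> slice T h = slice T g"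
  using coeff_cong[of h g] by (auto simp: slice_def subset_iff)

lemma pos: "\<exists>i\<in>S. h i \<noteq> 0 \<Longrightarrow> 0 < (\<Sum>i\<in>S. h i * coeff h i)"
  unfolding coeff_def by (rule posdef)

lemma coeff_vtx:
  assumes "T \<subseteq> S"
  shows "i \<in> S - T \<Longrightarrow> coeff (vtx T) i = 0" "i \<in> S \<Longrightarrow> 0 \<le> coeff (vtx T) i"
  using vtx_supp[OF assms, of i] vtx_nonneg[OF assms, of i] by (cases "i \<in> T"; simp add: coeff_def)+

text \<open>Adding \<open>i\<close> to \<open>T\<close> moves the foot by \<open>?d\<close>, which
  vanishes on \<open>T\<close> and has no coefficients off \<open>insert i T\<close>. Its quadratic
  form is therefore \<open>?d i * coeff ?d i\<close>, with a nonnegative second factor, and positive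
  definiteness excludes \<open>?d i < 0\<close>. Since \<open>vtx (insert i T) i = z i\<close>, this
  \<open>?d i\<close> is the gap.\<close>

lemma gap_nonneg:
  assumes "T \<subseteq> S" "i \<in> S"
  shows "0 \<le> gap T i"
proof (cases "i \<in> T")
  case False
  let ?d = "\<lambda>j. 1 * vtx (insert i T) j + (- 1) * vtx T j"
  have T': "insert i T \<subseteq> S" using assms by auto
  have "?d j * coeff ?d j = 0" if "j \<in> S - {i}" for j
    unfolding coeff_lin using that assms coeff_vtx(1)[OF T', of j] coeff_vtx(1)[OF assms(1), of j]
      vtx_tight[OF T', of j] vtx_tight[OF assms(1), of j] by (cases "j \<in> T") auto
  then have "(\<Sum>j\<in>S - {i}. ?d j * coeff ?d j) = 0" by (intro sum.neutral ballI)
  then have "(\<Sum>j\<in>S. ?d j * coeff ?d j) = ?d i * coeff ?d i"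
    using sum.remove[OF fin assms(2), of "\<lambda>j. ?d j * coeff ?d j"] by linarith
  moreover have "coeff ?d i \<ge> 0"
    unfolding coeff_lin using coeff_vtx(2)[OF T', of i] coeff_vtx(1)[OF assms(1), of i] False assms by auto
  moreover have "0 < (\<Sum>j\<in>S. ?d j * coeff ?d j)" if "?d i < 0"
    using that assms(2) by (intro pos bexI[of _ i]) auto
  ultimately have "\<not> ?d i < 0" by (auto simp: zero_less_mult_iff)
  then show ?thesis using vtx_tight[OF T', of i] by (simp add: gap_def)
qed (use assms vtx_tight in \<open>auto simp: gap_def\<close>)

text \<open>The ray from the vertex \<open>vtx T\<close> through a point of the slice leaves the slice through one of
  the facets \<open>h \<rho> = z \<rho>\<close>.\<close>

lemma ray_shooting:
  assumes T: "T \<subseteq> S" and h: "slice T h" and ne: "\<exists>i\<in>S. h i \<noteq> vtx T i"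
  obtains \<rho> t where "\<rho> \<in> S - T" "0 < t" "t \<le> 1" "0 < gap T \<rho>" "h \<rho> - vtx T \<rho> = t * gap T \<rho>"
    "slice (insert \<rho> T) (\<lambda>i. vtx T i + (h i - vtx T i) / t)"
proof -
  let ?d = "\<lambda>i. 1 * h i + (- 1) * vtx T i"
  have dT: "?d i = 0" if "i \<in> T" for i
    using that h vtx_tight[OF T] by (simp add: slice_def)
  have cd: "coeff ?d i = coeff h i" if "i \<in> S - T" for i
    unfolding coeff_lin using coeff_vtx(1)[OF T that] by simp
  have ch: "0 \<le> coeff h i" if "i \<in> S - T" for i using that h by (simp add: slice_def)
  have le: "?d i \<le> gap T i" if "i \<in> S - T" for i using that h by (simp add: slice_def gap_def)
  \<comment> \<open>A positive sum has a positive term, so some coordinate exceeds that of the apex.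
    This makes the set \<open>?K\<close> of candidate facets nonempty.\<close>
  have "0 < (\<Sum>i\<in>S. ?d i * coeff ?d i)" using ne by (intro pos) auto
  then obtain i0 where i0: "i0 \<in> S" "0 < ?d i0 * coeff ?d i0"
    by (meson not_less sum_nonpos)
  then have "i0 \<notin> T" using dT[of i0] by auto
  then have i0T: "i0 \<in> S - T" using i0(1) by simp
  have "0 < ?d i0 * coeff h i0" using i0(2) unfolding cd[OF i0T] .
  then have d0: "0 < ?d i0" using ch[OF i0T] unfolding zero_less_mult_iff by linarith
  then have g0: "0 < gap T i0" using le[OF i0T] by simp
  let ?K = "{i \<in> S - T. 0 < gap T i}"
  have K: "finite ?K" "?K \<noteq> {}" using fin i0T g0 by auto
  \<comment> \<open>\<open>1 / t\<close> is the largest dilation from the apex that respects all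
    bounds \<open>h i \<le> z i\<close>, and a maximizer is a facet that is hit. Indices with gap 0
    can be left out: there \<open>?d i \<le> 0\<close>, and dilation preserves the bound.\<close>
  define t where "t = Max ((\<lambda>i. ?d i / gap T i) ` ?K)"
  have "t \<in> (\<lambda>i. ?d i / gap T i) ` ?K" unfolding t_def using K by (intro Max_in) auto
  then obtain \<rho> where \<rho>: "\<rho> \<in> S - T" "0 < gap T \<rho>" "t = ?d \<rho> / gap T \<rho>" by auto
  have tmax: "?d i / gap T i \<le> t" if "i \<in> ?K" for i
    unfolding t_def using that K(1) by (intro Max_ge) auto
  have "0 < ?d i0 / gap T i0" using d0 g0 by simp
  also have "\<dots> \<le> t" using tmax i0T g0 by simp
  finally have t0: "0 < t" .
  have t1: "t \<le> 1" using \<rho> le by simp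
  let ?h' = "\<lambda>i. vtx T i + (h i - vtx T i) / t"
  have d_le: "?d i \<le> t * gap T i" if "i \<in> S - T" for i
  proof (cases "0 < gap T i")
    case True
    then show ?thesis using tmax[of i] that by (simp add: field_simps)
  next
    case False
    then have "gap T i = 0" using gap_nonneg[OF T, of i] that by auto
    then show ?thesis using le[OF that] by simp
  qed
  have h'_le: "?h' i \<le> z i" if "i \<in> S - T" for i
  proof -
    have "(h i - vtx T i) / t \<le> gap T i" using d_le[OF that] t0 by (simp add: field_simps)
    then show ?thesis by (simp add: gap_def)
  qed
  have "coeff ?h' i \<ge> 0" if "i \<in> S - T" for i
  proof -
    have "?h' = (\<lambda>i. 1 * vtx T i + (1 / t) * ?d i)" by (simp add: fun_eq_iff)
    then have "coeff ?h' i = 1 * coeff (vtx T) i + (1 / t) * coeff ?d i"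
      by (simp only: coeff_lin)
    then show ?thesis using coeff_vtx(1)[OF T that] cd[OF that] ch[OF that] t0 by simp
  qed
  moreover have "?h' i = z i" if "i \<in> T" for i using dT[OF that] vtx_tight[OF T that] by simp
  moreover have h\<rho>: "h \<rho> - vtx T \<rho> = t * gap T \<rho>" using \<rho> by simp
  then have "?h' \<rho> = z \<rho>" using t0 by (simp add: h\<rho> gap_def)
  ultimately have "slice (insert \<rho> T) ?h'" using h'_le by (auto simp: slice_def)
  then show ?thesis using that \<rho> t0 t1 h\<rho> by blast
qed

text \<open>The inequalities \<open>0 \<le> coeff h i\<close> with \<open>i \<in> T\<close> are redundant on a slice: \<open>h\<close> is a convex combination
  of \<open>vtx T\<close> and a point of a smaller slice.\<close>

lemma slice_coeff_nonneg:
  assumes "T \<subseteq> S" "slice T h" "i \<in> S"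
  shows "0 \<le> coeff h i"
  using assms(1,2)
proof (induction "card (S - T)" arbitrary: T h rule: less_induct)
  case less
  show ?case
  proof (cases "\<exists>i\<in>S. h i \<noteq> vtx T i")
    case False
    then have "coeff h = coeff (vtx T)" by (intro coeff_cong) auto
    then show ?thesis using coeff_vtx(2)[OF less.prems(1) assms(3)] by simp
  next
    case True
    from True obtain \<rho> t where \<rho>: "\<rho> \<in> S - T" "0 < t" "t \<le> 1" "0 < gap T \<rho>"
        "h \<rho> - vtx T \<rho> = t * gap T \<rho>"
      and sl: "slice (insert \<rho> T) (\<lambda>i. vtx T i + (h i - vtx T i) / t)"
      by (rule ray_shooting[OF less.prems])
    let ?h' = "\<lambda>i. vtx T i + (h i - vtx T i) / t"
    have "S - insert \<rho> T \<subset> S - T" using \<rho> by auto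
    then have "card (S - insert \<rho> T) < card (S - T)" using fin by (intro psubset_card_mono) auto
    then have "0 \<le> coeff ?h' i" using less.hyps[OF _ _ sl] \<rho> less.prems by auto
    moreover have "h = (\<lambda>i. (1 - t) * vtx T i + t * ?h' i)" using \<rho> by (auto simp: fun_eq_iff field_simps)
    then have "coeff h i = (1 - t) * coeff (vtx T) i + t * coeff ?h' i" using coeff_lin by metis
    ultimately show ?thesis using coeff_vtx(2)[OF less.prems(1) assms(3)] \<rho> by simp
  qed
qed

text \<open>Converse to \<open>ray_shooting\<close>. The sign of \<open>coeff g\<close> at the new
  index \<open>\<rho>\<close> is not part of the smaller slice and comes from
  \<open>slice_coeff_nonneg\<close>.\<close>

lemma slice_join:
  assumes "T \<subseteq> S" "\<rho> \<in> S - T" and g: "slice (insert \<rho> T) g" and t: "0 \<le> t" "t \<le> 1"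
  shows "slice T (\<lambda>i. (1 - t) * vtx T i + t * g i)"
  unfolding slice_def
proof (intro conjI ballI)
  fix i assume "i \<in> T"
  then have "vtx T i = z i" "g i = z i" using vtx_tight[OF assms(1)] g by (auto simp: slice_def)
  then show "(1 - t) * vtx T i + t * g i = z i" by (simp add: algebra_simps)
next
  have T': "insert \<rho> T \<subseteq> S" using assms by auto
  fix i assume i: "i \<in> S - T"
  show "0 \<le> coeff (\<lambda>i. (1 - t) * vtx T i + t * g i) i"
    unfolding coeff_lin using i t slice_coeff_nonneg[OF T' g, of i] coeff_vtx(2)[OF assms(1), of i] by simp
  have "vtx T i \<le> z i" using gap_nonneg[OF assms(1), of i] i by (simp add: gap_def)
  moreover have "g i \<le> z i" using g i by (cases "i = \<rho>") (auto simp: slice_def)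
  ultimately show "(1 - t) * vtx T i + t * g i \<le> z i"
    using convex_bound_le[of "vtx T i" "z i" "g i" "1 - t" t] t by simp
qed

section \<open>Volumes of sections and pyramids\<close>

abbreviation leb :: "'r set \<Rightarrow> ('r \<Rightarrow> real) measure" where
  "leb I \<equiv> Pi\<^sub>M I (\<lambda>_. lborel)"

definition fill :: "'r set \<Rightarrow> ('r \<Rightarrow> real) \<Rightarrow> 'r \<Rightarrow> real" where
  "fill T y i = (if i \<in> T then z i else y i)"

text \<open>Only the coordinates off \<open>T\<close> are free, so the section is measured in
  dimension \<open>card (S - T)\<close>; for \<open>T = S\<close> it is a single point.\<close>

definition section_polytope :: "'r set \<Rightarrow> ('r \<Rightarrow> real) set" where
  "section_polytope T = {y \<in> space (leb (S - T)). slice T (fill T y)}"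

text \<open>The pyramid with apex \<open>vtx T\<close> over the facet \<open>h \<rho> = z \<rho>\<close>: rescaling from the apex by the inverse of
  the relative height of \<open>y\<close> moves \<open>y\<close> into the facet. If \<open>gap T \<rho> = 0\<close> the pyramid is flat, and it is
  replaced by the empty set.\<close>

definition pyramid :: "'r set \<Rightarrow> 'r \<Rightarrow> ('r \<Rightarrow> real) set" where
  "pyramid T \<rho> = {y \<in> space (leb (S - T)). 0 < gap T \<rho> \<and> vtx T \<rho> < y \<rho> \<and> y \<rho> \<le> z \<rho> \<and>
     (\<lambda>i\<in>S - insert \<rho> T. vtx T i + (y i - vtx T i) / ((y \<rho> - vtx T \<rho>) / gap T \<rho>))
       \<in> section_polytope (insert \<rho> T)}"

lemma section_polytope_sets[measurable]: "section_polytope T \<in> sets (leb (S - T))"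
proof -
  have f: "(\<lambda>y. fill T y i) \<in> borel_measurable (leb (S - T))" if "i \<in> S" for i
    unfolding fill_def using that by (cases "i \<in> T") auto
  have c: "(\<lambda>y. coeff (fill T y) i) \<in> borel_measurable (leb (S - T))" for i
    unfolding coeff_def using f by (intro borel_measurable_sum borel_measurable_times) auto
  have "section_polytope T = {y \<in> space (leb (S - T)). \<forall>i\<in>S - T. 0 \<le> coeff (fill T y) i \<and> fill T y i \<le> z i}"
    by (auto simp: section_polytope_def slice_def fill_def)
  also have "\<dots> \<in> sets (leb (S - T))"
    using fin f c by (intro sets.sets_Collect_finite_All sets.sets_Collect_conj) auto
  finally show ?thesis .
qed

text \<open>The dilation fixes the coordinates in \<open>T\<close>, where apex and point both have
  the value \<open>z\<close>, and moves coordinate \<open>\<rho>\<close> to \<open>z \<rho>\<close>.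
  So one formula in \<open>fill T y\<close> covers all coordinates of the point on the
  facet.\<close>

lemma pyramid_iff:
  assumes "T \<subseteq> S" "\<rho> \<in> S - T" and y: "y \<in> space (leb (S - T))"
  shows "y \<in> pyramid T \<rho> \<longleftrightarrow>
    (0 < gap T \<rho> \<and> vtx T \<rho> < y \<rho> \<and> y \<rho> \<le> z \<rho> \<and>
     slice (insert \<rho> T) (\<lambda>i. vtx T i + (fill T y i - vtx T i) / ((y \<rho> - vtx T \<rho>) / gap T \<rho>)))"
proof -
  let ?t = "(y \<rho> - vtx T \<rho>) / gap T \<rho>"
  let ?w = "\<lambda>i\<in>S - insert \<rho> T. vtx T i + (y i - vtx T i) / ?t"
  let ?h = "\<lambda>i. vtx T i + (fill T y i - vtx T i) / ?t"
  have "slice (insert \<rho> T) (fill (insert \<rho> T) ?w) = slice (insert \<rho> T) ?h"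
    if "0 < gap T \<rho>" "vtx T \<rho> < y \<rho>"
  proof (rule slice_cong)
    fix i assume "i \<in> S"
    consider "i \<in> T" | "i = \<rho>" | "i \<in> S - insert \<rho> T" using \<open>i \<in> S\<close> by blast
    then show "fill (insert \<rho> T) ?w i = ?h i"
    proof cases
      case 1
      then show ?thesis using vtx_tight[OF assms(1)] by (simp add: fill_def)
    next
      case 2
      have "vtx T \<rho> + (y \<rho> - vtx T \<rho>) / ?t = z \<rho>" using that by (simp add: gap_def)
      then show ?thesis using 2 assms(2) by (simp add: fill_def)
    next
      case 3
      then show ?thesis by (auto simp: fill_def)
    qed
  qed (use assms in auto)
  moreover have "?w \<in> space (leb (S - insert \<rho> T))" by (simp add: space_PiM)
  ultimately show ?thesis using y by (auto simp: pyramid_def section_polytope_def)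
qed

lemma pyramid_sets[measurable]:
  assumes "\<rho> \<in> S - T"
  shows "pyramid T \<rho> \<in> sets (leb (S - T))"
proof -
  have comp: "(\<lambda>y. y i) \<in> borel_measurable (leb (S - T))" if "i \<in> S - T" for i using that by simp
  have "(\<lambda>y. \<lambda>i\<in>S - insert \<rho> T. vtx T i + (y i - vtx T i) / ((y \<rho> - vtx T \<rho>) / gap T \<rho>))
      \<in> measurable (leb (S - T)) (leb (S - insert \<rho> T))"
    by (rule measurable_restrict) (use assms in measurable)
  note [measurable] = this measurable_sets[OF this section_polytope_sets]
  show ?thesis unfolding pyramid_def using assms comp by measurable
qed

text \<open>Away from the apex \<open>ray_shooting\<close> covers the section by pyramids, and
  \<open>slice_join\<close> keeps the pyramids inside it. Two pyramids share only points with equal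
  relative heights, a null set.\<close>

lemma AE_pyramid_decomposition:
  assumes T: "T \<subseteq> S" "T \<noteq> S"
  shows "AE y in leb (S - T). indicator (section_polytope T) y =
    (\<Sum>\<rho>\<in>S - T. indicator (pyramid T \<rho>) y :: ennreal)"
proof -
  let ?I = "S - T"
  let ?g = "\<lambda>\<rho> \<eta> y. vtx T \<rho> + (y \<eta> - vtx T \<eta>) * gap T \<rho> / gap T \<eta>"
  have finI: "finite ?I" using fin by simp
  have "AE y in leb ?I. \<forall>\<rho>\<in>?I. y \<rho> \<noteq> vtx T \<rho>"
    using finI by (intro AE_finite_allI AE_PiM_neq) auto
  moreover have "AE y in leb ?I. \<forall>\<rho>\<in>?I. \<forall>\<eta>\<in>?I - {\<rho>}. y \<rho> \<noteq> ?g \<rho> \<eta> y"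
  proof (intro AE_finite_allI AE_PiM_neq)
    fix \<rho> \<eta> assume "\<rho> \<in> ?I" "\<eta> \<in> ?I - {\<rho>}"
    then show "?g \<rho> \<eta> \<in> borel_measurable (leb ?I)" "\<And>y t. ?g \<rho> \<eta> (y(\<rho> := t)) = ?g \<rho> \<eta> y" by auto
  qed (use finI in auto)
  moreover have "AE y in leb ?I. y \<in> space (leb ?I)" by simp
  ultimately show ?thesis
  proof eventually_elim
    fix y assume ne: "\<forall>\<rho>\<in>?I. y \<rho> \<noteq> vtx T \<rho>" and tie: "\<forall>\<rho>\<in>?I. \<forall>\<eta>\<in>?I - {\<rho>}. y \<rho> \<noteq> ?g \<rho> \<eta> y"
      and y: "y \<in> space (leb ?I)"
    let ?h = "fill T y"
    let ?t = "\<lambda>\<rho>. (y \<rho> - vtx T \<rho>) / gap T \<rho>"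
    have hy: "?h \<rho> = y \<rho>" if "\<rho> \<in> ?I" for \<rho> using that by (simp add: fill_def)
    have uniq: "\<rho> = \<eta>" if mem: "y \<in> pyramid T \<rho>" "y \<in> pyramid T \<eta>" and I: "\<rho> \<in> ?I" "\<eta> \<in> ?I" for \<rho> \<eta>
    proof (rule ccontr)
      assume "\<rho> \<noteq> \<eta>"
      \<comment> \<open>In the pyramid over \<open>a\<close>, the dilation by the inverse of the
        relative height at \<open>a\<close> still satisfies the bound at \<open>b\<close>. Hence the
        relative height at \<open>a\<close> is at least the one at \<open>b\<close>, and membership
        in both forces a tie.\<close>
      have le: "?t b \<le> ?t a" if "y \<in> pyramid T a" "y \<in> pyramid T b" "a \<in> ?I" "b \<in> ?I" "a \<noteq> b" for a b
      proof -
        have g: "0 < gap T a" "vtx T a < y a" "0 < gap T b"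
          and sl: "slice (insert a T) (\<lambda>i. vtx T i + (?h i - vtx T i) / ?t a)"
          using that pyramid_iff[OF T(1) _ y] by blast+
        have "b \<in> S - insert a T" using that by blast
        then have "vtx T b + (?h b - vtx T b) / ?t a \<le> z b" using sl unfolding slice_def by blast
        then have "vtx T b + (y b - vtx T b) / ?t a \<le> z b" unfolding hy[OF that(4)] .
        then have "(y b - vtx T b) / ?t a \<le> gap T b" by (simp add: gap_def)
        moreover have "0 < ?t a" using g by simp
        moreover have "x / c \<le> s" if "x / s \<le> c" "0 < s" "0 < c" for x s c :: real
          using that by (simp add: field_simps)
        ultimately show ?thesis using g(3) by blast
      qed
      have "?t \<rho> = ?t \<eta>"
        using le[OF mem I \<open>\<rho> \<noteq> \<eta>\<close>] le[OF mem(2,1) I(2,1)] \<open>\<rho> \<noteq> \<eta>\<close> by simp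
      moreover have "0 < gap T \<rho>" using mem(1) by (simp add: pyramid_def)
      ultimately have "y \<rho> - vtx T \<rho> = ?t \<eta> * gap T \<rho>" by (simp add: field_simps)
      then have "y \<rho> = ?g \<rho> \<eta> y" by (simp add: algebra_simps)
      then show False using tie I \<open>\<rho> \<noteq> \<eta>\<close> by blast
    qed
    have iff: "y \<in> section_polytope T \<longleftrightarrow> (\<exists>\<rho>\<in>?I. y \<in> pyramid T \<rho>)"
    proof
      assume "y \<in> section_polytope T"
      then have sl: "slice T ?h" by (simp add: section_polytope_def)
      obtain i where "i \<in> ?I" using T by auto
      then have "\<exists>i\<in>S. ?h i \<noteq> vtx T i" using ne hy[of i] by (intro bexI[of _ i]) auto
      then obtain \<rho> t where \<rho>: "\<rho> \<in> ?I" "0 < t" "t \<le> 1" "0 < gap T \<rho>"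
        "?h \<rho> - vtx T \<rho> = t * gap T \<rho>" "slice (insert \<rho> T) (\<lambda>i. vtx T i + (?h i - vtx T i) / t)"
        by (rule ray_shooting[OF T(1) sl])
      have "y \<rho> - vtx T \<rho> = t * gap T \<rho>" using \<rho>(1,5) hy by simp
      moreover from this have "vtx T \<rho> < y \<rho>" using \<rho>(2,4) mult_pos_pos[of t "gap T \<rho>"] by linarith
      moreover have "t = ?t \<rho>" using calculation(1) \<rho>(4) by simp
      moreover have "y \<rho> \<le> z \<rho>"
      proof -
        have "?h \<rho> \<le> z \<rho>" using sl \<rho>(1) unfolding slice_def by blast
        then show ?thesis unfolding hy[OF \<rho>(1)] .
      qed
      ultimately have "y \<in> pyramid T \<rho>"
        using pyramid_iff[OF T(1) \<rho>(1) y] \<rho>(4,6) by simp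
      then show "\<exists>\<rho>\<in>?I. y \<in> pyramid T \<rho>" using \<rho>(1) by blast
    next
      assume "\<exists>\<rho>\<in>?I. y \<in> pyramid T \<rho>"
      then obtain \<rho> where \<rho>: "\<rho> \<in> ?I" "y \<in> pyramid T \<rho>" by blast
      have g: "0 < gap T \<rho>" "vtx T \<rho> < y \<rho>" "y \<rho> \<le> z \<rho>"
        and sl: "slice (insert \<rho> T) (\<lambda>i. vtx T i + (?h i - vtx T i) / ?t \<rho>)"
        using \<rho> pyramid_iff[OF T(1) \<rho>(1) y] by auto
      have t: "0 < ?t \<rho>" "?t \<rho> \<le> 1" using g by (auto simp: gap_def)
      have "slice T (\<lambda>i. (1 - ?t \<rho>) * vtx T i + ?t \<rho> * (vtx T i + (?h i - vtx T i) / ?t \<rho>))"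
        by (rule slice_join[OF T(1) \<rho>(1) sl less_imp_le[OF t(1)] t(2)])
      moreover have join: "(1 - s) * vtx T i + s * (vtx T i + (?h i - vtx T i) / s) = ?h i"
        if "0 < s" for s i using that by (simp add: field_simps)
      ultimately have "slice T ?h" by (simp only: join[OF t(1)])
      then show "y \<in> section_polytope T" using y by (simp add: section_polytope_def)
    qed
    show "indicator (section_polytope T) y = (\<Sum>\<rho>\<in>?I. indicator (pyramid T \<rho>) y :: ennreal)"
    proof (cases "y \<in> section_polytope T")
      case True
      then obtain \<rho> where \<rho>: "\<rho> \<in> ?I" "y \<in> pyramid T \<rho>" using iff by blast
      have "(\<Sum>\<eta>\<in>?I. indicator (pyramid T \<eta>) y :: ennreal) = (\<Sum>\<eta>\<in>?I. if \<eta> = \<rho> then 1 else 0)"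
      proof (rule sum.cong[OF refl])
        fix \<eta> assume \<eta>: "\<eta> \<in> ?I"
        show "(indicator (pyramid T \<eta>) y :: ennreal) = (if \<eta> = \<rho> then 1 else 0)"
        proof (cases "\<eta> = \<rho>")
          case False
          then have "y \<notin> pyramid T \<eta>" using uniq[OF _ \<rho>(2) \<eta> \<rho>(1)] by blast
          then show ?thesis using False by simp
        qed (use \<rho>(2) in simp)
      qed
      then show ?thesis using True \<rho>(1) finI by simp
    next
      case False
      then have "(\<Sum>\<eta>\<in>?I. indicator (pyramid T \<eta>) y :: ennreal) = 0"
        using iff by (intro sum.neutral) (auto simp: indicator_def)
      then show ?thesis using False by simp
    qed
  qed
qed

text \<open>Cavalieri along coordinate \<open>\<rho>\<close>: at height \<open>s\<close> the
  cross-section is the facet shrunk towards the apex by the factor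
  \<open>(s - vtx T \<rho>) / gap T \<rho>\<close>. For gap 0 both sides are zero.\<close>

lemma emeasure_pyramid:
  assumes T: "T \<subseteq> S" and \<rho>: "\<rho> \<in> S - T"
  shows "emeasure (leb (S - T)) (pyramid T \<rho>) =
    ennreal (gap T \<rho> / card (S - T)) * emeasure (leb (S - insert \<rho> T)) (section_polytope (insert \<rho> T))"
proof (cases "0 < gap T \<rho>")
  case False
  then have "gap T \<rho> = 0" using gap_nonneg[OF T, of \<rho>] \<rho> by auto
  moreover have "pyramid T \<rho> = {}" using False by (simp add: pyramid_def)
  ultimately show ?thesis by simp
next
  case gap: True
  interpret product_sigma_finite "\<lambda>_. lborel :: real measure" by standard
  let ?J = "S - insert \<rho> T" and ?P = "section_polytope (insert \<rho> T)"
  let ?a = "gap T \<rho>" and ?b = "vtx T \<rho>"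
  let ?n = "card ?J"
  have I: "S - T = insert \<rho> ?J" using \<rho> by auto
  have J: "finite ?J" "\<rho> \<notin> ?J" using fin by auto
  have cI: "card (S - T) = Suc ?n" unfolding I by (rule card_insert_disjoint[OF J])
  have zb: "z \<rho> = ?b + ?a" by (simp add: gap_def)
  have pyr: "pyramid T \<rho> \<in> sets (leb (insert \<rho> ?J))" using pyramid_sets[OF \<rho>] unfolding I .
  have "emeasure (leb (S - T)) (pyramid T \<rho>) =
      (\<integral>\<^sup>+ y. indicator (pyramid T \<rho>) y \<partial>leb (insert \<rho> ?J))"
    unfolding I by (rule nn_integral_indicator[OF pyr, symmetric])
  also have "\<dots> = (\<integral>\<^sup>+ s. \<integral>\<^sup>+ x. indicator (pyramid T \<rho>) (x(\<rho> := s)) \<partial>leb ?J \<partial>lborel)"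
    by (rule product_nn_integral_insert_rev[OF J]) (rule borel_measurable_indicator[OF pyr])
  also have "\<dots> = (\<integral>\<^sup>+ s. ennreal (((s - ?b) / ?a) ^ ?n) * indicator {?b<..?b + ?a} s *
      emeasure (leb ?J) ?P \<partial>lborel)"
  proof (rule nn_integral_cong)
    fix s :: real
    show "(\<integral>\<^sup>+ x. indicator (pyramid T \<rho>) (x(\<rho> := s)) \<partial>leb ?J) =
        ennreal (((s - ?b) / ?a) ^ ?n) * indicator {?b<..?b + ?a} s * emeasure (leb ?J) ?P"
    proof (cases "s \<in> {?b<..?b + ?a}")
      case False
      then have "x(\<rho> := s) \<notin> pyramid T \<rho>" for x by (auto simp: pyramid_def zb)
      then show ?thesis using False by simp
    next
      case True
      define t where "t = (s - ?b) / ?a"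
      have t: "0 < t" using True gap by (simp add: t_def)
      let ?\<beta> = "\<lambda>i. vtx T i - vtx T i / t"
      have "(\<integral>\<^sup>+ x. indicator (pyramid T \<rho>) (x(\<rho> := s)) \<partial>leb ?J) =
          (\<integral>\<^sup>+ x. indicator ?P (\<lambda>i\<in>?J. ?\<beta> i + (1 / t) * x i) \<partial>leb ?J)"
      proof (rule nn_integral_cong)
        fix x assume "x \<in> space (leb ?J)"
        then have sp: "x(\<rho> := s) \<in> space (leb (S - T))"
          using \<rho> by (auto simp: space_PiM PiE_def extensional_def)
        have "(\<lambda>i\<in>?J. vtx T i + ((x(\<rho> := s)) i - vtx T i) / (((x(\<rho> := s)) \<rho> - ?b) / ?a)) =
            (\<lambda>i\<in>?J. ?\<beta> i + (1 / t) * x i)"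
        proof (rule restrict_ext)
          fix i assume "i \<in> ?J"
          then have "vtx T i + ((x(\<rho> := s)) i - vtx T i) / (((x(\<rho> := s)) \<rho> - ?b) / ?a) =
              vtx T i + (x i - vtx T i) / t" by (auto simp: t_def)
          then show "vtx T i + ((x(\<rho> := s)) i - vtx T i) / (((x(\<rho> := s)) \<rho> - ?b) / ?a) =
              ?\<beta> i + (1 / t) * x i" by (simp add: diff_divide_distrib)
        qed
        then have "x(\<rho> := s) \<in> pyramid T \<rho> \<longleftrightarrow> (\<lambda>i\<in>?J. ?\<beta> i + (1 / t) * x i) \<in> ?P"
          unfolding pyramid_def mem_Collect_eq using True gap zb sp by simp
        then show "indicator (pyramid T \<rho>) (x(\<rho> := s)) =
            (indicator ?P (\<lambda>i\<in>?J. ?\<beta> i + (1 / t) * x i) :: ennreal)"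
          by (simp add: indicator_def)
      qed
      \<comment> \<open>The indicator is pulled back along a dilation by \<open>1 / t\<close>, so
        the volume scales by \<open>t\<close> in each of the \<open>?n\<close> remaining
        coordinates.\<close>
      also have "\<dots> = ennreal ((1 / (1 / t)) ^ ?n) * (\<integral>\<^sup>+ x. indicator ?P x \<partial>leb ?J)"
        using t by (intro nn_integral_PiM_affine J(1) borel_measurable_indicator section_polytope_sets) simp
      also have "\<dots> = ennreal (t ^ ?n) * emeasure (leb ?J) ?P"
        by (simp add: section_polytope_sets)
      finally show ?thesis using True by (simp add: t_def)
    qed
  qed
  also have "\<dots> = (\<integral>\<^sup>+ s. ennreal (((s - ?b) / ?a) ^ ?n) * indicator {?b<..?b + ?a} s \<partial>lborel) *
      emeasure (leb ?J) ?P"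
    by (rule nn_integral_multc) measurable
  also have "\<dots> = ennreal (?a / card (S - T)) * emeasure (leb ?J) ?P"
    unfolding cI nn_integral_pyramid_height[OF gap] ..
  finally show ?thesis .
qed

lemma emeasure_section_polytope:
  assumes T: "T \<subseteq> S" "T \<noteq> S"
  shows "emeasure (leb (S - T)) (section_polytope T) =
    (\<Sum>\<rho>\<in>S - T. ennreal (gap T \<rho> / card (S - T)) *
      emeasure (leb (S - insert \<rho> T)) (section_polytope (insert \<rho> T)))"
proof -
  have "emeasure (leb (S - T)) (section_polytope T) =
      (\<integral>\<^sup>+ y. (\<Sum>\<rho>\<in>S - T. indicator (pyramid T \<rho>) y) \<partial>leb (S - T))"
    using nn_integral_cong_AE[OF AE_pyramid_decomposition[OF T]] by (simp add: section_polytope_sets)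
  also have "\<dots> = (\<Sum>\<rho>\<in>S - T. emeasure (leb (S - T)) (pyramid T \<rho>))"
    by (subst nn_integral_sum) (auto simp: pyramid_sets intro!: sum.cong)
  also have "\<dots> = (\<Sum>\<rho>\<in>S - T. ennreal (gap T \<rho> / card (S - T)) *
      emeasure (leb (S - insert \<rho> T)) (section_polytope (insert \<rho> T)))"
    by (rule sum.cong) (simp_all add: emeasure_pyramid[OF T(1)])
  finally show ?thesis .
qed

lemma emeasure_section_polytope_full: "emeasure (leb (S - S)) (section_polytope S) = 1"
proof -
  have "section_polytope S = space (leb {})" by (auto simp: section_polytope_def slice_def fill_def)
  then show ?thesis by (simp add: PiM_empty)
qed

lemma seq_weight_gap_nonneg: "f \<in> seqs k (Pow S) \<Longrightarrow> 0 \<le> seq_weight gap k f"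
  unfolding seq_weight_def seqs_def by (auto intro!: prod_nonneg gap_nonneg)

text \<open>The quotient of factorials collects the factors \<open>1 / card (S - T)\<close> of the
  first \<open>k\<close> cuts, made in dimensions \<open>card S\<close> down to
  \<open>card S - k + 1\<close>.\<close>

lemma emeasure_polytope_expansion:
  assumes "k \<le> card S"
  shows "emeasure (leb S) (section_polytope {}) =
    (\<Sum>f\<in>seqs k (Pow S). ennreal (seq_weight gap k f * fact (card S - k) / fact (card S)) *
      emeasure (leb (S - f ` {1..k})) (section_polytope (f ` {1..k})))"
  using assms
proof (induction k)
  case 0
  then show ?case by (simp add: seqs_0 seq_weight_0)
next
  case (Suc k)
  let ?n = "card S"
  let ?E = "\<lambda>T. emeasure (leb (S - T)) (section_polytope T)"
  let ?w = "\<lambda>k f. seq_weight gap k f * fact (?n - k) / fact ?n"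
  have "ennreal (?w k f) * ?E (f ` {1..k}) =
      (\<Sum>\<rho> | \<rho> \<notin> f ` {1..k} \<and> insert \<rho> (f ` {1..k}) \<in> Pow S.
        ennreal (?w (Suc k) (f(Suc k := \<rho>))) * ?E ((f(Suc k := \<rho>)) ` {1..Suc k}))"
    if f: "f \<in> seqs k (Pow S)" for f
  proof -
    let ?T = "f ` {1..k}"
    have T: "?T \<subseteq> S" and cT: "card ?T = k" using f by (auto simp: seqs_def card_image)
    then have "?T \<noteq> S" using Suc.prems by auto
    have cST: "card (S - ?T) = ?n - k" using T cT fin by (simp add: card_Diff_subset finite_subset)
    have nk: "?n - k = Suc (?n - Suc k)" using Suc.prems by simp
    have w: "ennreal (?w k f) * ennreal (gap ?T \<rho> / card (S - ?T)) = ennreal (?w (Suc k) (f(Suc k := \<rho>)))"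
      if "\<rho> \<in> S - ?T" for \<rho>
    proof -
      have "?w k f * (gap ?T \<rho> / card (S - ?T)) = ?w (Suc k) (f(Suc k := \<rho>))"
        unfolding cST nk fact_Suc seq_weight_Suc by (simp add: field_simps del: of_nat_Suc)
      moreover have "0 \<le> ?w k f" "0 \<le> gap ?T \<rho> / card (S - ?T)"
        using seq_weight_gap_nonneg[OF f] gap_nonneg[OF T] that by auto
      ultimately show ?thesis by (metis ennreal_mult)
    qed
    have "ennreal (?w k f) * ?E ?T =
        (\<Sum>\<rho>\<in>S - ?T. ennreal (?w k f) * (ennreal (gap ?T \<rho> / card (S - ?T)) * ?E (insert \<rho> ?T)))"
      unfolding emeasure_section_polytope[OF T \<open>?T \<noteq> S\<close>] by (rule sum_distrib_left)
    also have "\<dots> = (\<Sum>\<rho> | \<rho> \<notin> ?T \<and> insert \<rho> ?T \<in> Pow S.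
        ennreal (?w (Suc k) (f(Suc k := \<rho>))) * ?E ((f(Suc k := \<rho>)) ` {1..Suc k}))"
    proof (rule sum.cong)
      show "S - ?T = {\<rho>. \<rho> \<notin> ?T \<and> insert \<rho> ?T \<in> Pow S}" using T by auto
      fix \<rho> assume "\<rho> \<in> {\<rho>. \<rho> \<notin> ?T \<and> insert \<rho> ?T \<in> Pow S}"
      then have "\<rho> \<in> S - ?T" by auto
      then show "ennreal (?w k f) * (ennreal (gap ?T \<rho> / card (S - ?T)) * ?E (insert \<rho> ?T)) =
          ennreal (?w (Suc k) (f(Suc k := \<rho>))) * ?E ((f(Suc k := \<rho>)) ` {1..Suc k})"
        by (simp only: w[symmetric] image_fun_upd_Suc' mult.assoc)
    qed
    finally show ?thesis .
  qed
  then have "emeasure (leb S) (section_polytope {}) = (\<Sum>f\<in>seqs k (Pow S).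
      \<Sum>\<rho> | \<rho> \<notin> f ` {1..k} \<and> insert \<rho> (f ` {1..k}) \<in> Pow S.
        ennreal (?w (Suc k) (f(Suc k := \<rho>))) * ?E ((f(Suc k := \<rho>)) ` {1..Suc k}))"
    using Suc by (simp only: Suc_leD cong: sum.cong)
  also have "\<dots> = (\<Sum>f\<in>seqs (Suc k) (Pow S). ennreal (?w (Suc k) f) * ?E (f ` {1..Suc k}))"
    by (rule sum_seqs_Suc[symmetric]) (use fin finite_subset in auto)
  finally show ?case .
qed

text \<open>After \<open>card S\<close> cuts every remaining section is a point of measure 1, and
  only the heights and the factorial are left.\<close>

lemma measure_cubical_polytope:
  "measure (leb S) (section_polytope {}) = (\<Sum>f\<in>seqs (card S) (Pow S). seq_weight gap (card S) f) / fact (card S)"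
proof -
  let ?n = "card S"
  have "emeasure (leb S) (section_polytope {}) =
      (\<Sum>f\<in>seqs ?n (Pow S). ennreal (seq_weight gap ?n f / fact ?n))"
    unfolding emeasure_polytope_expansion[OF order_refl]
  proof (rule sum.cong[OF refl])
    fix f assume f: "f \<in> seqs ?n (Pow S)"
    then have "f ` {1..?n} = S"
      using fin by (intro card_subset_eq) (auto simp: seqs_def card_image)
    then show "ennreal (seq_weight gap ?n f * fact (?n - ?n) / fact ?n) *
        emeasure (leb (S - f ` {1..?n})) (section_polytope (f ` {1..?n})) =
        ennreal (seq_weight gap ?n f / fact ?n)"
      using emeasure_section_polytope_full by simp
  qed
  also have "\<dots> = ennreal ((\<Sum>f\<in>seqs ?n (Pow S). seq_weight gap ?n f) / fact ?n)"
    unfolding sum_divide_distrib by (rule sum_ennreal) (simp add: seq_weight_gap_nonneg)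
  finally show ?thesis
    by (simp add: measure_def sum_nonneg seq_weight_gap_nonneg)
qed

end

section \<open>The volume polynomial\<close>

text \<open>In the coordinates \<open>ip v (u \<rho>)\<close> the normal polytope becomes
  \<open>section_polytope {}\<close>: its inequalities are upper bounds on coordinates, and
  membership in the cone is nonnegativity of \<open>coeff\<close>.\<close>

lemma coord_volume_normal_polytope:
  fixes \<Sigma> :: "'a::euclidean_space set set"
  assumes fan: "simplicial_fan \<Sigma> u" and ip: "inner_product ip" and \<sigma>: "\<sigma> \<in> \<Sigma>"
    and z: "z \<in> pseudo_cubical \<Sigma> u ip"
  shows "coord_volume u ip \<sigma> (normal_polytope u ip z \<sigma>) =
    (\<Sum>f\<in>seqs (card (rays \<sigma>)) (Pow (rays \<sigma>)). seq_weight (excess u ip z) (card (rays \<sigma>)) f) /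
      fact (card (rays \<sigma>))"
proof -
  let ?S = "rays \<sigma>" and ?m = "dual_vector u ip \<sigma>"
  \<comment> \<open>The Gram matrix of the dual basis is the inverse of the Gram matrix of the
    generators; applied to the products \<open>ip v (u \<eta>)\<close> it returns the coefficients
    of \<open>v\<close>.\<close>
  define H where "H = (\<lambda>\<rho> \<eta>. ip (?m \<rho>) (?m \<eta>))"
  define vtx where "vtx = (\<lambda>T \<rho>. ip (foot u ip z T) (u \<rho>))"
  note S = fan_rays[OF fan \<sigma>]
  note ind = fan_independent[OF fan \<sigma>]
  have T: "finite T" "inj_on u T" "independent (u ` T)" if "T \<subseteq> ?S" for T
    using fan_complex_independent(1-3)[OF fan fan_complex_down[OF fan imageI[OF \<sigma>] that]] .
  have sym: "ip x y = ip y x" for x y using ip by (simp add: inner_product_def)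
  have dual: "ip (?m \<rho>) (u \<eta>) = of_bool (\<eta> = \<rho>)" if "\<rho> \<in> ?S" "\<eta> \<in> ?S" for \<rho> \<eta>
    using dual_vector(2)[OF ip ind that] .
  have dual_coeff: "ip (?m \<rho>) (\<Sum>\<eta>\<in>?S. c \<eta> *\<^sub>R u \<eta>) = c \<rho>" if "\<rho> \<in> ?S" for c \<rho>
  proof -
    have "ip (?m \<rho>) (\<Sum>\<eta>\<in>?S. c \<eta> *\<^sub>R u \<eta>) = (\<Sum>\<eta>\<in>?S. if \<eta> = \<rho> then c \<eta> else 0)"
      unfolding inner_product_simps[OF ip] by (rule sum.cong) (auto simp: dual that)
    then show ?thesis using that S(1) by simp
  qed
  have span_dual: "(\<Sum>\<rho>\<in>?S. h \<rho> *\<^sub>R ?m \<rho>) \<in> span (u ` ?S)" for h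
    by (intro span_sum span_mul dual_vector(1)[OF ip ind])
  have H_sum: "(\<Sum>\<eta>\<in>?S. H \<rho> \<eta> * h \<eta>) = ip (?m \<rho>) (\<Sum>\<eta>\<in>?S. h \<eta> *\<^sub>R ?m \<eta>)" for \<rho> h
    by (simp add: H_def inner_product_simps[OF ip] mult.commute)
  have H_ip: "(\<Sum>\<eta>\<in>?S. H \<rho> \<eta> * ip v (u \<eta>)) = ip (?m \<rho>) v" if "v \<in> span (u ` ?S)" for \<rho> v
  proof -
    have "v = (\<Sum>\<eta>\<in>?S. ip v (u \<eta>) *\<^sub>R ?m \<eta>)"
      by (rule span_products_unique[OF ip that span_dual]) (auto simp: ip_sum_dual_vector[OF ip ind])
    then show ?thesis by (simp add: H_sum)
  qed
  have span_T: "span (u ` T) \<subseteq> span (u ` ?S)" if "T \<subseteq> ?S" for T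
    using that by (intro span_mono) auto
  interpret cubical_polytope ?S H z vtx
  proof
    show "finite ?S" by (rule S(1))
  next
    fix h :: "'a set \<Rightarrow> real" assume "\<exists>\<rho>\<in>?S. h \<rho> \<noteq> 0"
    then obtain \<rho> where \<rho>: "\<rho> \<in> ?S" "h \<rho> \<noteq> 0" by blast
    let ?v = "\<Sum>\<eta>\<in>?S. h \<eta> *\<^sub>R ?m \<eta>"
    have "ip ?v (u \<rho>) = h \<rho>" by (rule ip_sum_dual_vector[OF ip ind \<rho>(1)])
    then have "?v \<noteq> 0" using \<rho>(2) inner_product_simps(8)[OF ip] by metis
    then have "0 < ip ?v ?v" using ip by (simp add: inner_product_def)
    also have "ip ?v ?v = (\<Sum>\<rho>\<in>?S. h \<rho> * ip (?m \<rho>) ?v)"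
      by (simp only: inner_product_simps(4,6)[OF ip])
    finally show "0 < (\<Sum>\<rho>\<in>?S. h \<rho> * (\<Sum>\<eta>\<in>?S. H \<rho> \<eta> * h \<eta>))" by (simp only: H_sum)
  next
    fix T \<rho> assume "T \<subseteq> ?S" "\<rho> \<in> T"
    then show "vtx T \<rho> = z \<rho>" using foot(2)[OF ip T] by (simp add: vtx_def)
  next
    fix T \<rho> assume TS: "T \<subseteq> ?S" and \<rho>: "\<rho> \<in> ?S - T"
    note f = foot(1)[OF ip T[OF TS], where z = z]
    have "ip (?m \<rho>) (foot u ip z T) = 0"
      by (rule ip_span_zero[OF ip f]) (use \<rho> TS in \<open>auto simp: dual subset_iff\<close>)
    then show "(\<Sum>\<eta>\<in>?S. H \<rho> \<eta> * vtx T \<eta>) = 0"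
      unfolding vtx_def using H_ip f span_T[OF TS] by auto
  next
    fix T \<rho> assume TS: "T \<subseteq> ?S" and \<rho>: "\<rho> \<in> T"
    note f = foot[OF ip T[OF TS], where z = z]
    note s = sub_cone[OF fan \<sigma> TS]
    have "\<forall>\<tau>\<in>\<Sigma>. \<tau> \<inter> {v. \<forall>\<rho>\<in>rays \<tau>. ip v (u \<rho>) = z \<rho>} \<noteq> {}"
      using z by (simp add: pseudo_cubical_def)
    from bspec[OF this s(2), unfolded s(3)]
    obtain v where v: "v \<in> convex_cone hull (u ` T)" "\<And>\<eta>. \<eta> \<in> T \<Longrightarrow> ip v (u \<eta>) = z \<eta>"
      by blast
    \<comment> \<open>Pseudo-cubicality for the face spanned by \<open>T\<close> supplies a point of
      that face with the prescribed products. By uniqueness it is the foot, whose coefficients are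
      therefore nonnegative.\<close>
    have "foot u ip z T = v"
      by (rule span_products_unique[OF ip f(1)])
        (use v f(2) convex_cone_hull_subset_span in \<open>auto simp: subset_iff\<close>)
    moreover obtain c where c: "\<forall>\<eta>\<in>T. 0 \<le> c \<eta>" "v = (\<Sum>\<eta>\<in>T. c \<eta> *\<^sub>R u \<eta>)"
      using v(1) unfolding convex_cone_hull_image[OF T(1)[OF TS]] by blast
    moreover have "(\<Sum>\<eta>\<in>T. c \<eta> *\<^sub>R u \<eta>) = (\<Sum>\<eta>\<in>?S. (if \<eta> \<in> T then c \<eta> else 0) *\<^sub>R u \<eta>)"
      by (rule sum.mono_neutral_cong_left) (use S(1) TS in auto)
    ultimately have "ip (?m \<rho>) (foot u ip z T) = c \<rho>"
      using dual_coeff[of \<rho> "\<lambda>\<eta>. if \<eta> \<in> T then c \<eta> else 0"] \<rho> TS by auto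
    then show "0 \<le> (\<Sum>\<eta>\<in>?S. H \<rho> \<eta> * vtx T \<eta>)"
      unfolding vtx_def using H_ip f(1) span_T[OF TS] c(1) \<rho> by auto
  qed
  have gap: "gap = excess u ip z"
    by (intro ext) (simp only: gap_def excess_def, simp only: vtx_def)
  have section_iff: "y \<in> section_polytope {} \<longleftrightarrow>
      y \<in> space (leb ?S) \<and> (\<forall>\<rho>\<in>?S. 0 \<le> (\<Sum>\<eta>\<in>?S. H \<rho> \<eta> * y \<eta>) \<and> y \<rho> \<le> z \<rho>)" for y
    unfolding section_polytope_def slice_def fill_def[abs_def] coeff_def by simp
  let ?\<phi> = "\<lambda>v. \<lambda>\<rho>\<in>?S. ip v (u \<rho>)"
  have "?\<phi> ` normal_polytope u ip z \<sigma> = section_polytope {}"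
  proof
    show "?\<phi> ` normal_polytope u ip z \<sigma> \<subseteq> section_polytope {}"
    proof
      fix y assume "y \<in> ?\<phi> ` normal_polytope u ip z \<sigma>"
      then obtain v where v: "v \<in> \<sigma>" "\<And>\<rho>. \<rho> \<in> ?S \<Longrightarrow> ip v (u \<rho>) \<le> z \<rho>" "y = ?\<phi> v"
        by (auto simp: normal_polytope_def)
      have v_hull: "v \<in> convex_cone hull (u ` ?S)" using v(1) fan_cone_hull[OF fan \<sigma>] by simp
      then obtain c where c: "\<forall>\<rho>\<in>?S. 0 \<le> c \<rho>" "v = (\<Sum>\<rho>\<in>?S. c \<rho> *\<^sub>R u \<rho>)"
        unfolding convex_cone_hull_image[OF S(1)] by blast
      have "(\<Sum>\<eta>\<in>?S. H \<rho> \<eta> * y \<eta>) = c \<rho>" if "\<rho> \<in> ?S" for \<rho>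
      proof -
        have "(\<Sum>\<eta>\<in>?S. H \<rho> \<eta> * y \<eta>) = (\<Sum>\<eta>\<in>?S. H \<rho> \<eta> * ip v (u \<eta>))"
          by (rule sum.cong) (simp_all add: v(3))
        also have "\<dots> = ip (?m \<rho>) v" using H_ip v_hull convex_cone_hull_subset_span by blast
        finally show ?thesis using dual_coeff[OF that] c(2) by simp
      qed
      then show "y \<in> section_polytope {}"
        unfolding section_iff using c(1) v(2,3) by (simp add: space_PiM)
    qed
    show "section_polytope {} \<subseteq> ?\<phi> ` normal_polytope u ip z \<sigma>"
    proof
      fix y assume y: "y \<in> section_polytope {}"
      let ?v = "\<Sum>\<rho>\<in>?S. y \<rho> *\<^sub>R ?m \<rho>"
      obtain c where c: "?v = (\<Sum>\<rho>\<in>?S. c \<rho> *\<^sub>R u \<rho>)"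
        using span_image_coeffs[OF S(1,2) span_dual] by blast
      have "c \<rho> = (\<Sum>\<eta>\<in>?S. H \<rho> \<eta> * y \<eta>)" if "\<rho> \<in> ?S" for \<rho>
        using dual_coeff[OF that, of c] c H_sum by simp
      then have "\<forall>\<rho>\<in>?S. 0 \<le> c \<rho>" using y unfolding section_iff by simp
      then have "?v \<in> convex_cone hull (u ` ?S)"
        unfolding convex_cone_hull_image[OF S(1)] c by blast
      then have "?v \<in> normal_polytope u ip z \<sigma>"
        using y fan_cone_hull[OF fan \<sigma>] unfolding section_iff normal_polytope_def
        by (auto simp: ip_sum_dual_vector[OF ip ind])
      moreover have "y = ?\<phi> ?v"
        using y unfolding section_iff
        by (intro ext) (auto simp: ip_sum_dual_vector[OF ip ind] space_PiM PiE_def extensional_def)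
      ultimately show "y \<in> ?\<phi> ` normal_polytope u ip z \<sigma>" by blast
    qed
  qed
  then show ?thesis
    unfolding coord_volume_def using measure_cubical_polytope gap by simp
qed

lemma labelings_eq_seqs:
  assumes "finite (rays \<sigma>)" "card (rays \<sigma>) = d"
  shows "labelings d \<sigma> = seqs d (Pow (rays \<sigma>))"
proof -
  have "f ` {1..d} = rays \<sigma>" if "f ` {1..d} \<subseteq> rays \<sigma>" "inj_on f {1..d}" for f
    using that assms by (intro card_subset_eq) (auto simp: card_image)
  then show ?thesis by (auto simp: labelings_def seqs_def bij_betw_def)
qed

text \<open>The numerator at \<open>j\<close> is the excess of \<open>f j\<close> over the preceding
  face times the Gram determinant of that face. The Gram determinants cancel successively, down to
  the empty one, which is 1.\<close>

lemma gram_flag_product: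
  fixes \<Sigma> :: "'a::euclidean_space set set"
  assumes fan: "simplicial_fan \<Sigma> u" and ip: "inner_product ip" and \<sigma>: "\<sigma> \<in> \<Sigma>"
    and f: "f \<in> labelings d \<sigma>"
  shows "det_gram ip u \<sigma> * (\<Prod>j=1..d. det_gram_replace ip u (flag_face \<sigma> f j) (f j) z /
    det_gram ip u (flag_face \<sigma> f j)) = seq_weight (excess u ip z) d f"
proof -
  let ?g = "\<lambda>j. det_on (f ` {1..j}) (gram ip u)"
  have inj: "inj_on f {1..d}" and im: "f ` {1..d} = rays \<sigma>"
    using f by (auto simp: labelings_def bij_betw_def)
  note S = fan_rays[OF fan \<sigma>]
  have T: "finite T" "inj_on u T" "independent (u ` T)" if "T \<subseteq> rays \<sigma>" for T
    using fan_complex_independent(1-3)[OF fan fan_complex_down[OF fan imageI[OF \<sigma>] that]] .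
  have sub: "f ` {1..j} \<subseteq> rays \<sigma>" if "j \<le> d" for j using that im by auto
  have g: "?g j \<noteq> 0" if "j \<le> d" for j
    using det_on_gram_pos[OF ip T[OF sub[OF that]]] by simp
  have rep: "det_on (f ` {1..Suc j}) (gram_replace ip u (f (Suc j)) z) =
      excess u ip z (f ` {1..j}) (f (Suc j)) * ?g j" if "Suc j \<le> d" for j
  proof -
    have "{1..Suc j} = insert (Suc j) {1..j}" by auto
    then have "f ` {1..Suc j} = insert (f (Suc j)) (f ` {1..j})" by simp
    moreover have "f (Suc j) \<notin> f ` {1..j}"
    proof
      assume "f (Suc j) \<in> f ` {1..j}"
      then obtain i where "i \<in> {1..j}" "f (Suc j) = f i" by blast
      then show False using inj_onD[OF inj, of "Suc j" i] that by auto
    qed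
    ultimately show ?thesis
      using det_on_gram_replace[OF ip T[OF sub]] that by simp
  qed
  have tel: "?g k * (\<Prod>j=1..k. det_on (f ` {1..j}) (gram_replace ip u (f j) z) / ?g j) =
      seq_weight (excess u ip z) k f" if "k \<le> d" for k
    using that
  proof (induction k)
    case 0
    then show ?case by (simp add: seq_weight_0 det_on_def)
  next
    case (Suc k)
    let ?q = "\<lambda>j. det_on (f ` {1..j}) (gram_replace ip u (f j) z) / ?g j"
    have "?g (Suc k) * (\<Prod>j=1..Suc k. ?q j) = ?g (Suc k) * ?q (Suc k) * (\<Prod>j=1..k. ?q j)"
      by (simp add: prod.nat_ivl_Suc')
    also have "?g (Suc k) * ?q (Suc k) = excess u ip z (f ` {1..k}) (f (Suc k)) * ?g k"
      using g[OF Suc.prems] rep[OF Suc.prems] by simp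
    also have "\<dots> * (\<Prod>j=1..k. ?q j) =
        seq_weight (excess u ip z) k f * excess u ip z (f ` {1..k}) (f (Suc k))"
      using Suc by simp
    also have "\<dots> = seq_weight (excess u ip z) (Suc k) f"
      using seq_weight_Suc[of "excess u ip z" k f "f (Suc k)"] by simp
    finally show ?case .
  qed
  have prod_eq: "(\<Prod>j=1..d. det_gram_replace ip u (flag_face \<sigma> f j) (f j) z / det_gram ip u (flag_face \<sigma> f j)) =
      (\<Prod>j=1..d. det_on (f ` {1..j}) (gram_replace ip u (f j) z) / ?g j)"
    by (rule prod.cong) (simp_all add: det_gram_def det_gram_replace_def flag_face[OF fan \<sigma> f])
  have "det_gram ip u \<sigma> = ?g d" by (simp only: det_gram_def im)
  then show ?thesis by (simp only: prod_eq tel[OF order_refl])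
qed

theorem theorem6p2:
  fixes \<Sigma> :: "'a::euclidean_space set set"
    and u :: "'a set \<Rightarrow> 'a"
    and \<omega> z :: "'a set \<Rightarrow> real"
    and d :: nat
    and ip :: "'a \<Rightarrow> 'a \<Rightarrow> real"
    and deg :: "'a set mpoly set \<Rightarrow> real"
    and D :: "'a set mpoly set"
  assumes "simplicial_tropical_fan d \<Sigma> u \<omega>"
    and "inner_product ip"
    and "degree_map d \<Sigma> u \<omega> deg"
    and "D = divisor \<Sigma> u z"
  shows "Vol_divisor d \<Sigma> u deg D =
           (\<Sum>\<sigma>\<in>cones \<Sigma> d. \<omega> \<sigma> * det_gram ip u \<sigma> *
              (\<Sum>f\<in>labelings d \<sigma>. \<Prod>j=1..d.
                 det_gram_replace ip u (flag_face \<sigma> f j) (f j) z / det_gram ip u (flag_face \<sigma> f j)))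
         \<and> (z \<in> pseudo_cubical \<Sigma> u ip \<longrightarrow>
              Vol_divisor d \<Sigma> u deg D = Vol_normal_complex d \<Sigma> u ip z \<omega>)"
proof -
  note ip = assms(2) and deg = assms(3)
  have fan: "simplicial_fan \<Sigma> u" using assms(1) by (simp add: simplicial_tropical_fan_def)
  let ?a = "excess u ip z" and ?C = "rays ` \<Sigma>"
  let ?w = "\<lambda>f. seq_weight ?a d f" and ?x = "\<lambda>f. squarefree_monomial (f ` {1..d})"
  define L where "L = (\<Sum>\<rho>\<in>cones \<Sigma> 1. const (z \<rho>) * var \<rho>)"
  have L: "L \<in> carrier (mpoly_ring (cones \<Sigma> 1))"
    unfolding L_def by (intro mpoly_carrier_sum mpoly_carrier)
  have finV: "finite (cones \<Sigma> k)" for k using finite_fan[OF fan] by (simp add: cones_def)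
  have lab: "\<sigma> \<in> \<Sigma>" "finite (rays \<sigma>)" "card (rays \<sigma>) = d" "rays \<sigma> \<subseteq> cones \<Sigma> 1"
    if "\<sigma> \<in> cones \<Sigma> d" for \<sigma>
    using that dim_fan_cone[OF fan, of \<sigma>] fan_rays[OF fan, of \<sigma>] rays_subset_cones[OF fan, of \<sigma>]
    by (auto simp: cones_def)
  have "\<exists>v. linear v \<and> (\<forall>\<rho>. ?a T \<rho> = z \<rho> - v (u \<rho>)) \<and> (\<forall>\<rho>\<in>T. ?a T \<rho> = 0)" if "T \<in> ?C" for T
  proof (intro exI conjI allI ballI)
    show "linear (ip (foot u ip z T))" using ip by (simp add: inner_product_def bilinear_def)
    show "?a T \<rho> = z \<rho> - ip (foot u ip z T) (u \<rho>)" for \<rho> by (simp add: excess_def)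
    show "?a T \<rho> = 0" if "\<rho> \<in> T" for \<rho>
      using foot(2)[OF ip fan_complex_independent(1-3)[OF fan \<open>T \<in> ?C\<close>] that] by (simp add: excess_def)
  qed
  from divisor_power[OF fan this, where k = d]
  obtain r where r: "r \<in> chow_ideal \<Sigma> u" "L ^ d = (\<Sum>f\<in>seqs d ?C. const (?w f) * ?x f) + r"
    unfolding L_def by blast
  have x: "?x f \<in> carrier (mpoly_ring (cones \<Sigma> 1))" "homogeneous d (?x f)" if "f \<in> seqs d ?C" for f
  proof -
    have T: "f ` {1..d} \<in> ?C" "card (f ` {1..d}) = d" using that by (auto simp: seqs_def card_image)
    show "?x f \<in> carrier (mpoly_ring (cones \<Sigma> 1))"
      using fan_complex_independent(4)[OF fan T(1)] by (rule squarefree_monomial_carrier)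
    show "homogeneous d (?x f)"
      using homogeneous_squarefree_monomial[OF fan_complex_independent(1)[OF fan T(1)]] T(2) by simp
  qed
  have "D [^]\<^bsub>chow_ring \<Sigma> u\<^esub> d = chow_class \<Sigma> u (L ^ d)"
    unfolding assms(4) divisor_eq[OF finV] L_def[symmetric] by (rule chow_class_power[OF L, symmetric])
  also have "\<dots> = chow_class \<Sigma> u (\<Sum>f\<in>seqs d ?C. const (?w f) * ?x f)"
    unfolding r(2) by (rule chow_class_cong[OF _ r(1)]) (intro mpoly_carrier_sum mpoly_carrier x)
  finally have "Vol_divisor d \<Sigma> u deg D = (\<Sum>f\<in>seqs d ?C. ?w f * deg (chow_class \<Sigma> u (?x f)))"
    unfolding Vol_divisor_def
    using degree_map_sum[OF deg finite_seqs[OF fan_complex_finite[OF fan]] x, where c = ?w] by simp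
  \<comment> \<open>An injective sequence of length \<open>d\<close> exhausts the rays of the face
    it spans, so that face has dimension \<open>d\<close> by \<open>dim_fan_cone\<close>. This
    groups the sequences by the cones in \<open>cones \<Sigma> d\<close>.\<close>
  also have "seqs d ?C = (\<Union>\<sigma>\<in>cones \<Sigma> d. labelings d \<sigma>)"
  proof
    show "seqs d ?C \<subseteq> (\<Union>\<sigma>\<in>cones \<Sigma> d. labelings d \<sigma>)"
    proof
      fix f assume f: "f \<in> seqs d ?C"
      then obtain \<sigma> where \<sigma>: "\<sigma> \<in> \<Sigma>" "f ` {1..d} = rays \<sigma>" and inj: "inj_on f {1..d}"
        by (auto simp: seqs_def)
      have "card (rays \<sigma>) = d" unfolding \<sigma>(2)[symmetric] using inj by (simp add: card_image)
      then have "\<sigma> \<in> cones \<Sigma> d" using \<sigma>(1) dim_fan_cone[OF fan \<sigma>(1)] by (simp add: cones_def)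
      moreover have "f \<in> labelings d \<sigma>"
        using f \<sigma>(2) inj by (auto simp: labelings_def seqs_def bij_betw_def PiE_def)
      ultimately show "f \<in> (\<Union>\<sigma>\<in>cones \<Sigma> d. labelings d \<sigma>)" by blast
    qed
    show "(\<Union>\<sigma>\<in>cones \<Sigma> d. labelings d \<sigma>) \<subseteq> seqs d ?C"
      using lab(1) by (fastforce simp: labelings_def seqs_def bij_betw_def PiE_def)
  qed
  also have "(\<Sum>f\<in>(\<Union>\<sigma>\<in>cones \<Sigma> d. labelings d \<sigma>). ?w f * deg (chow_class \<Sigma> u (?x f))) =
      (\<Sum>\<sigma>\<in>cones \<Sigma> d. \<Sum>f\<in>labelings d \<sigma>. ?w f * deg (chow_class \<Sigma> u (?x f)))"
  proof (rule sum.UNION_disjoint)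
    show "\<forall>\<sigma>\<in>cones \<Sigma> d. finite (labelings d \<sigma>)"
      using lab(2) unfolding labelings_def
      by (intro ballI finite_Collect_conjI disjI1) (auto simp: PiE_def[symmetric] intro!: finite_PiE)
    \<comment> \<open>A sequence determines its set of rays, and the rays determine the
      cone.\<close>
    show "\<forall>\<sigma>\<in>cones \<Sigma> d. \<forall>\<tau>\<in>cones \<Sigma> d. \<sigma> \<noteq> \<tau> \<longrightarrow> labelings d \<sigma> \<inter> labelings d \<tau> = {}"
    proof (intro ballI impI)
      fix \<sigma> \<tau> assume \<sigma>\<tau>: "\<sigma> \<in> cones \<Sigma> d" "\<tau> \<in> cones \<Sigma> d" "\<sigma> \<noteq> \<tau>"
      have "rays \<sigma> = f ` {1..d}" if "f \<in> labelings d \<sigma>" for f \<sigma>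
        using that by (simp add: labelings_def bij_betw_def)
      then have "rays \<sigma> = rays \<tau>" if "f \<in> labelings d \<sigma> \<inter> labelings d \<tau>" for f
        using that by (metis IntE)
      moreover have "rays \<sigma> \<noteq> rays \<tau>"
        using fan_eqI[OF fan lab(1)[OF \<sigma>\<tau>(1)] lab(1)[OF \<sigma>\<tau>(2)]] \<sigma>\<tau>(3) by blast
      ultimately show "labelings d \<sigma> \<inter> labelings d \<tau> = {}" by (metis disjoint_iff IntI)
    qed
  qed (rule finV)
  also have "\<dots> = (\<Sum>\<sigma>\<in>cones \<Sigma> d. \<omega> \<sigma> * (\<Sum>f\<in>labelings d \<sigma>. ?w f))"
  proof (rule sum.cong[OF refl])
    fix \<sigma> assume \<sigma>: "\<sigma> \<in> cones \<Sigma> d"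
    have "deg (chow_class \<Sigma> u (?x f)) = \<omega> \<sigma>" if "f \<in> labelings d \<sigma>" for f
    proof -
      have "f ` {1..d} = rays \<sigma>" using that by (simp add: labelings_def bij_betw_def)
      moreover have "deg (X_cone \<Sigma> u \<sigma>) = \<omega> \<sigma>" using deg \<sigma> unfolding degree_map_def by blast
      ultimately show ?thesis by (simp only: X_cone_eq[OF lab(2,4)[OF \<sigma>]])
    qed
    then show "(\<Sum>f\<in>labelings d \<sigma>. ?w f * deg (chow_class \<Sigma> u (?x f))) =
        \<omega> \<sigma> * (\<Sum>f\<in>labelings d \<sigma>. ?w f)"
      by (simp add: sum_distrib_left mult.commute)
  qed
  finally have vol: "Vol_divisor d \<Sigma> u deg D = (\<Sum>\<sigma>\<in>cones \<Sigma> d. \<omega> \<sigma> * (\<Sum>f\<in>labelings d \<sigma>. ?w f))" .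
  show ?thesis
  proof (intro conjI impI)
    show "Vol_divisor d \<Sigma> u deg D =
        (\<Sum>\<sigma>\<in>cones \<Sigma> d. \<omega> \<sigma> * det_gram ip u \<sigma> *
          (\<Sum>f\<in>labelings d \<sigma>. \<Prod>j=1..d.
             det_gram_replace ip u (flag_face \<sigma> f j) (f j) z / det_gram ip u (flag_face \<sigma> f j)))"
      unfolding vol
      by (rule sum.cong[OF refl])
        (simp only: mult.assoc sum_distrib_left[of "det_gram _ _ _"] gram_flag_product[OF fan ip lab(1)] cong: sum.cong)
  next
    assume z: "z \<in> pseudo_cubical \<Sigma> u ip"
    \<comment> \<open>The factor \<open>1 / fact d\<close> occurs for the polytope and for the
      fundamental simplex, and cancels in the quotient.\<close>
    have "Vol_cone u ip \<sigma> (normal_polytope u ip z \<sigma>) = (\<Sum>f\<in>labelings d \<sigma>. ?w f)"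
      if "\<sigma> \<in> cones \<Sigma> d" for \<sigma>
      using coord_volume_normal_polytope[OF fan ip lab(1)[OF that] z]
        coord_volume_fundamental_simplex[OF ip fan_independent[OF fan lab(1)[OF that]]]
        labelings_eq_seqs[OF lab(2,3)[OF that]] lab(3)[OF that]
      by (simp add: Vol_cone_def)
    then show "Vol_divisor d \<Sigma> u deg D = Vol_normal_complex d \<Sigma> u ip z \<omega>"
      unfolding vol Vol_normal_complex_def by simp
  qed
qed

end
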